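(* Let $k$, $A$, $X=\bigoplus_{i=1}^r X_i$, $Y=\bigoplus_{j=1}^s Y_j$ (with $\operatorname{Hom}_A(X,Y)=0$), the bipartite quiver $K$ and the functor $F$ from finite-dimensional representations of $K$ to finite-dimensional $A$-modules be as described in the context. Then: (1) If $M$ is an indecomposable $K$-representation, then $FM$ is an indecomposable $A$-module. (2) If $M,M'$ are $K$-representations with $FM\simeq FM'$, then $M\simeq M'$.
   Context: Let $k$ be an algebraically closed field and $A$ a (not necessarily finite-dimensional) $k$-algebra. All $A$-modules are finite-dimensional left modules and all quiver representations are finite-dimensional over $k$. For a module $M$ and $a\in A$, $M(a)\in\operatorname{End}_k(M)$ denotes left multiplication by $a$. Fix indecomposable $A$-modules $X_1,\dots,X_r$ (pairwise non-isomorphic) and $Y_1,\dots,Y_s$ (pairwise non-isomorphic), put $X=\bigoplus_i X_i$, $Y=\bigoplus_j Y_j$, and assume $\operatorname{Hom}_A(X,Y)=0$. For $A$-modules $N,M$ let $Z^1_A(N,M)$ be the space of $k$-linear maps $\delta:A\to\operatorname{Hom}_k(N,M)$ with $\delta(ab)=M(a)\delta(b)+\delta(a)N(b)$ for all $a,b\in A$, and let $B^1_A(N,M)\subseteq Z^1_A(N,M)$ be the subspace of the maps $a\mapsto M(a)\circ h-h\circ N(a)$ with $h\in\operatorname{Hom}_k(N,M)$. Both are bifunctors (contravariant in $N$, covariant in $M$). Denote by $Z,B$ their restrictions to $\operatorname{add}(Y)\times\operatorname{add}(X)$. With $\mathcal R$ denoting the radical of an additive category, let $$(\operatorname{Rad}Z)(N,M)=\mathcal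 R_{\operatorname{add}(X)}(X,M)\,Z(N,X)+Z(Y,M)\,\mathcal R_{\operatorname{add}(Y)}(N,Y)$$ (spans of the respective products) and $\overline Z=Z/(\operatorname{Rad}Z+B)$. For all $i,j$ choose a finite subset $\mathcal B_{ij}\subseteq Z(Y_j,X_i)$ whose residue classes form a $k$-basis of $\overline Z(Y_j,X_i)$ (these spaces are assumed finite-dimensional). The quiver $K$ has vertices $Y_1,\dots,Y_s,X_1,\dots,X_r$; its arrows $Y_j\to X_i$ are the elements of $\mathcal B_{ij}$, and there are no other arrows. The functor $F$: for a $K$-representation $M$, as a vector space $FM=\bigl(\bigoplus_i X_i\otimes_k M(X_i)\bigr)\oplus\bigl(\bigoplus_j Y_j\otimes_k M(Y_j)\bigr)$, and $a\in A$ acts by the block matrix $\begin{bmatrix}\bigoplus_i X_i(a)\otimes \mathrm{id}&\zeta(a)\\0&\bigoplus_j Y_j(a)\otimes\mathrm{id}\end{bmatrix}$, where the $(i,j)$-block of $\zeta(a)$ is $\sum_{\alpha\in\mathcal B_{ij}}\alpha(a)\otimes M(\alpha)$. For a homomorphism $f:M\to M'$, $Ff$ is the block diagonal map with blocks $\mathrm{id}_{X_i}\otimes f_{X_i}$ and $\mathrm{id}_{Y_j}\otimes f_{Y_j}$. *)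

theory Defs
  imports
    "HOL-Computational_Algebra.Polynomial"
    "HOL-Library.Function_Algebras"
    "HOL-Library.Product_Plus"
    "Graph_Theory.Digraph"
begin

section \<open>Finite-dimensional vector spaces and linear maps\<close>

text \<open>
  Many vector spaces over the field occur at the same time, so a vector space is a record consisting
  of a scalar multiplication on an ambient type and a carrier that is a subspace of this type. The
  ambient space may be infinite-dimensional and only serves to supply the elements.
\<close>

record ('k, 'v) vspace =
  vcarrier :: "'v set"
  vscale :: "'k \<Rightarrow> 'v \<Rightarrow> 'v"

definition fd_space :: "('k::field, 'v::ab_group_add, 'm) vspace_scheme \<Rightarrow> bool" where
  "fd_space V \<longleftrightarrow> vector_space (vscale V) \<and> module.subspace (vscale V) (vcarrier V) \<and>
     (\<exists>S. finite S \<and> vcarrier V = module.span (vscale V) S)"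

text \<open>
  A linear map between carriers is a function on the ambient type that is 0 outside of the
  carrier. So equality of linear maps is equality of functions, and linear
  combinations of linear maps are taken pointwise.
\<close>

definition hom_k ::
  "('k, 'v::ab_group_add, 'm) vspace_scheme \<Rightarrow> ('k, 'w::ab_group_add, 'n) vspace_scheme \<Rightarrow> ('v \<Rightarrow> 'w) set"
  where
  "hom_k V W = {f. (\<forall>v\<in>vcarrier V. f v \<in> vcarrier W) \<and>
     (\<forall>u\<in>vcarrier V. \<forall>v\<in>vcarrier V. f (u + v) = f u + f v) \<and>
     (\<forall>c. \<forall>v\<in>vcarrier V. f (vscale V c v) = vscale W c (f v)) \<and>
     (\<forall>v. v \<notin> vcarrier V \<longrightarrow> f v = 0)}"

definition on_carrier :: "('k, 'v, 'm) vspace_scheme \<Rightarrow> ('v \<Rightarrow> 'w::zero) \<Rightarrow> 'v \<Rightarrow> 'w" where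
  "on_carrier V f = (\<lambda>v. if v \<in> vcarrier V then f v else 0)"

abbreviation id_on_carrier :: "('k, 'v::zero, 'm) vspace_scheme \<Rightarrow> 'v \<Rightarrow> 'v" where
  "id_on_carrier V \<equiv> on_carrier V (\<lambda>v. v)"

definition internal_direct_sum :: "'v::ab_group_add set \<Rightarrow> 'v set \<Rightarrow> 'v set \<Rightarrow> bool" where
  "internal_direct_sum V U W \<longleftrightarrow> U \<inter> W = {0} \<and> V = {u + w | u w. u \<in> U \<and> w \<in> W}"


section \<open>Tensor products\<close>

text \<open>
  The tensor product of V and W is realised inside the dual of the space of bilinear forms on
  V and W: the pure tensor of v and w is the evaluation of bilinear forms at (v, w), and the tensor
  product is the span of the pure tensors. The value at a function that is not bilinear is 0.
\<close>

definition bilinear_forms ::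
  "('k::field, 'v::ab_group_add, 'm) vspace_scheme \<Rightarrow> ('k, 'w::ab_group_add, 'n) vspace_scheme \<Rightarrow>
   ('v \<Rightarrow> 'w \<Rightarrow> 'k) set" where
  "bilinear_forms V W = {\<beta>.
     (\<forall>u\<in>vcarrier V. \<forall>v\<in>vcarrier V. \<forall>w\<in>vcarrier W. \<beta> (u + v) w = \<beta> u w + \<beta> v w) \<and>
     (\<forall>v\<in>vcarrier V. \<forall>w\<in>vcarrier W. \<forall>z\<in>vcarrier W. \<beta> v (w + z) = \<beta> v w + \<beta> v z) \<and>
     (\<forall>c. \<forall>v\<in>vcarrier V. \<forall>w\<in>vcarrier W. \<beta> (vscale V c v) w = c * \<beta> v w) \<and>
     (\<forall>c. \<forall>v\<in>vcarrier V. \<forall>w\<in>vcarrier W. \<beta> v (vscale W c w) = c * \<beta> v w)}"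

definition pure_tensor ::
  "('k::field, 'v::ab_group_add, 'm) vspace_scheme \<Rightarrow> ('k, 'w::ab_group_add, 'n) vspace_scheme \<Rightarrow>
   'v \<Rightarrow> 'w \<Rightarrow> ('v \<Rightarrow> 'w \<Rightarrow> 'k) \<Rightarrow> 'k" where
  "pure_tensor V W v w = (\<lambda>\<beta>. if \<beta> \<in> bilinear_forms V W then \<beta> v w else 0)"

definition dual_scale :: "'k::field \<Rightarrow> ('b \<Rightarrow> 'k) \<Rightarrow> 'b \<Rightarrow> 'k" where
  "dual_scale c t = (\<lambda>\<beta>. c * t \<beta>)"

definition tensor ::
  "('k::field, 'v::ab_group_add, 'm) vspace_scheme \<Rightarrow> ('k, 'w::ab_group_add, 'n) vspace_scheme \<Rightarrow>
   ('k, ('v \<Rightarrow> 'w \<Rightarrow> 'k) \<Rightarrow> 'k) vspace" where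
  "tensor V W =
    \<lparr> vcarrier = module.span dual_scale {pure_tensor V W v w | v w. v \<in> vcarrier V \<and> w \<in> vcarrier W},
      vscale = dual_scale \<rparr>"

text \<open>
  For linear maps f from V to V' and g from W to W', \<open>tensor_map V' W' f g\<close> is the map
  induced by f and g on tensor products. It sends the pure tensor of v and w to that of f v and g w
  (lemma \<open>tensor_map_pure\<close> below).
\<close>

definition tensor_map ::
  "('k::field, 'v2::ab_group_add, 'm) vspace_scheme \<Rightarrow> ('k, 'w2::ab_group_add, 'n) vspace_scheme \<Rightarrow>
   ('v \<Rightarrow> 'v2) \<Rightarrow> ('w \<Rightarrow> 'w2) \<Rightarrow> (('v \<Rightarrow> 'w \<Rightarrow> 'k) \<Rightarrow> 'k) \<Rightarrow> ('v2 \<Rightarrow> 'w2 \<Rightarrow> 'k) \<Rightarrow> 'k" where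
  "tensor_map V' W' f g t =
     (\<lambda>\<beta>. if \<beta> \<in> bilinear_forms V' W' then t (\<lambda>v w. \<beta> (f v) (g w)) else 0)"

lemma tensor_map_pure:
  assumes "f \<in> hom_k V V'" "g \<in> hom_k W W'" "v \<in> vcarrier V" "w \<in> vcarrier W"
  shows "tensor_map V' W' f g (pure_tensor V W v w) = pure_tensor V' W' (f v) (g w)"
proof -
  have "(\<lambda>v w. \<beta> (f v) (g w)) \<in> bilinear_forms V W" if "\<beta> \<in> bilinear_forms V' W'" for \<beta>
    using that assms(1,2) by (simp add: bilinear_forms_def hom_k_def)
  then show ?thesis
    by (auto simp: tensor_map_def pure_tensor_def fun_eq_iff)
qed


section \<open>Algebras and modules\<close>

definition k_algebra :: "('k::field \<Rightarrow> 'a::ring_1 \<Rightarrow> 'a) \<Rightarrow> bool" where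
  "k_algebra sA \<longleftrightarrow> vector_space sA \<and>
     (\<forall>c a b. sA c (a * b) = sA c a * b \<and> sA c (a * b) = a * sA c b)"

record ('a, 'k, 'v) amodule = "('k, 'v) vspace" +
  act :: "'a \<Rightarrow> 'v \<Rightarrow> 'v"

definition fd_module ::
  "('k::field \<Rightarrow> 'a::ring_1 \<Rightarrow> 'a) \<Rightarrow> ('a, 'k, 'v::ab_group_add) amodule \<Rightarrow> bool" where
  "fd_module sA M \<longleftrightarrow> fd_space M \<and> (\<forall>a. act M a \<in> hom_k M M) \<and>
     (\<forall>a b. act M (a + b) = act M a + act M b) \<and>
     (\<forall>c a. act M (sA c a) = (\<lambda>v. vscale M c (act M a v))) \<and>
     act M 1 = id_on_carrier M \<and>
     (\<forall>a b. act M (a * b) = act M a \<circ> act M b)"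

definition hom_A ::
  "('a, 'k, 'v::ab_group_add) amodule \<Rightarrow> ('a, 'k, 'w::ab_group_add) amodule \<Rightarrow> ('v \<Rightarrow> 'w) set" where
  "hom_A N M = {f \<in> hom_k N M. \<forall>a. f \<circ> act N a = act M a \<circ> f}"

definition iso_A ::
  "('a, 'k, 'v::ab_group_add) amodule \<Rightarrow> ('a, 'k, 'w::ab_group_add) amodule \<Rightarrow> bool" where
  "iso_A N M \<longleftrightarrow> (\<exists>f \<in> hom_A N M. bij_betw f (vcarrier N) (vcarrier M))"

definition submodule :: "('a, 'k::field, 'v::ab_group_add) amodule \<Rightarrow> 'v set \<Rightarrow> bool" where
  "submodule M U \<longleftrightarrow> module.subspace (vscale M) U \<and> U \<subseteq> vcarrier M \<and> (\<forall>a. \<forall>u\<in>U. act M a u \<in> U)"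

definition indecomposable_A ::
  "('k::field \<Rightarrow> 'a::ring_1 \<Rightarrow> 'a) \<Rightarrow> ('a, 'k, 'v::ab_group_add) amodule \<Rightarrow> bool" where
  "indecomposable_A sA M \<longleftrightarrow> fd_module sA M \<and> vcarrier M \<noteq> {0} \<and>
     (\<forall>U W. submodule M U \<and> submodule M W \<and> internal_direct_sum (vcarrier M) U W
        \<longrightarrow> U = {0} \<or> W = {0})"

definition direct_sum ::
  "('i \<Rightarrow> ('a, 'k, 'v::ab_group_add) amodule) \<Rightarrow> ('a, 'k, 'i \<Rightarrow> 'v) amodule" where
  "direct_sum X =
    \<lparr> vcarrier = {x. \<forall>i. x i \<in> vcarrier (X i)},
      vscale = (\<lambda>c x i. vscale (X i) c (x i)),
      act = (\<lambda>a x. if \<forall>i. x i \<in> vcarrier (X i) then (\<lambda>i. act (X i) a (x i)) else 0) \<rparr>"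


section \<open>Cocycles, coboundaries and the radical\<close>

definition Z1 ::
  "('k \<Rightarrow> 'a::ring_1 \<Rightarrow> 'a) \<Rightarrow> ('a, 'k, 'n::ab_group_add) amodule \<Rightarrow> ('a, 'k, 'm::ab_group_add) amodule \<Rightarrow>
   ('a \<Rightarrow> 'n \<Rightarrow> 'm) set" where
  "Z1 sA N M = {\<delta>. (\<forall>a. \<delta> a \<in> hom_k N M) \<and>
     (\<forall>a b. \<delta> (a + b) = \<delta> a + \<delta> b) \<and>
     (\<forall>c a. \<delta> (sA c a) = (\<lambda>v. vscale M c (\<delta> a v))) \<and>
     (\<forall>a b. \<delta> (a * b) = (act M a \<circ> \<delta> b) + (\<delta> a \<circ> act N b))}"

definition B1 ::
  "('a, 'k, 'n::ab_group_add) amodule \<Rightarrow> ('a, 'k, 'm::ab_group_add) amodule \<Rightarrow> ('a \<Rightarrow> 'n \<Rightarrow> 'm) set"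
  where
  "B1 N M = {\<lambda>a. (act M a \<circ> h) - (h \<circ> act N a) | h. h \<in> hom_k N M}"

text \<open>
  The radical of an additive category consists of the morphisms f from N to M such that
  \<open>1 - g \<circ> f\<close> is invertible for all g from M to N. Since add(X) is a full
  subcategory of the category of modules, its morphisms are all homomorphisms of modules.
\<close>

definition rad_hom ::
  "('a, 'k, 'n::ab_group_add) amodule \<Rightarrow> ('a, 'k, 'm::ab_group_add) amodule \<Rightarrow> ('n \<Rightarrow> 'm) set" where
  "rad_hom N M = {f \<in> hom_A N M. \<forall>g \<in> hom_A M N. \<exists>h \<in> hom_A N N.
      h \<circ> (id_on_carrier N - (g \<circ> f)) = id_on_carrier N \<and>
      (id_on_carrier N - (g \<circ> f)) \<circ> h = id_on_carrier N}"

definition cocycle_scale ::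
  "('a, 'k, 'm) amodule \<Rightarrow> 'k \<Rightarrow> ('a \<Rightarrow> 'n \<Rightarrow> 'm) \<Rightarrow> 'a \<Rightarrow> 'n \<Rightarrow> 'm" where
  "cocycle_scale M c \<delta> = (\<lambda>a v. vscale M c (\<delta> a v))"

definition RadZ ::
  "('k::field \<Rightarrow> 'a::ring_1 \<Rightarrow> 'a) \<Rightarrow>
   ('a, 'k, 'x::ab_group_add) amodule \<Rightarrow> ('a, 'k, 'y::ab_group_add) amodule \<Rightarrow>
   ('a, 'k, 'n::ab_group_add) amodule \<Rightarrow> ('a, 'k, 'm::ab_group_add) amodule \<Rightarrow> ('a \<Rightarrow> 'n \<Rightarrow> 'm) set"
  where
  "RadZ sA X Y N M =
     {\<delta> + \<epsilon> | \<delta> \<epsilon>.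
        \<delta> \<in> module.span (cocycle_scale M) {\<lambda>a. \<rho> \<circ> \<zeta> a | \<rho> \<zeta>. \<rho> \<in> rad_hom X M \<and> \<zeta> \<in> Z1 sA N X} \<and>
        \<epsilon> \<in> module.span (cocycle_scale M) {\<lambda>a. \<zeta> a \<circ> \<rho> | \<zeta> \<rho>. \<zeta> \<in> Z1 sA Y M \<and> \<rho> \<in> rad_hom N Y}}"

definition RadZ_plus_B ::
  "('k::field \<Rightarrow> 'a::ring_1 \<Rightarrow> 'a) \<Rightarrow>
   ('a, 'k, 'x::ab_group_add) amodule \<Rightarrow> ('a, 'k, 'y::ab_group_add) amodule \<Rightarrow>
   ('a, 'k, 'n::ab_group_add) amodule \<Rightarrow> ('a, 'k, 'm::ab_group_add) amodule \<Rightarrow> ('a \<Rightarrow> 'n \<Rightarrow> 'm) set"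
  where
  "RadZ_plus_B sA X Y N M = {\<delta> + \<epsilon> | \<delta> \<epsilon>. \<delta> \<in> RadZ sA X Y N M \<and> \<epsilon> \<in> B1 N M}"

text \<open>
  \<open>basis_modulo s V S \<B>\<close>: the residue classes of the elements of the finite set \<open>\<B>\<close> of vectors
  of V are pairwise distinct and form a basis of the quotient space V/S.
\<close>

definition basis_modulo ::
  "('k::field \<Rightarrow> 'v::ab_group_add \<Rightarrow> 'v) \<Rightarrow> 'v set \<Rightarrow> 'v set \<Rightarrow> 'v set \<Rightarrow> bool" where
  "basis_modulo s V S \<B> \<longleftrightarrow> finite \<B> \<and> \<B> \<subseteq> V \<and>
     (\<forall>c. (\<Sum>\<alpha>\<in>\<B>. s (c \<alpha>) \<alpha>) \<in> S \<longrightarrow> (\<forall>\<alpha>\<in>\<B>. c \<alpha> = 0)) \<and>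
     (\<forall>z\<in>V. \<exists>c. z - (\<Sum>\<alpha>\<in>\<B>. s (c \<alpha>) \<alpha>) \<in> S)"


section \<open>Representations of quivers\<close>

record ('k, 'v, 'p, 'e) quiver_rep =
  rspace :: "'p \<Rightarrow> ('k, 'v) vspace"
  rmap :: "'e \<Rightarrow> 'v \<Rightarrow> 'v"

definition fd_rep ::
  "('p, 'e) pre_digraph \<Rightarrow> ('k::field, 'v::ab_group_add, 'p, 'e) quiver_rep \<Rightarrow> bool" where
  "fd_rep Q M \<longleftrightarrow> (\<forall>p\<in>verts Q. fd_space (rspace M p)) \<and>
     (\<forall>e\<in>arcs Q. rmap M e \<in> hom_k (rspace M (tail Q e)) (rspace M (head Q e)))"

definition rep_hom ::
  "('p, 'e) pre_digraph \<Rightarrow> ('k, 'v::ab_group_add, 'p, 'e) quiver_rep \<Rightarrow>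
   ('k, 'w::ab_group_add, 'p, 'e) quiver_rep \<Rightarrow> ('p \<Rightarrow> 'v \<Rightarrow> 'w) \<Rightarrow> bool" where
  "rep_hom Q M M' f \<longleftrightarrow> (\<forall>p\<in>verts Q. f p \<in> hom_k (rspace M p) (rspace M' p)) \<and>
     (\<forall>e\<in>arcs Q. f (head Q e) \<circ> rmap M e = rmap M' e \<circ> f (tail Q e))"

definition rep_iso ::
  "('p, 'e) pre_digraph \<Rightarrow> ('k, 'v::ab_group_add, 'p, 'e) quiver_rep \<Rightarrow>
   ('k, 'w::ab_group_add, 'p, 'e) quiver_rep \<Rightarrow> bool" where
  "rep_iso Q M M' \<longleftrightarrow> (\<exists>f. rep_hom Q M M' f \<and>
     (\<forall>p\<in>verts Q. bij_betw (f p) (vcarrier (rspace M p)) (vcarrier (rspace M' p))))"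

definition subrep ::
  "('p, 'e) pre_digraph \<Rightarrow> ('k::field, 'v::ab_group_add, 'p, 'e) quiver_rep \<Rightarrow> ('p \<Rightarrow> 'v set) \<Rightarrow> bool"
  where
  "subrep Q M U \<longleftrightarrow>
     (\<forall>p\<in>verts Q. module.subspace (vscale (rspace M p)) (U p) \<and> U p \<subseteq> vcarrier (rspace M p)) \<and>
     (\<forall>e\<in>arcs Q. \<forall>u\<in>U (tail Q e). rmap M e u \<in> U (head Q e))"

definition indecomposable_rep ::
  "('p, 'e) pre_digraph \<Rightarrow> ('k::field, 'v::ab_group_add, 'p, 'e) quiver_rep \<Rightarrow> bool" where
  "indecomposable_rep Q M \<longleftrightarrow> fd_rep Q M \<and> (\<exists>p\<in>verts Q. vcarrier (rspace M p) \<noteq> {0}) \<and>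
     (\<forall>U W. subrep Q M U \<and> subrep Q M W \<and>
        (\<forall>p\<in>verts Q. internal_direct_sum (vcarrier (rspace M p)) (U p) (W p)) \<longrightarrow>
        (\<forall>p\<in>verts Q. U p = {0}) \<or> (\<forall>p\<in>verts Q. W p = {0}))"


section \<open>The quiver and the functor\<close>

datatype ('i, 'j) vertex = VX 'i | VY 'j

text \<open>
  The arrow from vertex \<open>VY j\<close> to vertex \<open>VX i\<close> given by \<open>\<alpha> \<in> \<B> i j\<close> is the triple \<open>(i, j, \<alpha>)\<close>:
  one function can belong to several of the sets \<open>\<B> i j\<close>.
\<close>

type_synonym ('i, 'j, 'a, 'x, 'y) arrow = "'i \<times> 'j \<times> ('a \<Rightarrow> 'y \<Rightarrow> 'x)"

definition quiver_K ::
  "('i \<Rightarrow> 'j \<Rightarrow> ('a \<Rightarrow> 'y \<Rightarrow> 'x) set) \<Rightarrow> (('i, 'j) vertex, ('i, 'j, 'a, 'x, 'y) arrow) pre_digraph" where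
  "quiver_K \<B> =
    \<lparr> verts = UNIV,
      arcs = {(i, j, \<alpha>) | i j \<alpha>. \<alpha> \<in> \<B> i j},
      tail = (\<lambda>(i, j, \<alpha>). VY j),
      head = (\<lambda>(i, j, \<alpha>). VX i) \<rparr>"

definition F_space ::
  "('i \<Rightarrow> ('a, 'k::field, 'x::ab_group_add) amodule) \<Rightarrow> ('j \<Rightarrow> ('a, 'k, 'y::ab_group_add) amodule) \<Rightarrow>
   ('k, 'v::ab_group_add, ('i, 'j) vertex, ('i, 'j, 'a, 'x, 'y) arrow) quiver_rep \<Rightarrow>
   ('k, ('i \<Rightarrow> ('x \<Rightarrow> 'v \<Rightarrow> 'k) \<Rightarrow> 'k) \<times> ('j \<Rightarrow> ('y \<Rightarrow> 'v \<Rightarrow> 'k) \<Rightarrow> 'k)) vspace" where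
  "F_space X Y M =
    \<lparr> vcarrier = {(p, q). (\<forall>i. p i \<in> vcarrier (tensor (X i) (rspace M (VX i)))) \<and>
                          (\<forall>j. q j \<in> vcarrier (tensor (Y j) (rspace M (VY j))))},
      vscale = (\<lambda>c (p, q). (\<lambda>i. dual_scale c (p i), \<lambda>j. dual_scale c (q j))) \<rparr>"

definition F_obj ::
  "('i \<Rightarrow> ('a, 'k::field, 'x::ab_group_add) amodule) \<Rightarrow>
   ('j::finite \<Rightarrow> ('a, 'k, 'y::ab_group_add) amodule) \<Rightarrow>
   ('i \<Rightarrow> 'j \<Rightarrow> ('a \<Rightarrow> 'y \<Rightarrow> 'x) set) \<Rightarrow>
   ('k, 'v::ab_group_add, ('i, 'j) vertex, ('i, 'j, 'a, 'x, 'y) arrow) quiver_rep \<Rightarrow>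
   ('a, 'k, ('i \<Rightarrow> ('x \<Rightarrow> 'v \<Rightarrow> 'k) \<Rightarrow> 'k) \<times> ('j \<Rightarrow> ('y \<Rightarrow> 'v \<Rightarrow> 'k) \<Rightarrow> 'k)) amodule" where
  "F_obj X Y \<B> M =
    \<lparr> vcarrier = vcarrier (F_space X Y M), vscale = vscale (F_space X Y M),
      act = (\<lambda>a. on_carrier (F_space X Y M) (\<lambda>(p, q).
        (\<lambda>i. tensor_map (X i) (rspace M (VX i)) (act (X i) a) (id_on_carrier (rspace M (VX i))) (p i) +
             (\<Sum>j\<in>UNIV. \<Sum>\<alpha>\<in>\<B> i j. tensor_map (X i) (rspace M (VX i)) (\<alpha> a) (rmap M (i, j, \<alpha>)) (q j)),
         \<lambda>j. tensor_map (Y j) (rspace M (VY j)) (act (Y j) a) (id_on_carrier (rspace M (VY j))) (q j)))) \<rparr>"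

end

theory Submission
  imports Defs
begin

text \<open>
  Since the field is algebraically closed, an endomorphism of an indecomposable module is a scalar
  plus a nilpotent endomorphism, and every homomorphism between non-isomorphic indecomposable modules
  is radical. As there are no nonzero homomorphisms from \<open>X\<close> to \<open>Y\<close>, a homomorphism from \<open>F M\<close> to
  \<open>F M'\<close> is block triangular, and its diagonal blocks are, modulo the radical, given by linear maps
  \<open>f\<close> from \<open>M p\<close> to \<open>M' p\<close>. Comparing the off-diagonal blocks modulo radical cocycles and
  coboundaries, the linear independence of the residue classes of the arrows shows that \<open>f\<close> is a
  homomorphism of representations. This assignment, the top part of a homomorphism, is functorial and
  inverts \<open>F\<close> on homomorphisms, and an idempotent endomorphism of \<open>F M\<close> with zero top part lies in
  the radical and hence vanishes. So isomorphisms and decompositions descend from \<open>F M\<close> to \<open>M\<close>.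
\<close>

section \<open>Linear maps between carriers\<close>

text \<open>No decomposition of the spaces \<open>M p\<close> into lines is chosen. A vector
  \<open>v\<close> of \<open>M p\<close> gives the inclusion of an indecomposable module into
  \<open>F M\<close> that tensors with \<open>v\<close>, and a functional \<open>\<xi>\<close> gives
  a contraction back. The entry of a homomorphism at \<open>\<xi>\<close> and \<open>v\<close> is
  then a map between indecomposable modules, so the radical can be applied to it, and linearity in
  \<open>v\<close> and \<open>\<xi>\<close> replaces the choice of matrices. The obstacle is that
  these coordinate maps are not all module homomorphisms: the off-diagonal block of the action
  spoils the contractions to \<open>X\<close> and the inclusions of \<open>Y\<close>. For the
  diagonal entries the spoiling terms run through the block from \<open>X\<close> to
  \<open>Y\<close>, which is 0, so these entries are homomorphisms after all. The block from
  \<open>Y\<close> to \<open>X\<close> stays merely linear; its defect is a coboundary, and this is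
  where dividing by coboundaries in the definition of the arrows enters. A radical idempotent
  \<open>e\<close> vanishes because \<open>1 - e\<close> is invertible while
  \<open>(1 - e) e = 0\<close>.\<close>

definition lin_space :: "('k::field, 'v::ab_group_add, 'm) vspace_scheme \<Rightarrow> bool" where
  "lin_space V \<longleftrightarrow> vector_space (vscale V) \<and> module.subspace (vscale V) (vcarrier V)"

lemma fd_space_lin_space: "fd_space V \<Longrightarrow> lin_space V"
  by (simp add: fd_space_def lin_space_def)

lemma lin_space_vector_space: "lin_space V \<Longrightarrow> vector_space (vscale V)"
  and lin_space_subspace: "lin_space V \<Longrightarrow> module.subspace (vscale V) (vcarrier V)"
  by (simp_all add: lin_space_def)

lemma lin_space_module: "lin_space V \<Longrightarrow> module (vscale V)"
  by (simp add: lin_space_def module_iff_vector_space)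

lemma lin_space_closed:
  assumes "lin_space V"
  shows "0 \<in> vcarrier V"
    and "u \<in> vcarrier V \<Longrightarrow> v \<in> vcarrier V \<Longrightarrow> u + v \<in> vcarrier V"
    and "u \<in> vcarrier V \<Longrightarrow> v \<in> vcarrier V \<Longrightarrow> u - v \<in> vcarrier V"
    and "u \<in> vcarrier V \<Longrightarrow> - u \<in> vcarrier V"
    and "u \<in> vcarrier V \<Longrightarrow> vscale V c u \<in> vcarrier V"
    and "(\<And>x. x \<in> I \<Longrightarrow> g x \<in> vcarrier V) \<Longrightarrow> sum g I \<in> vcarrier V"
  using lin_space_module[OF assms] lin_space_subspace[OF assms]
  by (auto intro: module.subspace_0 module.subspace_add module.subspace_diff
      module.subspace_neg module.subspace_scale module.subspace_sum)

lemma lin_space_scale: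
  assumes "lin_space V"
  shows "vscale V c (u + v) = vscale V c u + vscale V c v"
    and "vscale V c (u - v) = vscale V c u - vscale V c v"
    and "vscale V (c + d) u = vscale V c u + vscale V d u"
    and "vscale V (c - d) u = vscale V c u - vscale V d u"
    and "vscale V c (vscale V d u) = vscale V (c * d) u"
    and "vscale V 1 u = u"
    and "vscale V 0 u = 0"
    and "vscale V c 0 = 0"
    and "vscale V c (- u) = - vscale V c u"
    and "vscale V (- c) u = - vscale V c u"
    and "vscale V c u = 0 \<longleftrightarrow> c = 0 \<or> u = 0"
    and "vscale V c (sum g I) = (\<Sum>i\<in>I. vscale V c (g i))"
    and "vscale V (sum h I) u = (\<Sum>i\<in>I. vscale V (h i) u)"
proof -
  interpret vector_space "vscale V"
    by (rule lin_space_vector_space[OF assms])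
  show "vscale V c (u + v) = vscale V c u + vscale V c v"
    "vscale V c (u - v) = vscale V c u - vscale V c v"
    "vscale V (c + d) u = vscale V c u + vscale V d u"
    "vscale V (c - d) u = vscale V c u - vscale V d u"
    "vscale V c (vscale V d u) = vscale V (c * d) u"
    "vscale V 1 u = u"
    "vscale V 0 u = 0"
    "vscale V c 0 = 0"
    "vscale V c (- u) = - vscale V c u"
    "vscale V (- c) u = - vscale V c u"
    "vscale V c u = 0 \<longleftrightarrow> c = 0 \<or> u = 0"
    "vscale V c (sum g I) = (\<Sum>i\<in>I. vscale V c (g i))"
    "vscale V (sum h I) u = (\<Sum>i\<in>I. vscale V (h i) u)"
    by (simp_all add: scale_right_distrib scale_left_distrib scale_right_diff_distrib
        scale_left_diff_distrib scale_sum_right scale_sum_left)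
qed

lemma sum_fun_apply: "(\<Sum>i\<in>I. g i) x = (\<Sum>i\<in>I. g i x)"
  by (induction I rule: infinite_finite_induct) auto

lemma hom_kD:
  assumes "f \<in> hom_k V W"
  shows "v \<in> vcarrier V \<Longrightarrow> f v \<in> vcarrier W"
    and "u \<in> vcarrier V \<Longrightarrow> v \<in> vcarrier V \<Longrightarrow> f (u + v) = f u + f v"
    and "v \<in> vcarrier V \<Longrightarrow> f (vscale V c v) = vscale W c (f v)"
    and "v \<notin> vcarrier V \<Longrightarrow> f v = 0"
  using assms by (auto simp: hom_k_def)

lemma hom_kI:
  assumes "\<And>v. v \<in> vcarrier V \<Longrightarrow> f v \<in> vcarrier W"
    and "\<And>u v. u \<in> vcarrier V \<Longrightarrow> v \<in> vcarrier V \<Longrightarrow> f (u + v) = f u + f v"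
    and "\<And>c v. v \<in> vcarrier V \<Longrightarrow> f (vscale V c v) = vscale W c (f v)"
    and "\<And>v. v \<notin> vcarrier V \<Longrightarrow> f v = 0"
  shows "f \<in> hom_k V W"
  using assms by (auto simp: hom_k_def)

lemma hom_k_0:
  assumes "lin_space V" "f \<in> hom_k V W"
  shows "f 0 = 0"
  using hom_kD(2)[OF assms(2), of 0 0] lin_space_closed(1)[OF assms(1)] by simp

lemma hom_k_neg:
  assumes "lin_space V" "f \<in> hom_k V W"
  shows "f (- v) = - f v"
proof (cases "v \<in> vcarrier V")
  case True
  then have "f (- v + v) = f (- v) + f v"
    using assms by (intro hom_kD(2)) (auto intro: lin_space_closed)
  then show ?thesis
    using hom_k_0[OF assms] by (simp add: eq_neg_iff_add_eq_0)
next
  case False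
  then have "- v \<notin> vcarrier V"
    using lin_space_closed(4)[OF assms(1), of "- v"] by auto
  then show ?thesis
    using False assms(2) by (simp add: hom_kD(4))
qed

lemma hom_k_diff:
  assumes "lin_space V" "f \<in> hom_k V W" "u \<in> vcarrier V" "v \<in> vcarrier V"
  shows "f (u - v) = f u - f v"
  using hom_kD(2)[OF assms(2), of u "- v"] lin_space_closed(4)[OF assms(1)] hom_k_neg[OF assms(1,2)]
    assms by simp

lemma hom_k_sum:
  assumes "lin_space V" "f \<in> hom_k V W" "\<And>i. i \<in> I \<Longrightarrow> g i \<in> vcarrier V"
  shows "f (sum g I) = (\<Sum>i\<in>I. f (g i))"
  using assms(3)
proof (induction I rule: infinite_finite_induct)
  case (insert i I)
  then have "f (g i + sum g I) = f (g i) + f (sum g I)"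
    using assms(1,2) by (intro hom_kD(2)) (auto intro!: lin_space_closed)
  then show ?case
    using insert by simp
qed (simp_all add: hom_k_0[OF assms(1,2)])

lemma hom_k_double_sum:
  assumes V: "lin_space V" and f: "f \<in> hom_k V W"
    and g: "\<And>i b. b \<in> B i \<Longrightarrow> g i b \<in> vcarrier V"
  shows "f (\<Sum>i\<in>I. \<Sum>b\<in>B i. g i b) = (\<Sum>i\<in>I. \<Sum>b\<in>B i. f (g i b))"
proof -
  have "f (\<Sum>i\<in>I. \<Sum>b\<in>B i. g i b) = (\<Sum>i\<in>I. f (\<Sum>b\<in>B i. g i b))"
    by (rule hom_k_sum[OF V f lin_space_closed(6)[OF V g]])
  also have "\<dots> = (\<Sum>i\<in>I. \<Sum>b\<in>B i. f (g i b))"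
    by (intro sum.cong refl hom_k_sum[OF V f g])
  finally show ?thesis .
qed

text \<open>Outside the carrier the value is 0, which lies in \<open>vcarrier W\<close>, so the
  claim holds for every \<open>v\<close> of the ambient type. This avoids case distinctions when
  composites are applied.\<close>

lemma hom_k_mem:
  assumes "lin_space W" "f \<in> hom_k V W"
  shows "f v \<in> vcarrier W"
  using assms by (cases "v \<in> vcarrier V") (auto simp: hom_kD intro: lin_space_closed)

lemma hom_k_eqI:
  assumes "f \<in> hom_k V W" "g \<in> hom_k V W" "\<And>v. v \<in> vcarrier V \<Longrightarrow> f v = g v"
  shows "f = g"
  using assms by (intro ext) (metis hom_kD(4))

lemma hom_k_comp:
  assumes "lin_space V" "lin_space W" "f \<in> hom_k U V" "g \<in> hom_k V W"
  shows "g \<circ> f \<in> hom_k U W"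
  using assms by (intro hom_kI) (auto simp: hom_kD hom_k_0)

lemma hom_k_plus:
  assumes "lin_space W" "f \<in> hom_k V W" "g \<in> hom_k V W"
  shows "f + g \<in> hom_k V W"
  using assms by (intro hom_kI) (auto simp: hom_kD lin_space_scale intro: lin_space_closed)

lemma hom_k_minus:
  assumes "lin_space W" "f \<in> hom_k V W" "g \<in> hom_k V W"
  shows "f - g \<in> hom_k V W"
  using assms by (intro hom_kI) (auto simp: hom_kD lin_space_scale intro: lin_space_closed)

lemma hom_k_zero:
  assumes "lin_space W"
  shows "0 \<in> hom_k V W"
  using assms by (intro hom_kI) (auto simp: lin_space_scale intro: lin_space_closed)

lemma hom_k_image_subspace:
  assumes V: "lin_space V" and W: "lin_space W" and f: "f \<in> hom_k V W"
  shows "module.subspace (vscale W) (f ` vcarrier V)"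
proof (rule module.subspaceI[OF lin_space_module[OF W]])
  show "0 \<in> f ` vcarrier V"
    using hom_k_0[OF V f] lin_space_closed(1)[OF V] by (auto intro!: image_eqI[of _ _ 0])
  show "u + v \<in> f ` vcarrier V" if uv: "u \<in> f ` vcarrier V" "v \<in> f ` vcarrier V" for u v
  proof -
    obtain x y where "x \<in> vcarrier V" "y \<in> vcarrier V" "u = f x" "v = f y"
      using uv by blast
    then show ?thesis
      using lin_space_closed(2)[OF V] by (intro image_eqI[of _ _ "x + y"]) (simp_all add: hom_kD(2)[OF f])
  qed
  show "vscale W c u \<in> f ` vcarrier V" if u: "u \<in> f ` vcarrier V" for c u
  proof -
    obtain x where "x \<in> vcarrier V" "u = f x"
      using u by blast
    then show ?thesis
      using lin_space_closed(5)[OF V]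
      by (intro image_eqI[of _ _ "vscale V c x"]) (simp_all add: hom_kD(3)[OF f])
  qed
qed

lemma hom_k_id: "lin_space V \<Longrightarrow> id_on_carrier V \<in> hom_k V V"
  by (intro hom_kI) (auto simp: on_carrier_def intro: lin_space_closed)

lemma hom_k_id_comp:
  assumes "f \<in> hom_k V W" "lin_space W"
  shows "id_on_carrier W \<circ> f = f" and "lin_space V \<Longrightarrow> f \<circ> id_on_carrier V = f"
  using assms by (auto simp: fun_eq_iff on_carrier_def hom_k_mem hom_k_0 hom_kD(4))

lemma hom_k_inv:
  assumes V: "lin_space V" and W: "lin_space W" and f: "f \<in> hom_k V W"
    and bij: "bij_betw f (vcarrier V) (vcarrier W)"
  obtains g where "g \<in> hom_k W V" "g \<circ> f = id_on_carrier V" "f \<circ> g = id_on_carrier W"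
proof -
  define g where "g = on_carrier W (inv_into (vcarrier V) f)"
  have gf: "g (f v) = v" if "v \<in> vcarrier V" for v
    using that bij f by (auto simp: g_def on_carrier_def hom_kD(1) bij_betw_inv_into_left)
  have fg: "f (g w) = w" if "w \<in> vcarrier W" for w
    using that bij by (auto simp: g_def on_carrier_def bij_betw_inv_into_right)
  have mem: "g w \<in> vcarrier V" for w
    using bij lin_space_closed(1)[OF V]
    by (auto simp: g_def on_carrier_def) (metis bij_betw_imp_surj_on inv_into_into)
  have "g \<in> hom_k W V"
  proof (rule hom_kI)
    fix u v assume "u \<in> vcarrier W" "v \<in> vcarrier W"
    then have "f (g u + g v) = u + v"
      by (simp add: hom_kD[OF f] fg mem)
    then show "g (u + v) = g u + g v"
      using gf mem lin_space_closed[OF V] by metis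
  next
    fix c v assume "v \<in> vcarrier W"
    then have "f (vscale V c (g v)) = vscale W c v"
      by (simp add: hom_kD[OF f] fg mem)
    then show "g (vscale W c v) = vscale V c (g v)"
      using gf mem lin_space_closed[OF V] by metis
  qed (simp_all add: mem, simp add: g_def on_carrier_def)
  moreover have "g \<circ> f = id_on_carrier V"
    using gf lin_space_closed(1)[OF V] fg hom_k_0[OF W \<open>g \<in> hom_k W V\<close>]
    by (auto simp: fun_eq_iff on_carrier_def hom_kD(4)[OF f])
  moreover have "f \<circ> g = id_on_carrier W"
    using fg hom_k_0[OF V f] by (auto simp: fun_eq_iff on_carrier_def hom_kD(4)[OF \<open>g \<in> hom_k W V\<close>])
  ultimately show ?thesis
    by (rule that)
qed

section \<open>Dual spaces and contractions of tensors\<close>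

text \<open>The field is taken as a space over itself with full carrier. Functionals thus become an
  instance of \<open>hom_k\<close> and inherit its lemmas, including the value 0 outside the
  carrier.\<close>

definition dual :: "('k::field, 'v::ab_group_add, 'm) vspace_scheme \<Rightarrow> ('v \<Rightarrow> 'k) set" where
  "dual V = hom_k V \<lparr>vcarrier = UNIV, vscale = (*)\<rparr>"

lemma lin_space_field: "lin_space \<lparr>vcarrier = UNIV, vscale = ((*) :: 'k::field \<Rightarrow> _)\<rparr>"
proof -
  interpret vector_space "(*) :: 'k \<Rightarrow> _"
    by standard (auto simp: algebra_simps)
  show ?thesis
    by (simp add: lin_space_def vector_space_axioms)
qed

lemma dualD:
  assumes "\<xi> \<in> dual V"
  shows "u \<in> vcarrier V \<Longrightarrow> v \<in> vcarrier V \<Longrightarrow> \<xi> (u + v) = \<xi> u + \<xi> v"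
    and "v \<in> vcarrier V \<Longrightarrow> \<xi> (vscale V c v) = c * \<xi> v"
    and "v \<notin> vcarrier V \<Longrightarrow> \<xi> v = 0"
  using hom_kD[OF assms[unfolded dual_def]] by auto

lemma dual_sum:
  assumes "lin_space V" "\<xi> \<in> dual V" "\<And>i. i \<in> I \<Longrightarrow> g i \<in> vcarrier V"
  shows "\<xi> (sum g I) = (\<Sum>i\<in>I. \<xi> (g i))"
  using hom_k_sum[OF assms(1) assms(2)[unfolded dual_def] assms(3)] .

lemma dual_comp:
  assumes "lin_space V" "lin_space W" "\<xi> \<in> dual W" "f \<in> hom_k V W"
  shows "\<xi> \<circ> f \<in> dual V"
  using hom_k_comp[OF assms(2) lin_space_field assms(4) assms(3)[unfolded dual_def]]
  by (simp add: dual_def)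

lemma dual_basis_exists:
  fixes V :: "('k::field, 'v::ab_group_add, 'm) vspace_scheme"
  assumes "fd_space V"
  obtains B \<eta> where "finite B" "B \<subseteq> vcarrier V" "\<And>b. \<eta> b \<in> dual V"
    "\<And>v. v \<in> vcarrier V \<Longrightarrow> (\<Sum>b\<in>B. vscale V (\<eta> b v) b) = v"
proof -
  interpret vector_space "vscale V"
    using assms by (simp add: fd_space_def)
  have sub: "subspace (vcarrier V)"
    using assms by (simp add: fd_space_def)
  obtain S where S: "finite S" "vcarrier V = span S"
    using assms by (auto simp: fd_space_def)
  obtain B where B: "B \<subseteq> vcarrier V" "independent B" "vcarrier V \<subseteq> span B"
    using basis_exists by metis
  have fin: "finite B"
    using independent_span_bound[OF S(1) B(2)] B(1) S(2) by auto
  have span: "span B = vcarrier V"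
    using B sub by (simp add: span_subspace)
  \<comment> \<open>For \<open>b\<close> outside \<open>B\<close> the coefficient is 0, so
    \<open>\<eta> b\<close> is a functional for every \<open>b\<close> and later uses need no
    membership premise.\<close>
  define \<eta> where "\<eta> b = on_carrier V (\<lambda>v. representation B v b)" for b
  have "\<eta> b \<in> dual V" for b
    unfolding dual_def \<eta>_def on_carrier_def
    by (intro hom_kI)
      (auto simp: span representation_add[OF B(2)] representation_scale[OF B(2)]
        subspace_add[OF sub] subspace_scale[OF sub])
  moreover have "(\<Sum>b\<in>B. vscale V (\<eta> b v) b) = v" if "v \<in> vcarrier V" for v
    using sum_representation_eq[OF B(2) _ fin, of v] that
    by (simp add: span \<eta>_def on_carrier_def)
  ultimately show ?thesis
    using that fin B(1) by blast
qed

text \<open>Only the expansion property is needed; the vectors need not be linearly independent.\<close>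

definition dual_basis ::
  "('k::field, 'v::ab_group_add, 'm) vspace_scheme \<Rightarrow> 'v set \<times> ('v \<Rightarrow> 'v \<Rightarrow> 'k)" where
  "dual_basis V = (SOME (B, \<eta>). finite B \<and> B \<subseteq> vcarrier V \<and> (\<forall>b. \<eta> b \<in> dual V) \<and>
     (\<forall>v\<in>vcarrier V. (\<Sum>b\<in>B. vscale V (\<eta> b v) b) = v))"

definition basis_of :: "('k::field, 'v::ab_group_add, 'm) vspace_scheme \<Rightarrow> 'v set" where
  "basis_of V = fst (dual_basis V)"

definition coord :: "('k::field, 'v::ab_group_add, 'm) vspace_scheme \<Rightarrow> 'v \<Rightarrow> 'v \<Rightarrow> 'k" where
  "coord V = snd (dual_basis V)"

lemma dual_basis_props:
  assumes "fd_space V"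
  shows "finite (basis_of V)" "b \<in> basis_of V \<Longrightarrow> b \<in> vcarrier V" "coord V c \<in> dual V"
    "v \<in> vcarrier V \<Longrightarrow> (\<Sum>b\<in>basis_of V. vscale V (coord V b v) b) = v"
proof -
  obtain B0 \<eta>0 where "finite B0" "B0 \<subseteq> vcarrier V" "\<And>b. \<eta>0 b \<in> dual V"
    "\<And>v. v \<in> vcarrier V \<Longrightarrow> (\<Sum>b\<in>B0. vscale V (\<eta>0 b v) b) = v"
    using dual_basis_exists[OF assms] by metis
  then have "\<exists>p. case p of (B, \<eta>) \<Rightarrow> finite B \<and> B \<subseteq> vcarrier V \<and> (\<forall>b. \<eta> b \<in> dual V) \<and>
     (\<forall>v\<in>vcarrier V. (\<Sum>b\<in>B. vscale V (\<eta> b v) b) = v)"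
    by (intro exI[of _ "(B0, \<eta>0)"]) auto
  then have "case dual_basis V of (B, \<eta>) \<Rightarrow> finite B \<and> B \<subseteq> vcarrier V \<and> (\<forall>b. \<eta> b \<in> dual V) \<and>
     (\<forall>v\<in>vcarrier V. (\<Sum>b\<in>B. vscale V (\<eta> b v) b) = v)"
    unfolding dual_basis_def by (rule someI_ex)
  then have "finite (basis_of V) \<and> basis_of V \<subseteq> vcarrier V \<and> (\<forall>b. coord V b \<in> dual V) \<and>
     (\<forall>v\<in>vcarrier V. (\<Sum>b\<in>basis_of V. vscale V (coord V b v) b) = v)"
    by (simp add: basis_of_def coord_def split_beta)
  then show "finite (basis_of V)" "b \<in> basis_of V \<Longrightarrow> b \<in> vcarrier V" "coord V c \<in> dual V"
    "v \<in> vcarrier V \<Longrightarrow> (\<Sum>b\<in>basis_of V. vscale V (coord V b v) b) = v"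
    by auto
qed

text \<open>A vector is the combination of the basis vectors with the values of the coordinate
  functionals. Block entries only see values of functionals, so equalities in the spaces of a
  representation are reduced to this test.\<close>

lemma dual_separates:
  assumes "fd_space V" "v \<in> vcarrier V" "\<And>\<xi>. \<xi> \<in> dual V \<Longrightarrow> \<xi> v = 0"
  shows "v = 0"
proof -
  have "v = (\<Sum>b\<in>basis_of V. vscale V (coord V b v) b)"
    using dual_basis_props(4)[OF assms(1,2)] by simp
  also have "\<dots> = 0"
    using assms(1) by (simp add: assms(3)[OF dual_basis_props(3)] lin_space_scale fd_space_lin_space)
  finally show ?thesis .
qed

lemma dual_expand:
  assumes "fd_space V" "\<xi> \<in> dual V" "v \<in> vcarrier V"
  shows "(\<Sum>b\<in>basis_of V. \<xi> b * coord V b v) = \<xi> v"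
proof -
  have "\<xi> v = \<xi> (\<Sum>b\<in>basis_of V. vscale V (coord V b v) b)"
    using dual_basis_props(4)[OF assms(1,3)] by simp
  also have "\<dots> = (\<Sum>b\<in>basis_of V. \<xi> b * coord V b v)"
    using assms dual_basis_props(2)[OF assms(1)]
    by (subst dual_sum)
      (auto simp: fd_space_lin_space dualD mult.commute intro!: lin_space_closed sum.cong)
  finally show ?thesis ..
qed

text \<open>This is the map \<open>id \<otimes> \<xi>\<close> from the tensor product to
  \<open>V\<close>. Elements of the tensor product are evaluations of bilinear forms; evaluating at
  the product of \<open>coord V m\<close> and \<open>\<xi>\<close> yields the coordinate of the
  result at \<open>m\<close>.\<close>

definition contr ::
  "('k::field, 'v::ab_group_add, 'm) vspace_scheme \<Rightarrow> ('w \<Rightarrow> 'k) \<Rightarrow> (('v \<Rightarrow> 'w \<Rightarrow> 'k) \<Rightarrow> 'k) \<Rightarrow> 'v"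
  where
  "contr V \<xi> t = (\<Sum>m\<in>basis_of V. vscale V (t (\<lambda>v w. coord V m v * \<xi> w)) m)"

section \<open>Linear algebra of tensor products and their contractions\<close>

lemma vector_space_dual_scale: "vector_space (dual_scale :: 'k::field \<Rightarrow> ('b \<Rightarrow> 'k) \<Rightarrow> 'b \<Rightarrow> 'k)"
  by standard (auto simp: dual_scale_def algebra_simps)

lemma lin_space_tensor:
  fixes V :: "('k::field, 'v::ab_group_add, 'm) vspace_scheme"
    and W :: "('k, 'w::ab_group_add, 'n) vspace_scheme"
  shows "lin_space (tensor V W)"
proof -
  interpret vector_space "dual_scale :: 'k \<Rightarrow> (('v \<Rightarrow> 'w \<Rightarrow> 'k) \<Rightarrow> 'k) \<Rightarrow> _"
    by (rule vector_space_dual_scale)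
  show ?thesis
    by (simp add: lin_space_def tensor_def vector_space_axioms subspace_span)
qed

lemma vscale_tensor: "vscale (tensor V W) = dual_scale"
  by (simp add: tensor_def)

lemmas tensor_closed = lin_space_closed[OF lin_space_tensor, unfolded vscale_tensor]

lemma pure_tensor_mem:
  "v \<in> vcarrier V \<Longrightarrow> w \<in> vcarrier W \<Longrightarrow> pure_tensor V W v w \<in> vcarrier (tensor V W)"
  unfolding tensor_def
  by (auto intro!: module.span_base simp: module_iff_vector_space vector_space_dual_scale)

lemma tensor_induct [consumes 1, case_names pure add scale zero]:
  fixes V :: "('k::field, 'v::ab_group_add, 'm) vspace_scheme"
    and W :: "('k, 'w::ab_group_add, 'n) vspace_scheme"
  assumes "t \<in> vcarrier (tensor V W)"
    and "\<And>v w. v \<in> vcarrier V \<Longrightarrow> w \<in> vcarrier W \<Longrightarrow> P (pure_tensor V W v w)"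
    and "\<And>s t. s \<in> vcarrier (tensor V W) \<Longrightarrow> t \<in> vcarrier (tensor V W) \<Longrightarrow> P s \<Longrightarrow> P t \<Longrightarrow> P (s + t)"
    and "\<And>c t. t \<in> vcarrier (tensor V W) \<Longrightarrow> P t \<Longrightarrow> P (dual_scale c t)"
    and "P 0"
  shows "P t"
proof -
  interpret vector_space "dual_scale :: 'k \<Rightarrow> (('v \<Rightarrow> 'w \<Rightarrow> 'k) \<Rightarrow> 'k) \<Rightarrow> _"
    by (rule vector_space_dual_scale)
  let ?G = "{pure_tensor V W v w | v w. v \<in> vcarrier V \<and> w \<in> vcarrier W}"
  have "t \<in> span ?G"
    using assms(1) by (simp add: tensor_def)
  then have "t \<in> vcarrier (tensor V W) \<and> P t"
  proof (induction rule: span_induct)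
    case base
    show ?case
      by (rule subspaceI) (auto intro: assms(2-) tensor_closed)
  next
    case (step x)
    then show ?case
      using assms(2) by (auto intro: pure_tensor_mem)
  qed
  then show ?thesis ..
qed

lemma pure_tensor_linear:
  assumes "v \<in> vcarrier V" "w \<in> vcarrier W"
  shows "v' \<in> vcarrier V \<Longrightarrow> pure_tensor V W (v + v') w = pure_tensor V W v w + pure_tensor V W v' w"
    and "w' \<in> vcarrier W \<Longrightarrow> pure_tensor V W v (w + w') = pure_tensor V W v w + pure_tensor V W v w'"
    and "pure_tensor V W (vscale V c v) w = dual_scale c (pure_tensor V W v w)"
    and "pure_tensor V W v (vscale W c w) = dual_scale c (pure_tensor V W v w)"
  using assms by (auto simp: fun_eq_iff pure_tensor_def dual_scale_def bilinear_forms_def)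

lemma pure_tensor_sums:
  assumes "lin_space V" "lin_space W"
  shows "\<lbrakk>\<And>i. i \<in> I \<Longrightarrow> g i \<in> vcarrier V; w \<in> vcarrier W\<rbrakk> \<Longrightarrow>
      pure_tensor V W (sum g I) w = (\<Sum>i\<in>I. pure_tensor V W (g i) w)"
    and "\<lbrakk>v \<in> vcarrier V; \<And>i. i \<in> I \<Longrightarrow> g' i \<in> vcarrier W\<rbrakk> \<Longrightarrow>
      pure_tensor V W v (sum g' I) = (\<Sum>i\<in>I. pure_tensor V W v (g' i))"
proof -
  have 1: "on_carrier V (\<lambda>v. pure_tensor V W v w) \<in> hom_k V (tensor V W)" if "w \<in> vcarrier W" for w
    using that assms
    by (intro hom_kI)
      (auto simp: on_carrier_def vscale_tensor pure_tensor_linear pure_tensor_mem lin_space_closed)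
  have 2: "on_carrier W (pure_tensor V W v) \<in> hom_k W (tensor V W)" if "v \<in> vcarrier V" for v
    using that assms
    by (intro hom_kI)
      (auto simp: on_carrier_def vscale_tensor pure_tensor_linear pure_tensor_mem lin_space_closed)
  show "pure_tensor V W (sum g I) w = (\<Sum>i\<in>I. pure_tensor V W (g i) w)"
    if "\<And>i. i \<in> I \<Longrightarrow> g i \<in> vcarrier V" "w \<in> vcarrier W"
    using hom_k_sum[OF assms(1) 1[OF that(2)], of I g] that lin_space_closed(6)[OF assms(1), of I g]
    by (simp add: on_carrier_def)
  show "pure_tensor V W v (sum g' I) = (\<Sum>i\<in>I. pure_tensor V W v (g' i))"
    if "v \<in> vcarrier V" "\<And>i. i \<in> I \<Longrightarrow> g' i \<in> vcarrier W"
    using hom_k_sum[OF assms(2) 2[OF that(1)], of I g'] that lin_space_closed(6)[OF assms(2), of I g']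
    by (simp add: on_carrier_def)
qed

lemma contr_linear:
  assumes "lin_space V"
  shows "contr V \<xi> (s + t) = contr V \<xi> s + contr V \<xi> t"
    and "contr V \<xi> (dual_scale c t) = vscale V c (contr V \<xi> t)"
    and "contr V \<xi> 0 = 0"
  using assms
  by (auto simp: contr_def lin_space_scale dual_scale_def sum.distrib)

lemma contr_mem:
  assumes "fd_space V"
  shows "contr V \<xi> t \<in> vcarrier V"
  using assms
  by (auto simp: contr_def dual_basis_props intro!: lin_space_closed fd_space_lin_space)

lemma product_bilinear:
  assumes "\<eta> \<in> dual V" "\<xi> \<in> dual W"
  shows "(\<lambda>v w. \<eta> v * \<xi> w) \<in> bilinear_forms V W"
  using assms by (auto simp: bilinear_forms_def dualD algebra_simps)

lemma contr_pure:
  assumes "fd_space V" "v \<in> vcarrier V" "w \<in> vcarrier W" "\<xi> \<in> dual W"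
  shows "contr V \<xi> (pure_tensor V W v w) = vscale V (\<xi> w) v"
proof -
  have "contr V \<xi> (pure_tensor V W v w)
      = (\<Sum>m\<in>basis_of V. vscale V (\<xi> w) (vscale V (coord V m v) m))"
    using assms
    by (simp add: contr_def pure_tensor_def product_bilinear dual_basis_props lin_space_scale
        fd_space_lin_space mult.commute[of "\<xi> w"])
  also have "\<dots> = vscale V (\<xi> w) (\<Sum>m\<in>basis_of V. vscale V (coord V m v) m)"
    using assms by (simp add: lin_space_scale fd_space_lin_space)
  finally show ?thesis
    using assms by (simp add: dual_basis_props)
qed

lemma tensor_map_linear:
  "tensor_map V' W' f g (s + t) = tensor_map V' W' f g s + tensor_map V' W' f g t"
  "tensor_map V' W' f g (dual_scale c t) = dual_scale c (tensor_map V' W' f g t)"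
  "tensor_map V' W' f g 0 = 0"
  by (auto simp: tensor_map_def dual_scale_def fun_eq_iff)

lemma tensor_map_mem:
  assumes "f \<in> hom_k V V'" "g \<in> hom_k W W'" "t \<in> vcarrier (tensor V W)"
  shows "tensor_map V' W' f g t \<in> vcarrier (tensor V' W')"
  using assms(3)
proof (induction rule: tensor_induct)
  case (pure v w)
  then show ?case
    using assms by (simp add: tensor_map_pure pure_tensor_mem hom_kD)
qed (simp_all only: tensor_map_linear tensor_closed)

lemma contr_tensor_map:
  assumes V: "fd_space V" "fd_space V'" and W: "lin_space W" "lin_space W'"
    and f: "f \<in> hom_k V V'" and g: "g \<in> hom_k W W'" and "\<xi> \<in> dual W'"
    and "t \<in> vcarrier (tensor V W)"
  shows "contr V' \<xi> (tensor_map V' W' f g t) = f (contr V (\<xi> \<circ> g) t)"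
proof -
  define \<phi> where "\<phi> = \<xi> \<circ> g"
  have \<phi>: "\<phi> \<in> dual W" "\<And>w. \<phi> w = \<xi> (g w)"
    using dual_comp[OF W assms(7) g] by (simp_all add: \<phi>_def)
  have "contr V' \<xi> (tensor_map V' W' f g t) = f (contr V \<phi> t)"
    using assms(8)
  proof (induction rule: tensor_induct)
    case (pure v w)
    then show ?case
      using assms \<phi>(1) \<phi>(2)[of w] by (simp add: tensor_map_pure contr_pure hom_kD)
  next
    case (add s t)
    then show "contr V' \<xi> (tensor_map V' W' f g (s + t)) = f (contr V \<phi> (s + t))"
      by (simp add: tensor_map_linear contr_linear fd_space_lin_space V hom_kD(2)[OF f] contr_mem)
  next
    case (scale c t)
    then show ?case
      by (simp add: tensor_map_linear contr_linear fd_space_lin_space V hom_kD(3)[OF f] contr_mem)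
  next
    case zero
    show "contr V' \<xi> (tensor_map V' W' f g 0) = f (contr V \<phi> 0)"
      by (simp add: tensor_map_linear contr_linear fd_space_lin_space V hom_k_0[OF _ f])
  qed
  then show ?thesis
    by (simp only: \<phi>_def)
qed

text \<open>On a pure tensor the coordinates of \<open>w\<close> are moved across the tensor sign
  and \<open>w\<close> is reassembled from its basis expansion. Contractions by coordinate
  functionals followed by tensoring with basis vectors therefore resolve the identity.\<close>

lemma tensor_expand:
  fixes V :: "('k::field, 'v::ab_group_add, 'm) vspace_scheme"
    and W :: "('k, 'w::ab_group_add, 'n) vspace_scheme"
  assumes V: "fd_space V" and W: "fd_space W" and "t \<in> vcarrier (tensor V W)"
  shows "(\<Sum>b\<in>basis_of W. pure_tensor V W (contr V (coord W b) t) b) = t"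
  using assms(3)
proof (induction rule: tensor_induct)
  case (pure v w)
  have "(\<Sum>b\<in>basis_of W. pure_tensor V W (contr V (coord W b) (pure_tensor V W v w)) b)
      = (\<Sum>b\<in>basis_of W. pure_tensor V W v (vscale W (coord W b w) b))"
    using pure V W by (simp add: contr_pure dual_basis_props pure_tensor_linear)
  also have "\<dots> = pure_tensor V W v (\<Sum>b\<in>basis_of W. vscale W (coord W b w) b)"
    using pure V W
    by (subst pure_tensor_sums) (auto simp: fd_space_lin_space dual_basis_props lin_space_closed)
  finally show ?case
    using pure W by (simp add: dual_basis_props)
next
  case (add s t)
  have "pure_tensor V W (contr V (coord W b) (s + t)) b
      = pure_tensor V W (contr V (coord W b) s) b + pure_tensor V W (contr V (coord W b) t) b"
    if "b \<in> basis_of W" for b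
    using that V W dual_basis_props(2)[OF W that]
    by (simp add: contr_linear(1)[OF fd_space_lin_space] pure_tensor_linear(1) contr_mem)
  then show "(\<Sum>b\<in>basis_of W. pure_tensor V W (contr V (coord W b) (s + t)) b) = s + t"
    by (simp add: sum.distrib add.IH)
next
  case (scale c t)
  interpret vector_space "dual_scale :: 'k \<Rightarrow> (('v \<Rightarrow> 'w \<Rightarrow> 'k) \<Rightarrow> 'k) \<Rightarrow> _"
    by (rule vector_space_dual_scale)
  show ?case
    using scale V W
    by (simp add: contr_linear fd_space_lin_space pure_tensor_linear contr_mem dual_basis_props
        scale_sum_right[symmetric])
next
  case zero
  have "pure_tensor V W 0 b = 0" if "b \<in> basis_of W" for b
    using pure_tensor_sums(1)[of V W "{}" "\<lambda>_. 0" b] that V W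
    by (simp add: fd_space_lin_space dual_basis_props)
  then show "(\<Sum>b\<in>basis_of W. pure_tensor V W (contr V (coord W b) 0) b) = 0"
    using V by (simp add: contr_linear fd_space_lin_space)
qed

section \<open>The radical of a module category\<close>

text \<open>The radical calculus below only asks that homomorphisms commute with a family of linear
  operators. Isolating this makes it applicable to direct sums, to \<open>F M\<close> before its
  module axioms are checked, and to an auxiliary submodule of \<open>F M\<close>.\<close>

definition kmod :: "('a, 'k::field, 'v::ab_group_add) amodule \<Rightarrow> bool" where
  "kmod M \<longleftrightarrow> lin_space M \<and> (\<forall>a. act M a \<in> hom_k M M)"

lemma kmodD: "kmod M \<Longrightarrow> lin_space M" "kmod M \<Longrightarrow> act M a \<in> hom_k M M"
  by (simp_all add: kmod_def)

lemma fd_module_kmod: "fd_module sA M \<Longrightarrow> kmod M"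
  by (simp add: fd_module_def kmod_def fd_space_lin_space)

lemma hom_AD:
  assumes "f \<in> hom_A N M"
  shows "f \<in> hom_k N M" and "f (act N a v) = act M a (f v)"
  using assms by (auto simp: hom_A_def fun_eq_iff)

text \<open>Outside the carrier of \<open>N\<close> both \<open>act N a\<close> and \<open>f\<close>
  give 0, and linear maps send 0 to 0, so commutation has to be checked on the carrier only.\<close>

lemma hom_AI:
  assumes "kmod N" "kmod M" "f \<in> hom_k N M"
    and "\<And>a v. v \<in> vcarrier N \<Longrightarrow> f (act N a v) = act M a (f v)"
  shows "f \<in> hom_A N M"
proof -
  have "f (act N a v) = act M a (f v)" for a v
  proof (cases "v \<in> vcarrier N")
    case False
    then show ?thesis
      using assms(1-3) hom_k_0[OF kmodD(1) kmodD(2)] hom_k_0[OF kmodD(1) assms(3)]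
      by (simp add: hom_kD(4)[OF kmodD(2)] hom_kD(4)[OF assms(3)])
  qed (use assms in auto)
  then show ?thesis
    using assms(3) by (auto simp: hom_A_def)
qed

lemma hom_A_comp:
  assumes "kmod L" "kmod N" "kmod M" "f \<in> hom_A L N" "g \<in> hom_A N M"
  shows "g \<circ> f \<in> hom_A L M"
  using assms by (intro hom_AI hom_k_comp[of N]) (auto simp: kmodD hom_AD)

lemma hom_A_plus:
  assumes "kmod N" "kmod M" "f \<in> hom_A N M" "g \<in> hom_A N M"
  shows "f + g \<in> hom_A N M"
  using assms
  by (intro hom_AI hom_k_plus) (auto simp: kmodD hom_AD hom_kD(2)[OF kmodD(2)] hom_k_mem[OF kmodD(1) hom_AD(1)])

lemma hom_A_minus:
  assumes "kmod N" "kmod M" "f \<in> hom_A N M" "g \<in> hom_A N M"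
  shows "f - g \<in> hom_A N M"
  using assms
  by (intro hom_AI hom_k_minus)
    (auto simp: kmodD hom_AD hom_k_diff[OF kmodD(1) kmodD(2)] hom_k_mem[OF kmodD(1) hom_AD(1)])

lemma hom_A_zero:
  assumes "kmod N" "kmod M"
  shows "0 \<in> hom_A N M"
  using assms by (intro hom_AI hom_k_zero) (auto simp: kmodD hom_k_0[OF kmodD(1) kmodD(2)])

lemma hom_A_id:
  assumes "kmod M"
  shows "id_on_carrier M \<in> hom_A M M"
  using assms
  by (intro hom_AI hom_k_id) (auto simp: kmodD on_carrier_def hom_kD(1)[OF kmodD(2)])

definition scal :: "('k, 'v::ab_group_add, 'm) vspace_scheme \<Rightarrow> 'k \<Rightarrow> 'v \<Rightarrow> 'v" where
  "scal V c = on_carrier V (vscale V c)"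

lemma hom_A_scal:
  assumes "kmod M"
  shows "scal M c \<in> hom_A M M"
  using assms unfolding scal_def
  by (intro hom_AI hom_kI)
    (auto simp: kmodD on_carrier_def hom_kD[OF kmodD(2)] lin_space_scale[OF kmodD(1)] mult.commute
      intro: lin_space_closed)

lemma hom_A_sum:
  assumes "kmod N" "kmod M" "\<And>i. i \<in> I \<Longrightarrow> f i \<in> hom_A N M"
  shows "(\<Sum>i\<in>I. f i) \<in> hom_A N M"
  using assms(3)
  by (induction I rule: infinite_finite_induct)
    (auto simp: hom_A_zero[OF assms(1,2)] intro: hom_A_plus[OF assms(1,2)])

lemma hom_A_eqI:
  assumes "f \<in> hom_A N M" "g \<in> hom_A N M" "\<And>v. v \<in> vcarrier N \<Longrightarrow> f v = g v"
  shows "f = g"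
  using assms hom_k_eqI hom_AD(1) by metis

lemma hom_A_id_comp:
  assumes "kmod N" "kmod M" "f \<in> hom_A N M"
  shows "id_on_carrier M \<circ> f = f" and "f \<circ> id_on_carrier N = f"
  using hom_k_id_comp[OF hom_AD(1)[OF assms(3)]] assms by (auto simp: kmodD)

definition invertible_A :: "('a, 'k, 'v::ab_group_add) amodule \<Rightarrow> ('v \<Rightarrow> 'v) \<Rightarrow> bool" where
  "invertible_A N f \<longleftrightarrow> (\<exists>h \<in> hom_A N N. h \<circ> f = id_on_carrier N \<and> f \<circ> h = id_on_carrier N)"

lemma rad_hom_iff:
  "f \<in> rad_hom N M \<longleftrightarrow>
     f \<in> hom_A N M \<and> (\<forall>g \<in> hom_A M N. invertible_A N (id_on_carrier N - (g \<circ> f)))"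
  by (simp add: rad_hom_def invertible_A_def)

lemma invertible_A_comp:
  assumes "kmod N" "f \<in> hom_A N N" "g \<in> hom_A N N" "invertible_A N f" "invertible_A N g"
  shows "invertible_A N (g \<circ> f)"
proof -
  obtain h where h: "h \<in> hom_A N N" "h \<circ> f = id_on_carrier N" "f \<circ> h = id_on_carrier N"
    using assms(4) by (auto simp: invertible_A_def)
  obtain k where k: "k \<in> hom_A N N" "k \<circ> g = id_on_carrier N" "g \<circ> k = id_on_carrier N"
    using assms(5) by (auto simp: invertible_A_def)
  note id = hom_A_id_comp[OF assms(1,1)]
  have "(h \<circ> k) \<circ> (g \<circ> f) = h \<circ> ((k \<circ> g) \<circ> f)" "(g \<circ> f) \<circ> (h \<circ> k) = g \<circ> ((f \<circ> h) \<circ> k)"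
    by (simp_all only: o_assoc)
  then show ?thesis
    unfolding invertible_A_def
    using h k id assms hom_A_comp[OF assms(1,1,1) k(1) h(1)] by auto
qed

text \<open>Jacobson's identity: if \<open>h\<close> is inverse to \<open>1 - g f\<close>, then
  \<open>1 + f h g\<close> is inverse to \<open>1 - f g\<close>.\<close>

lemma invertible_A_swap:
  assumes "kmod N" "kmod M" "f \<in> hom_A N M" "g \<in> hom_A M N"
    and "invertible_A N (id_on_carrier N - (g \<circ> f))"
  shows "invertible_A M (id_on_carrier M - (f \<circ> g))"
proof -
  let ?u = "id_on_carrier N - (g \<circ> f)" and ?w = "id_on_carrier M - (f \<circ> g)"
  obtain h where h: "h \<in> hom_A N N" "h \<circ> ?u = id_on_carrier N" "?u \<circ> h = id_on_carrier N"
    using assms(5) by (auto simp: invertible_A_def)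
  define k where "k = id_on_carrier M + (f \<circ> h \<circ> g)"
  note lin = kmodD(1)[OF assms(1)] kmodD(1)[OF assms(2)]
  note hk = assms(3,4)[THEN hom_AD(1)] h(1)[THEN hom_AD(1)]
  note mem = hom_k_mem[OF lin(2) hk(1)] hom_k_mem[OF lin(1) hk(2)] hom_k_mem[OF lin(1) hk(3)]
  have hu: "h (v - g (f v)) = v" and uh: "h v - g (f (h v)) = v" if "v \<in> vcarrier N" for v
    using fun_cong[OF h(2), of v] fun_cong[OF h(3), of v] that mem
    by (simp_all add: on_carrier_def)
  have kA: "k \<in> hom_A M M"
    unfolding k_def using assms h
    by (intro hom_A_plus hom_A_id hom_A_comp[of M N M] hom_A_comp[of N N M])
  have wA: "?w \<in> hom_A M M"
    using assms by (intro hom_A_minus hom_A_id hom_A_comp[of M N M])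
  have "k \<circ> ?w = id_on_carrier M"
  proof (rule hom_A_eqI)
    fix v assume v: "v \<in> vcarrier M"
    have "g (v - f (g v)) = g v - g (f (g v))"
      using hom_k_diff[OF lin(2) hk(2) v] mem by simp
    then show "(k \<circ> ?w) v = id_on_carrier M v"
      using v hu[of "g v"] mem lin_space_closed(3)[OF lin(2)] by (simp add: k_def on_carrier_def)
  qed (use assms kA wA in \<open>auto intro!: hom_A_comp[of M M M] hom_A_id\<close>)
  moreover have "?w \<circ> k = id_on_carrier M"
  proof (rule hom_A_eqI)
    fix v assume v: "v \<in> vcarrier M"
    have "f (g (v + f (h (g v)))) = f (g v) + f (g (f (h (g v))))"
      using hom_kD(2)[OF hk(2) v] hom_kD(2)[OF hk(1)] mem by simp
    moreover have "f (h (g v)) - f (g (f (h (g v)))) = f (g v)"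
      using hom_k_diff[OF lin(1) hk(1), of "h (g v)" "g (f (h (g v)))"] uh[of "g v"] mem by simp
    ultimately show "(?w \<circ> k) v = id_on_carrier M v"
      using v mem lin_space_closed(2)[OF lin(2)]
      by (simp add: k_def on_carrier_def algebra_simps)
  qed (use assms kA wA in \<open>auto intro!: hom_A_comp[of M M M] hom_A_id\<close>)
  ultimately show ?thesis
    unfolding invertible_A_def using kA by auto
qed

lemma rad_hom_hom_A: "f \<in> rad_hom N M \<Longrightarrow> f \<in> hom_A N M"
  by (simp add: rad_hom_iff)

lemma rad_hom_comp_left:
  assumes "kmod N" "kmod M" "kmod L" "f \<in> rad_hom N M" "u \<in> hom_A M L"
  shows "u \<circ> f \<in> rad_hom N L"
proof -
  have "invertible_A N (id_on_carrier N - (g \<circ> (u \<circ> f)))" if "g \<in> hom_A L N" for g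
    using assms hom_A_comp[OF assms(2,3,1) assms(5) that] by (simp add: rad_hom_iff o_assoc)
  then show ?thesis
    using assms by (auto simp: rad_hom_iff intro: hom_A_comp)
qed

text \<open>The definition of the radical tests composites from one side only. To invert
  \<open>1 - g f u\<close> on \<open>L\<close>, the map \<open>1 - u g f\<close> is inverted on
  \<open>N\<close>, where \<open>f\<close> being radical applies to \<open>u g\<close>, and the
  factor \<open>u\<close> is then moved to the other side.\<close>

lemma rad_hom_comp_right:
  assumes "kmod L" "kmod N" "kmod M" "f \<in> rad_hom N M" "u \<in> hom_A L N"
  shows "f \<circ> u \<in> rad_hom L M"
proof -
  have f: "f \<in> hom_A N M"
    using assms(4) by (rule rad_hom_hom_A)
  have "invertible_A L (id_on_carrier L - (g \<circ> (f \<circ> u)))" if "g \<in> hom_A M L" for g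
  proof -
    have "invertible_A N (id_on_carrier N - (u \<circ> (g \<circ> f)))"
      using assms hom_A_comp[OF assms(3,1,2) that assms(5)] by (simp add: rad_hom_iff o_assoc)
    then show ?thesis
      using invertible_A_swap[OF assms(2,1) hom_A_comp[OF assms(2,3,1) f that] assms(5)]
      by (simp add: o_assoc)
  qed
  then show ?thesis
    using assms f by (auto simp: rad_hom_iff intro: hom_A_comp)
qed

text \<open>With \<open>u = 1 - g f\<close> and \<open>h\<close> its inverse,
  \<open>1 - g (f + f') = u (1 - h g f')\<close>. The second factor is invertible because
  \<open>f'\<close> is radical and \<open>h g\<close> is again a homomorphism.\<close>

lemma rad_hom_plus:
  assumes "kmod N" "kmod M" "f \<in> rad_hom N M" "f' \<in> rad_hom N M"
  shows "f + f' \<in> rad_hom N M"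
proof -
  have f: "f \<in> hom_A N M" "f' \<in> hom_A N M"
    using assms by (auto simp: rad_hom_iff)
  have "invertible_A N (id_on_carrier N - (g \<circ> (f + f')))" if g: "g \<in> hom_A M N" for g
  proof -
    let ?u = "id_on_carrier N - (g \<circ> f)"
    have inv: "invertible_A N ?u"
      using assms(3) g by (simp add: rad_hom_iff)
    then obtain h where h: "h \<in> hom_A N N" "?u \<circ> h = id_on_carrier N"
      by (auto simp: invertible_A_def)
    let ?w = "id_on_carrier N - ((h \<circ> g) \<circ> f')"
    have hg: "h \<circ> g \<in> hom_A M N"
      using assms g h(1) by (intro hom_A_comp)
    have u: "?u \<in> hom_A N N" and w: "?w \<in> hom_A N N"
      using hom_A_minus[OF assms(1,1) hom_A_id hom_A_comp[OF assms(1,2,1)]] assms f g hg by auto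
    have "id_on_carrier N - (g \<circ> (f + f')) = ?u \<circ> ?w"
    proof (rule hom_A_eqI)
      fix v assume v: "v \<in> vcarrier N"
      note lin = kmodD(1)[OF assms(1)] kmodD(1)[OF assms(2)]
      note mem = hom_k_mem[OF lin(2) hom_AD(1)[OF f(1)]] hom_k_mem[OF lin(2) hom_AD(1)[OF f(2)]]
        hom_k_mem[OF lin(1) hom_AD(1)[OF g]] hom_k_mem[OF lin(1) hom_AD(1)[OF h(1)]]
      have "?u (v - h (g (f' v))) = ?u v - ?u (h (g (f' v)))"
        by (rule hom_k_diff[OF lin(1) hom_AD(1)[OF u] v mem(4)])
      also have "?u (h (g (f' v))) = g (f' v)"
        using fun_cong[OF h(2), of "g (f' v)"] mem by (simp add: on_carrier_def)
      finally show "(id_on_carrier N - (g \<circ> (f + f'))) v = (?u \<circ> ?w) v"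
        using v mem hom_kD(2)[OF hom_AD(1)[OF g], of "f v" "f' v"]
        by (simp add: on_carrier_def)
    qed (use assms f g u w in
        \<open>auto intro!: hom_A_minus hom_A_id hom_A_comp[of N M N] hom_A_comp[of N N N] hom_A_plus\<close>)
    moreover have "invertible_A N ?w"
      using assms(4) hg by (simp add: rad_hom_iff)
    ultimately show ?thesis
      using invertible_A_comp[OF assms(1) w u _ inv] by simp
  qed
  then show ?thesis
    using assms f by (auto simp: rad_hom_iff intro: hom_A_plus)
qed

lemma rad_hom_scale:
  assumes "kmod N" "kmod M" "f \<in> rad_hom N M"
  shows "scal M c \<circ> f \<in> rad_hom N M"
  using assms by (intro rad_hom_comp_left[of N M M] hom_A_scal)

lemma rad_hom_uminus:
  assumes "kmod N" "kmod M" "f \<in> rad_hom N M"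
  shows "- f \<in> rad_hom N M"
proof -
  have "scal M (-1) \<circ> f = - f"
    using hom_k_mem[OF kmodD(1)[OF assms(2)] hom_AD(1)[OF rad_hom_hom_A[OF assms(3)]]]
      lin_space_scale(6,10)[OF kmodD(1)[OF assms(2)]]
    by (auto simp: scal_def on_carrier_def fun_eq_iff)
  then show ?thesis
    using rad_hom_scale[OF assms, of "-1"] by simp
qed

lemma rad_hom_minus:
  assumes "kmod N" "kmod M" "f \<in> rad_hom N M" "g \<in> rad_hom N M"
  shows "f - g \<in> rad_hom N M"
  using rad_hom_plus[OF assms(1-3) rad_hom_uminus[OF assms(1,2,4)]] by simp

lemma rad_hom_zero:
  assumes "kmod N" "kmod M"
  shows "0 \<in> rad_hom N M"
proof -
  have "invertible_A N (id_on_carrier N - (g \<circ> 0))" if "g \<in> hom_A M N" for g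
  proof -
    have "id_on_carrier N - (g \<circ> 0) = id_on_carrier N"
      using hom_k_0[OF kmodD(1)[OF assms(2)] hom_AD(1)[OF that]] by (auto simp: fun_eq_iff)
    then show ?thesis
      unfolding invertible_A_def
      using hom_A_id[OF assms(1)] hom_A_id_comp[OF assms(1,1) hom_A_id[OF assms(1)]] by auto
  qed
  then show ?thesis
    using assms by (auto simp: rad_hom_iff hom_A_zero)
qed

lemma rad_hom_sum:
  assumes "kmod N" "kmod M" "\<And>i. i \<in> I \<Longrightarrow> f i \<in> rad_hom N M"
  shows "(\<Sum>i\<in>I. f i) \<in> rad_hom N M"
  using assms(3)
  by (induction I rule: infinite_finite_induct)
    (auto simp: rad_hom_zero[OF assms(1,2)] intro: rad_hom_plus[OF assms(1,2)])

text \<open>\<open>1 - e\<close> has a left inverse \<open>h\<close>, and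
  \<open>(1 - e) e = 0\<close>, hence \<open>e = h (1 - e) e = 0\<close>.\<close>

lemma rad_hom_idempotent:
  assumes "kmod N" "e \<in> rad_hom N N" "e \<circ> e = e"
  shows "e = 0"
proof -
  note e = rad_hom_hom_A[OF assms(2)]
  have "invertible_A N (id_on_carrier N - (id_on_carrier N \<circ> e))"
    using assms(2) hom_A_id[OF assms(1)] by (auto simp: rad_hom_iff)
  then obtain h where h: "h \<in> hom_A N N" "h \<circ> (id_on_carrier N - e) = id_on_carrier N"
    using hom_A_id_comp(1)[OF assms(1,1) e] by (auto simp: invertible_A_def)
  note mem = hom_k_mem[OF kmodD(1)[OF assms(1)] hom_AD(1)[OF e]]
  have "e v = 0" for v
    using fun_cong[OF h(2), of "e v"] fun_cong[OF assms(3), of v] mem[of v]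
      hom_k_0[OF kmodD(1)[OF assms(1)] hom_AD(1)[OF h(1)]]
    by (simp add: on_carrier_def)
  then show ?thesis
    by (simp add: fun_eq_iff)
qed

section \<open>Endomorphisms of indecomposable modules\<close>

text \<open>The inverse is the finite geometric series of the powers of \<open>f\<close> below
  \<open>n\<close>; both products telescope.\<close>

lemma nilpotent_invertible:
  assumes M: "kmod M" and f: "f \<in> hom_A M M" and nil: "\<And>v. v \<in> vcarrier M \<Longrightarrow> (f ^^ n) v = 0"
  shows "invertible_A M (id_on_carrier M - f)"
proof -
  note lin = kmodD(1)[OF M]
  note mem = hom_k_mem[OF lin hom_AD(1)[OF f]]
  \<comment> \<open>The zeroth power is the identity of the whole ambient type, so the powers are
    cut off to become homomorphisms.\<close>
  define p where "p i = on_carrier M (f ^^ i)" for i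
  have p: "p i \<in> hom_A M M" for i
  proof (induction i)
    case 0
    then show ?case
      using hom_A_id[OF M] by (simp add: p_def id_def)
  next
    case (Suc i)
    have "p (Suc i) = f \<circ> p i"
      using hom_k_0[OF lin hom_AD(1)[OF f]] by (auto simp: p_def on_carrier_def fun_eq_iff)
    then show "p (Suc i) \<in> hom_A M M"
      using hom_A_comp[OF M M M Suc f] by simp
  qed
  define h where "h = (\<Sum>i<n. p i)"
  have h: "h \<in> hom_A M M"
    unfolding h_def using M p by (intro hom_A_sum)
  have id_f: "id_on_carrier M - f \<in> hom_A M M"
    using M f by (intro hom_A_minus hom_A_id)
  have tele: "(\<Sum>i<n. (f ^^ i) v - (f ^^ Suc i) v) = v" if "v \<in> vcarrier M" for v
    using sum_lessThan_telescope'[of "\<lambda>i. (f ^^ i) v" n] nil[OF that] by simp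
  have "h \<circ> (id_on_carrier M - f) = id_on_carrier M"
  proof (rule hom_A_eqI)
    fix v assume v: "v \<in> vcarrier M"
    have "p i (v - f v) = (f ^^ i) v - (f ^^ Suc i) v" for i
      using hom_k_diff[OF lin hom_AD(1)[OF p] v mem, of i] v mem[of v]
      by (simp add: p_def on_carrier_def funpow_swap1)
    then show "(h \<circ> (id_on_carrier M - f)) v = id_on_carrier M v"
      using v tele[OF v] by (simp add: h_def sum_fun_apply on_carrier_def)
  qed (use M h id_f in \<open>auto intro!: hom_A_id hom_A_comp[of M M M]\<close>)
  moreover have "(id_on_carrier M - f) \<circ> h = id_on_carrier M"
  proof (rule hom_A_eqI)
    fix v assume v: "v \<in> vcarrier M"
    have 1: "p i v \<in> vcarrier M" for i
      using hom_k_mem[OF lin hom_AD(1)[OF p]] .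
    have "(id_on_carrier M - f) (\<Sum>i<n. p i v) = (\<Sum>i<n. (id_on_carrier M - f) (p i v))"
      by (rule hom_k_sum[OF lin hom_AD(1)[OF id_f] 1])
    also have "\<dots> = (\<Sum>i<n. (f ^^ i) v - (f ^^ Suc i) v)"
      using v 1 by (intro sum.cong) (auto simp: p_def on_carrier_def)
    finally show "((id_on_carrier M - f) \<circ> h) v = id_on_carrier M v"
      using tele[OF v] v by (simp add: h_def sum_fun_apply) (simp add: on_carrier_def)
  qed (use M h id_f in \<open>auto intro!: hom_A_id hom_A_comp[of M M M]\<close>)
  ultimately show ?thesis
    unfolding invertible_A_def using h by auto
qed

section \<open>Polynomials in an endomorphism of a vector space\<close>

definition poly_act ::
  "('k::field, 'v::ab_group_add, 'm) vspace_scheme \<Rightarrow> ('v \<Rightarrow> 'v) \<Rightarrow> 'k poly \<Rightarrow> 'v \<Rightarrow> 'v" where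
  "poly_act V f p v = fold_coeffs (\<lambda>c w. vscale V c v + f w) p 0"

context
  fixes V :: "('k::field, 'v::ab_group_add, 'm) vspace_scheme" and f :: "'v \<Rightarrow> 'v"
  assumes V: "lin_space V" and f: "f \<in> hom_k V V"
begin

lemma poly_act_0: "poly_act V f 0 v = 0"
  by (simp add: poly_act_def)

lemma poly_act_pCons: "poly_act V f (pCons c p) v = vscale V c v + f (poly_act V f p v)"
  using hom_k_0[OF V f] lin_space_scale(7)[OF V]
  by (cases "c = 0 \<and> p = 0") (auto simp: poly_act_def)

lemma poly_act_mem: "v \<in> vcarrier V \<Longrightarrow> poly_act V f p v \<in> vcarrier V"
  by (induction p)
    (auto simp: poly_act_0 poly_act_pCons lin_space_closed[OF V] hom_kD(1)[OF f])

lemma poly_act_add: "v \<in> vcarrier V \<Longrightarrow> poly_act V f (p + q) v = poly_act V f p v + poly_act V f q v"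
proof (induction p arbitrary: q)
  case (pCons c p)
  obtain d q' where q: "q = pCons d q'"
    by (cases q)
  show ?case
    using pCons.IH[of q'] pCons.prems poly_act_mem hom_kD(2)[OF f]
    by (simp add: q poly_act_pCons lin_space_scale[OF V] ac_simps)
qed (simp add: poly_act_0)

lemma poly_act_smult: "v \<in> vcarrier V \<Longrightarrow> poly_act V f (smult c p) v = vscale V c (poly_act V f p v)"
  by (induction p)
    (simp_all add: poly_act_0 poly_act_pCons lin_space_scale[OF V] hom_kD(3)[OF f] poly_act_mem)

lemma poly_act_mult: "v \<in> vcarrier V \<Longrightarrow> poly_act V f (p * q) v = poly_act V f p (poly_act V f q v)"
  by (induction p)
    (simp_all add: poly_act_0 poly_act_pCons poly_act_add poly_act_smult lin_space_scale[OF V])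

lemma poly_act_linear: "poly_act V f p \<in> {h. \<forall>u\<in>vcarrier V. \<forall>v\<in>vcarrier V. h (u + v) = h u + h v}"
  "v \<in> vcarrier V \<Longrightarrow> poly_act V f p (vscale V c v) = vscale V c (poly_act V f p v)"
proof -
  show "poly_act V f p \<in> {h. \<forall>u\<in>vcarrier V. \<forall>v\<in>vcarrier V. h (u + v) = h u + h v}"
    by (induction p)
      (auto simp: poly_act_0 poly_act_pCons lin_space_scale[OF V] hom_kD(2)[OF f] poly_act_mem
        algebra_simps)
  show "v \<in> vcarrier V \<Longrightarrow> poly_act V f p (vscale V c v) = vscale V c (poly_act V f p v)"
    by (induction p)
      (auto simp: poly_act_0 poly_act_pCons lin_space_scale[OF V] hom_kD(3)[OF f] poly_act_mem
        mult.commute)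
qed

text \<open>The Horner evaluation \<open>poly_act\<close> does not vanish outside the carrier,
  because a constant term multiplies the vector itself; only its restriction follows the convention
  of \<open>hom_k\<close>.\<close>

lemma poly_act_hom_k: "on_carrier V (poly_act V f p) \<in> hom_k V V"
  using poly_act_linear(1)[of p]
  by (intro hom_kI) (auto simp: on_carrier_def poly_act_mem poly_act_linear(2) lin_space_closed[OF V])

lemma poly_act_monom: "poly_act V f (monom c n) v = (f ^^ n) (vscale V c v)"
  by (induction n)
    (simp_all add: monom_0 monom_Suc poly_act_pCons poly_act_0 hom_k_0[OF V f] lin_space_scale[OF V])

lemma poly_act_sum:
  "v \<in> vcarrier V \<Longrightarrow> poly_act V f (sum p I) v = (\<Sum>i\<in>I. poly_act V f (p i) v)"
  by (induction I rule: infinite_finite_induct) (simp_all add: poly_act_0 poly_act_add)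

lemma funpow_hom:
  assumes "v \<in> vcarrier V"
  shows "(f ^^ n) v \<in> vcarrier V" "(f ^^ n) (vscale V c v) = vscale V c ((f ^^ n) v)"
proof -
  show 1: "(f ^^ n) v \<in> vcarrier V" for n
    by (induction n) (simp_all add: assms hom_kD(1)[OF f])
  show "(f ^^ n) (vscale V c v) = vscale V c ((f ^^ n) v)"
    by (induction n) (simp_all add: 1 hom_kD(3)[OF f])
qed

text \<open>Translates between the factor of a polynomial belonging to a root and the operator whose
  nilpotency is wanted.\<close>

lemma poly_act_linear_power:
  assumes "v \<in> vcarrier V"
  shows "poly_act V f ([:- c, 1:] ^ n) v = ((f - scal V c) ^^ n) v"
proof -
  have "poly_act V f [:- c, 1:] u = (f - scal V c) u" if "u \<in> vcarrier V" for u
    using that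
    by (simp add: poly_act_pCons poly_act_0 hom_k_0[OF V f] lin_space_scale[OF V] scal_def
        on_carrier_def)
  then have "poly_act V f ([:- c, 1:] ^ Suc n) v = (f - scal V c) (poly_act V f ([:- c, 1:] ^ n) v)" for n
    using assms by (simp only: power_Suc poly_act_mult poly_act_mem)
  moreover have "poly_act V f 1 v = v"
    by (simp add: one_pCons poly_act_pCons poly_act_0 hom_k_0[OF V f] lin_space_scale[OF V])
  ultimately show ?thesis
    by (induction n) (simp_all del: power_Suc)
qed

end


text \<open>More iterates of \<open>v\<close> under \<open>f\<close> than the size of a spanning set
  cannot be distinct and independent. A linear relation or a coincidence among them is a polynomial
  relation.\<close>

lemma poly_annihilates_vector:
  fixes V :: "('k::field, 'v::ab_group_add, 'm) vspace_scheme"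
  assumes V: "fd_space V" and f: "f \<in> hom_k V V" and v: "v \<in> vcarrier V"
  shows "\<exists>p. p \<noteq> 0 \<and> poly_act V f p v = 0"
proof -
  interpret vector_space "vscale V"
    using V by (simp add: fd_space_def)
  note lin = fd_space_lin_space[OF V]
  obtain S where S: "finite S" "vcarrier V = span S"
    using V by (auto simp: fd_space_def)
  define g where "g i = (f ^^ i) v" for i
  have g_mem: "g i \<in> span S" for i
    using funpow_hom(1)[OF lin f v] S(2) by (simp add: g_def)
  have act_monom: "poly_act V f (monom c i) v = vscale V c (g i)" for c i
    by (simp add: poly_act_monom[OF lin f] funpow_hom(2)[OF lin f v] g_def)
  show ?thesis
  proof (cases "inj_on g {..card S}")
    case True
    \<comment> \<open>The index set \<open>{..card S}\<close> has one element more than the bound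
      for independent sets in the span of \<open>S\<close>.\<close>
    have "dependent (g ` {..card S})"
    proof (rule ccontr)
      assume "\<not> dependent (g ` {..card S})"
      then have "card (g ` {..card S}) \<le> card S"
        using independent_span_bound[OF S(1)] g_mem by blast
      then show False
        using card_image[OF True] by simp
    qed
    then obtain u where u: "\<exists>w\<in>g ` {..card S}. u w \<noteq> 0" "(\<Sum>w\<in>g ` {..card S}. vscale V (u w) w) = 0"
      using dependent_finite[of "g ` {..card S}"] by auto
    define p where "p = (\<Sum>i\<le>card S. monom (u (g i)) i)"
    have "coeff p i = (if i \<le> card S then u (g i) else 0)" for i
      by (simp add: p_def coeff_sum)
    moreover obtain i where "i \<le> card S" "u (g i) \<noteq> 0"
      using u(1) by auto
    ultimately have "coeff p i \<noteq> 0"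
      by simp
    then have "p \<noteq> 0"
      by auto
    moreover have "poly_act V f p v = 0"
      using u(2) True
      by (simp add: p_def poly_act_sum[OF lin f v] act_monom sum.reindex)
    ultimately show ?thesis
      by blast
  next
    \<comment> \<open>Dependence of the image set would not see repeated iterates; two equal
      iterates directly give the difference of two monomials.\<close>
    case False
    then obtain i j where ij: "g i = g j" "i \<noteq> j"
      by (auto simp: inj_on_def)
    have "coeff (monom (1::'k) i + monom (-1) j) i = 1"
      using ij(2) by simp
    then have "monom (1::'k) i + monom (-1) j \<noteq> 0"
      by (metis coeff_0 zero_neq_one)
    moreover have "poly_act V f (monom 1 i + monom (-1) j) v = 0"
      using ij(1) by (simp add: poly_act_add[OF lin f v] act_monom)
    ultimately show ?thesis
      by blast
  qed
qed

text \<open>A product of polynomials annihilating the single basis vectors annihilates all of them: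
  polynomials in \<open>f\<close> commute, so the factor belonging to a given vector can be applied
  to it before the others.\<close>

lemma poly_annihilates:
  fixes V :: "('k::field, 'v::ab_group_add, 'm) vspace_scheme"
  assumes V: "fd_space V" and f: "f \<in> hom_k V V"
  shows "\<exists>p. p \<noteq> 0 \<and> (\<forall>v\<in>vcarrier V. poly_act V f p v = 0)"
proof -
  note lin = fd_space_lin_space[OF V]
  have "\<exists>p. p \<noteq> 0 \<and> (\<forall>v\<in>B. poly_act V f p v = 0)" if "finite B" "B \<subseteq> vcarrier V" for B
    using that
  proof (induction B)
    case (insert b B)
    then obtain p q where p: "p \<noteq> 0" "\<forall>v\<in>B. poly_act V f p v = 0"
      and q: "q \<noteq> 0" "poly_act V f q b = 0"
      using poly_annihilates_vector[OF V f, of b] by auto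
    have "poly_act V f (p * q) b = 0"
      using q(2) insert.prems hom_k_0[OF lin poly_act_hom_k[OF lin f]] lin_space_closed(1)[OF lin]
      by (simp add: poly_act_mult[OF lin f] on_carrier_def)
    moreover have "poly_act V f (q * p) v = 0" if "v \<in> B" for v
      using that p(2) insert.prems hom_k_0[OF lin poly_act_hom_k[OF lin f]] lin_space_closed(1)[OF lin]
      by (subst poly_act_mult[OF lin f]) (auto simp: on_carrier_def)
    ultimately show ?case
      using p(1) q(1) by (intro exI[of _ "p * q"]) (auto simp: mult.commute)
  qed (auto intro: exI[of _ 1])
  then obtain p where p: "p \<noteq> 0" "\<forall>v\<in>basis_of V. poly_act V f p v = 0"
    using dual_basis_props(1,2)[OF V] by (metis subsetI)
  have "poly_act V f p v = 0" if v: "v \<in> vcarrier V" for v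
  proof -
    have "on_carrier V (poly_act V f p) (\<Sum>b\<in>basis_of V. vscale V (coord V b v) b)
        = (\<Sum>b\<in>basis_of V. on_carrier V (poly_act V f p) (vscale V (coord V b v) b))"
      by (intro hom_k_sum[OF lin poly_act_hom_k[OF lin f]] lin_space_closed(5)[OF lin]
          dual_basis_props(2)[OF V])
    also have "\<dots> = 0"
      using p(2) dual_basis_props(2)[OF V] hom_kD(3)[OF poly_act_hom_k[OF lin f]]
      by (auto intro!: sum.neutral simp: lin_space_scale[OF lin]) (simp add: on_carrier_def lin_space_scale[OF lin])
    finally show ?thesis
      using v by (simp add: dual_basis_props(4)[OF V v] on_carrier_def)
  qed
  then show ?thesis
    using p(1) by blast
qed

text \<open>Coprimality of a power of the linear factor and \<open>q\<close>, with explicit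
  coefficients. If \<open>s\<close> is the quotient of \<open>q\<close> by the linear factor and
  \<open>w\<close> the inverse of \<open>poly q c\<close>, division with remainder gives
  \<open>1 = w q - w s [:- c, 1:]\<close>.\<close>

lemma linear_power_bezout:
  fixes q :: "'k::field poly"
  assumes "poly q c \<noteq> 0"
  shows "\<exists>a b. a * [:- c, 1:] ^ m + b * q = 1"
proof (induction m)
  case 0
  show ?case
    by (intro exI[of _ 1] exI[of _ 0]) simp
next
  case (Suc m)
  then obtain a b where ab: "a * [:- c, 1:] ^ m + b * q = 1"
    by blast
  define s where "s = synthetic_div q c"
  define w where "w = [:1 / poly q c:]"
  have "[:- c, 1:] * s + [:poly q c:] = q"
    unfolding s_def by (rule synthetic_div_correct')
  then have "w * q = w * ([:- c, 1:] * s) + w * [:poly q c:]"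
    by (metis distrib_left)
  also have "w * [:poly q c:] = 1"
    using assms by (simp add: w_def)
  finally have w: "1 = w * q - w * s * [:- c, 1:]"
    by (simp only: ac_simps add_diff_cancel_left' add_diff_cancel_right')
  \<comment> \<open>The summand with the power is multiplied by the expression for 1 just found,
    which either produces one more linear factor or a multiple of \<open>q\<close>.\<close>
  have "1 = a * [:- c, 1:] ^ m * (w * q - w * s * [:- c, 1:]) + b * q"
    by (simp only: w[symmetric] mult_1_right ab)
  also have "\<dots> = (- a * w * s) * ([:- c, 1:] * [:- c, 1:] ^ m) + (a * [:- c, 1:] ^ m * w + b) * q"
    by (simp only: ring_distribs mult_minus_left mult_minus_right diff_conv_add_uminus ac_simps)
  finally have "(- a * w * s) * [:- c, 1:] ^ Suc m + (a * [:- c, 1:] ^ m * w + b) * q = 1"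
    by (simp only: power_Suc)
  then show ?case
    by blast
qed

section \<open>Splitting an indecomposable module by an annihilating polynomial\<close>

lemma submodule_poly_act_kernel:
  assumes M: "kmod M" and f: "f \<in> hom_A M M"
  shows "submodule M {v \<in> vcarrier M. poly_act M f p v = 0}"
proof -
  note lin = kmodD(1)[OF M]
  note fk = hom_AD(1)[OF f]
  have "poly_act M f p (act M a v) = act M a (poly_act M f p v)" if "v \<in> vcarrier M" for a v
    using that
    by (induction p)
      (auto simp: poly_act_0[OF lin fk] poly_act_pCons[OF lin fk] hom_k_0[OF lin kmodD(2)[OF M]]
        hom_kD[OF kmodD(2)[OF M]] hom_AD(2)[OF f] lin_space_closed[OF lin] poly_act_mem[OF lin fk]
        hom_kD(1)[OF fk])
  moreover have "module.subspace (vscale M) {v \<in> vcarrier M. poly_act M f p v = 0}"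
    using lin_space_closed[OF lin] poly_act_linear[OF lin fk]
      hom_k_0[OF lin poly_act_hom_k[OF lin fk, of p]]
    by (intro module.subspaceI[OF lin_space_module[OF lin]])
      (auto simp: lin_space_scale[OF lin] on_carrier_def)
  ultimately show ?thesis
    by (auto simp: submodule_def hom_kD(1)[OF kmodD(2)[OF M]] hom_k_0[OF lin kmodD(2)[OF M]])
qed

text \<open>Take an annihilating polynomial of least degree and a root \<open>c\<close> of it, which
  exists over an algebraically closed field. Separating the full power of the linear factor from the
  cofactor \<open>q\<close> splits \<open>M\<close> into the kernels \<open>U\<close> and
  \<open>W\<close> of the two factors. If \<open>U\<close> were 0, then \<open>q\<close> alone would
  annihilate \<open>M\<close> in smaller degree; so \<open>W\<close> is 0, and the power of
  \<open>f - c\<close> maps into \<open>W\<close>.\<close>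

lemma indecomposable_endomorphism:
  fixes M :: "('a::ring_1, 'k::alg_closed_field, 'v::ab_group_add) amodule"
  assumes M: "indecomposable_A sA M" and f: "f \<in> hom_A M M"
  obtains c n where "\<And>v. v \<in> vcarrier M \<Longrightarrow> ((f - scal M c) ^^ n) v = 0"
proof -
  have fdm: "fd_module sA M" and ne: "vcarrier M \<noteq> {0}"
    using M by (auto simp: indecomposable_A_def)
  have kM: "kmod M" and fd: "fd_space M"
    using fdm by (auto simp: fd_module_kmod fd_module_def)
  note lin = kmodD(1)[OF kM]
  note fk = hom_AD(1)[OF f]
  define Q where "Q p \<longleftrightarrow> p \<noteq> 0 \<and> (\<forall>v\<in>vcarrier M. poly_act M f p v = 0)" for p
  obtain p where p: "Q p" and min: "\<And>q. Q q \<Longrightarrow> degree p \<le> degree q"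
    using ex_has_least_nat[of Q _ degree] poly_annihilates[OF fd fk] unfolding Q_def by metis
  \<comment> \<open>A nonzero constant would act invertibly, but \<open>p\<close> kills the nonzero
    module \<open>M\<close>. This is what guarantees a root.\<close>
  have "degree p > 0"
  proof (rule ccontr)
    assume "\<not> degree p > 0"
    then obtain d where "p = [:d:]"
      by (metis gr0I degree_eq_zeroE)
    then show False
      using p ne lin_space_closed(1)[OF lin]
      by (auto simp: Q_def poly_act_pCons[OF lin fk] poly_act_0[OF lin fk] hom_k_0[OF lin fk]
          lin_space_scale[OF lin])
  qed
  then obtain c where c: "poly p c = 0"
    using alg_closed_imp_poly_has_root by blast
  define m where "m = order c p"
  obtain q where q: "p = [:- c, 1:] ^ m * q" "\<not> [:- c, 1:] dvd q"
    using order_decomp[of p c] p by (auto simp: Q_def m_def)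
  have "m > 0"
    using c p order_root[of p c] by (auto simp: Q_def m_def)
  have "q \<noteq> 0"
    using q p by (auto simp: Q_def)
  have "poly q c \<noteq> 0"
    using q(2) by (simp add: poly_eq_0_iff_dvd)
  then obtain a b where ab: "a * [:- c, 1:] ^ m + b * q = 1"
    using linear_power_bezout by blast
  let ?l = "[:- c, 1:] ^ m"
  define U where "U = {v \<in> vcarrier M. poly_act M f ?l v = 0}"
  define W where "W = {v \<in> vcarrier M. poly_act M f q v = 0}"
  have zero: "poly_act M f r 0 = 0" for r
    using hom_k_0[OF lin poly_act_hom_k[OF lin fk, of r]] lin_space_closed(1)[OF lin]
    by (simp add: on_carrier_def)
  have one: "poly_act M f 1 v = v" for v
    by (simp add: one_pCons poly_act_pCons[OF lin fk] poly_act_0[OF lin fk] hom_k_0[OF lin fk]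
        lin_space_scale[OF lin])
  note mult = poly_act_mult[OF lin fk]
  note mem = poly_act_mem[OF lin fk]
  have split: "v = poly_act M f (a * ?l) v + poly_act M f (b * q) v" if "v \<in> vcarrier M" for v
    using arg_cong[OF ab, of "\<lambda>r. poly_act M f r v"] poly_act_add[OF lin fk that] one by simp
  have kill: "poly_act M f (?l * (r * q)) v = 0" if "v \<in> vcarrier M" for r v
  proof -
    have eq: "?l * (r * q) = r * p"
      by (simp add: q(1))
    show ?thesis
      unfolding eq using p that mult[OF that, of r p] zero by (simp add: Q_def)
  qed
  have "internal_direct_sum (vcarrier M) U W"
    unfolding internal_direct_sum_def
  proof
    have "v = 0" if "v \<in> U" "v \<in> W" for v
      using split[of v] that mult[of v] zero by (simp add: U_def W_def)
    then show "U \<inter> W = {0}"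
      using zero lin_space_closed(1)[OF lin] by (auto simp: U_def W_def)
    have "v \<in> {u + w | u w. u \<in> U \<and> w \<in> W}" if v: "v \<in> vcarrier M" for v
    proof -
      have "poly_act M f (b * q) v \<in> U"
        using kill[OF v, of b] mult[OF v, of ?l "b * q"] mem[OF v] by (simp add: U_def)
      moreover have eq: "q * (a * ?l) = ?l * (a * q)"
        by (simp only: ac_simps)
      have "poly_act M f q (poly_act M f (a * ?l) v) = 0"
        unfolding mult[OF v, symmetric] eq by (rule kill[OF v])
      then have "poly_act M f (a * ?l) v \<in> W"
        using mem[OF v] by (simp add: W_def)
      ultimately show ?thesis
        using split[OF v] by (auto simp: add.commute)
    qed
    then show "vcarrier M = {u + w | u w. u \<in> U \<and> w \<in> W}"
      using lin_space_closed(2)[OF lin] by (auto simp: U_def W_def)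
  qed
  moreover have "submodule M U" "submodule M W"
    unfolding U_def W_def by (rule submodule_poly_act_kernel[OF kM f])+
  ultimately have "U = {0} \<or> W = {0}"
    using M by (auto simp: indecomposable_A_def)
  \<comment> \<open>Since \<open>U\<close> contains the image of \<open>q\<close>, its vanishing
    makes \<open>q\<close> an annihilator, against the choice of \<open>p\<close>.\<close>
  moreover have "U \<noteq> {0}"
  proof
    assume U: "U = {0}"
    have "poly_act M f q v = 0" if v: "v \<in> vcarrier M" for v
    proof -
      have "poly_act M f q v \<in> U"
        using kill[OF v, of 1] mult[OF v, of ?l q] mem[OF v] by (simp add: U_def)
      then show ?thesis
        using U by simp
    qed
    then have "degree p \<le> degree q"
      using \<open>q \<noteq> 0\<close> by (intro min) (simp add: Q_def)
    moreover have "degree p = m + degree q"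
      using \<open>q \<noteq> 0\<close> by (simp add: q(1) degree_mult_eq degree_linear_power)
    ultimately show False
      using \<open>m > 0\<close> by simp
  qed
  ultimately have W: "W = {0}"
    by simp
  have "((f - scal M c) ^^ m) v = 0" if v: "v \<in> vcarrier M" for v
  proof -
    have eq: "q * ?l = ?l * (1 * q)"
      by (simp only: mult_1_left mult.commute)
    have "poly_act M f q (poly_act M f ?l v) = 0"
      unfolding mult[OF v, symmetric] eq by (rule kill[OF v])
    then have "poly_act M f ?l v \<in> W"
      using mem[OF v] by (simp add: W_def)
    then show ?thesis
      using W by (simp add: poly_act_linear_power[OF lin fk v])
  qed
  then show ?thesis
    by (rule that)
qed

section \<open>Scalars, nilpotent maps and the radical on indecomposable modules\<close>

lemma scal_algebra:
  assumes "kmod M"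
  shows "scal M c + scal M d = scal M (c + d)"
    and "scal M c - scal M d = scal M (c - d)"
    and "scal M c \<circ> scal M d = scal M (c * d)"
    and "scal M 1 = id_on_carrier M"
    and "scal M 0 = 0"
  using lin_space_closed(5)[OF kmodD(1)[OF assms]]
  by (auto simp: scal_def on_carrier_def fun_eq_iff lin_space_scale[OF kmodD(1)[OF assms]])

lemma scal_sum:
  assumes "kmod M"
  shows "(\<Sum>i\<in>I. scal M (c i)) = scal M (sum c I)"
  by (induction I rule: infinite_finite_induct)
    (simp_all add: scal_algebra[OF assms])

lemma invertible_A_scal:
  assumes "kmod M" "c \<noteq> 0"
  shows "invertible_A M (scal M c)"
  unfolding invertible_A_def
  using assms by (intro bexI[of _ "scal M (1 / c)"]) (auto simp: scal_algebra hom_A_scal)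

lemma indecomposable_fd_module: "indecomposable_A sA M \<Longrightarrow> fd_module sA M"
  and indecomposable_nonzero: "indecomposable_A sA M \<Longrightarrow> vcarrier M \<noteq> {0}"
  and indecomposable_kmod: "indecomposable_A sA M \<Longrightarrow> kmod M"
  by (auto simp: indecomposable_A_def fd_module_kmod)

text \<open>For eigenvalue 0 the map is nilpotent. Otherwise \<open>f\<close> is \<open>c\<close>
  times \<open>1 - g\<close> for a nilpotent \<open>g\<close>, a product of invertible maps.\<close>

lemma endomorphism_cases:
  fixes M :: "('a::ring_1, 'k::alg_closed_field, 'v::ab_group_add) amodule"
  assumes "indecomposable_A sA M" and f: "f \<in> hom_A M M"
  shows "invertible_A M f \<or> (\<exists>n. \<forall>v\<in>vcarrier M. (f ^^ n) v = 0)"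
proof -
  from indecomposable_endomorphism[OF assms]
  obtain c n where nil: "\<And>v. v \<in> vcarrier M \<Longrightarrow> ((f - scal M c) ^^ n) v = 0"
    by blast
  have M: "kmod M"
    using assms(1) by (rule indecomposable_kmod)
  note lin = kmodD(1)[OF M]
  show ?thesis
  proof (cases "c = 0")
    case True
    then show ?thesis
      using nil by (auto simp: scal_algebra[OF M])
  next
    case False
    define \<nu> where "\<nu> = f - scal M c"
    \<comment> \<open>Chosen such that \<open>c (1 - g) = c + \<nu> = f\<close>.\<close>
    define g where "g = scal M (- (1 / c)) \<circ> \<nu>"
    have \<nu>: "\<nu> \<in> hom_A M M"
      unfolding \<nu>_def using M f by (intro hom_A_minus hom_A_scal)
    have g: "g \<in> hom_A M M"
      unfolding g_def using M \<nu> by (intro hom_A_comp[of M M M] hom_A_scal)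
    note mem = funpow_hom[OF lin hom_AD(1)[OF \<nu>]]
    have "(g ^^ i) v = vscale M ((- (1 / c)) ^ i) ((\<nu> ^^ i) v)" if v: "v \<in> vcarrier M" for v i
    proof (induction i)
      case (Suc i)
      then show ?case
        using mem(1)[OF v] mem(1)[OF v, of "Suc i"] hom_kD(3)[OF hom_AD(1)[OF \<nu>]]
          lin_space_closed(5)[OF lin]
        by (simp add: g_def scal_def on_carrier_def lin_space_scale[OF lin])
    qed (simp add: lin_space_scale[OF lin])
    then have "(g ^^ n) v = 0" if "v \<in> vcarrier M" for v
      using nil that by (simp add: \<nu>_def lin_space_scale[OF lin])
    then have inv: "invertible_A M (id_on_carrier M - g)"
      by (rule nilpotent_invertible[OF M g])
    have idg: "id_on_carrier M - g \<in> hom_A M M"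
      using M g by (intro hom_A_minus hom_A_id)
    have "f = scal M c \<circ> (id_on_carrier M - g)"
    proof (rule hom_A_eqI)
      fix v assume v: "v \<in> vcarrier M"
      have "vscale M c (v + vscale M (1 / c) (f v - vscale M c v)) = f v"
        using False by (simp add: lin_space_scale[OF lin])
      then show "f v = (scal M c \<circ> (id_on_carrier M - g)) v"
        using v hom_kD(1)[OF hom_AD(1)[OF f] v] False
        by (simp add: g_def \<nu>_def scal_def on_carrier_def lin_space_closed[OF lin]
            lin_space_scale[OF lin])
    qed (use f idg M hom_A_scal in \<open>auto intro!: hom_A_comp[of M M M]\<close>)
    then show ?thesis
      using invertible_A_comp[OF M idg hom_A_scal[OF M] inv invertible_A_scal[OF M False]] by simp
  qed
qed

text \<open>If \<open>g f\<close> is nilpotent, then \<open>1 - g f\<close> is invertible. If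
  \<open>g f\<close> is invertible, then \<open>f\<close> is a split monomorphism, so its image is a
  direct summand of the indecomposable module \<open>N\<close>; being nonzero it is all of
  \<open>N\<close>, and \<open>f\<close> would be bijective.\<close>

lemma nonisomorphism_in_rad_hom:
  fixes M :: "('a::ring_1, 'k::alg_closed_field, 'v::ab_group_add) amodule"
    and N :: "('a, 'k, 'w::ab_group_add) amodule"
  assumes M: "indecomposable_A sA M" and N: "indecomposable_A sA N"
    and f: "f \<in> hom_A M N" and not_bij: "\<not> bij_betw f (vcarrier M) (vcarrier N)"
  shows "f \<in> rad_hom M N"
proof -
  note kM = indecomposable_kmod[OF M] and kN = indecomposable_kmod[OF N]
  note linM = kmodD(1)[OF kM] and linN = kmodD(1)[OF kN]
  have "invertible_A M (id_on_carrier M - (g \<circ> f))" if g: "g \<in> hom_A N M" for g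
  proof -
    have gf: "g \<circ> f \<in> hom_A M M"
      using kM kN f g by (intro hom_A_comp[of M N M])
    from endomorphism_cases[OF M gf] show ?thesis
    proof
      assume "\<exists>n. \<forall>v\<in>vcarrier M. ((g \<circ> f) ^^ n) v = 0"
      then show ?thesis
        using nilpotent_invertible[OF kM gf] by blast
    next
      assume "invertible_A M (g \<circ> f)"
      then obtain h where h: "h \<in> hom_A M M" "h \<circ> (g \<circ> f) = id_on_carrier M"
        by (auto simp: invertible_A_def)
      \<comment> \<open>A left inverse of \<open>f\<close>; the complement of the image of
        \<open>f\<close> is the kernel of \<open>u\<close>.\<close>
      define u where "u = h \<circ> g"
      have u: "u \<in> hom_A N M"
        unfolding u_def using kM kN g h by (intro hom_A_comp[of N M M])
      have uf: "u (f v) = v" if "v \<in> vcarrier M" for v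
        using fun_cong[OF h(2), of v] that by (simp add: u_def on_carrier_def)
      note fk = hom_AD(1)[OF f] and uk = hom_AD(1)[OF u]
      let ?U = "f ` vcarrier M" and ?W = "{w \<in> vcarrier N. u w = 0}"
      have "submodule N ?U"
        unfolding submodule_def
      proof (intro conjI allI ballI)
        show "module.subspace (vscale N) ?U"
          by (rule hom_k_image_subspace[OF linM linN fk])
        show "?U \<subseteq> vcarrier N"
          using hom_kD(1)[OF fk] by auto
        show "act N a w \<in> ?U" if "w \<in> ?U" for a w
          using that hom_AD(2)[OF f] hom_kD(1)[OF kmodD(2)[OF kM]] by (auto simp flip: hom_AD(2)[OF f])
      qed
      moreover have "submodule N ?W"
        unfolding submodule_def
      proof (intro conjI allI ballI)
        show "module.subspace (vscale N) ?W"
          using lin_space_closed[OF linN]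
          by (intro module.subspaceI[OF lin_space_module[OF linN]])
            (auto simp: hom_kD(2,3)[OF uk] hom_k_0[OF linN uk] lin_space_scale[OF linM])
        show "act N a w \<in> ?W" if "w \<in> ?W" for a w
          using that hom_kD(1)[OF kmodD(2)[OF kN]]
          by (simp add: hom_AD(2)[OF u] hom_k_0[OF linM kmodD(2)[OF kM]])
      qed auto
      moreover have "internal_direct_sum (vcarrier N) ?U ?W"
        unfolding internal_direct_sum_def
      proof
        show "?U \<inter> ?W = {0}"
          using uf hom_k_0[OF linM fk] hom_k_0[OF linN uk] lin_space_closed(1)[OF linM]
            lin_space_closed(1)[OF linN]
          by (auto simp: image_iff)
        have "w \<in> {v + w | v w. v \<in> ?U \<and> w \<in> ?W}" if w: "w \<in> vcarrier N" for w
        proof -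
          have "f (u w) \<in> ?U" and mem: "f (u w) \<in> vcarrier N"
            using hom_kD(1)[OF uk w] hom_kD(1)[OF fk] by auto
          moreover have "u (w - f (u w)) = 0"
            using hom_k_diff[OF linN uk w mem] uf[OF hom_kD(1)[OF uk w]] by simp
          moreover have "w - f (u w) \<in> vcarrier N"
            using w mem by (rule lin_space_closed(3)[OF linN])
          moreover have "w = f (u w) + (w - f (u w))"
            by simp
          ultimately show ?thesis
            by blast
        qed
        then show "vcarrier N = {v + w | v w. v \<in> ?U \<and> w \<in> ?W}"
          using lin_space_closed(2)[OF linN] hom_kD(1)[OF fk] by auto
      qed
      ultimately have "?U = {0} \<or> ?W = {0}"
        using N by (auto simp: indecomposable_A_def)
      then show ?thesis
      proof
        assume U: "?U = {0}"
        have "v = 0" if "v \<in> vcarrier M" for v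
          using uf[OF that] U that hom_k_0[OF linN uk] by (metis imageI singletonD)
        then show ?thesis
          using indecomposable_nonzero[OF M] lin_space_closed(1)[OF linM] by auto
      next
        assume W: "?W = {0}"
        have "f (u w) = w" if w: "w \<in> vcarrier N" for w
        proof -
          have mem: "f (u w) \<in> vcarrier N"
            using hom_kD(1)[OF uk w] hom_kD(1)[OF fk] by auto
          have "u (w - f (u w)) = 0"
            using hom_k_diff[OF linN uk w mem] uf[OF hom_kD(1)[OF uk w]] by simp
          then have "w - f (u w) \<in> ?W"
            using w mem lin_space_closed(3)[OF linN] by simp
          then have "w - f (u w) \<in> {0}"
            using W by simp
          then show ?thesis
            by simp
        qed
        then have "bij_betw f (vcarrier M) (vcarrier N)"
          using uf hom_kD(1)[OF uk] hom_kD(1)[OF fk]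
          by (intro bij_betw_byWitness[where f' = u]) auto
        then show ?thesis
          using not_bij by simp
      qed
    qed
  qed
  then show ?thesis
    using f by (simp add: rad_hom_iff)
qed

lemma noniso_hom_A_in_rad_hom:
  fixes M :: "('a::ring_1, 'k::alg_closed_field, 'v::ab_group_add) amodule"
    and N :: "('a, 'k, 'w::ab_group_add) amodule"
  assumes "indecomposable_A sA M" "indecomposable_A sA N" "\<not> iso_A M N" "f \<in> hom_A M N"
  shows "f \<in> rad_hom M N"
  using assms by (intro nonisomorphism_in_rad_hom) (auto simp: iso_A_def)

text \<open>The nilpotent part \<open>f - c\<close> cannot be bijective on a nonzero module, hence
  is radical.\<close>

lemma endomorphism_residue:
  fixes M :: "('a::ring_1, 'k::alg_closed_field, 'v::ab_group_add) amodule"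
  assumes M: "indecomposable_A sA M" and f: "f \<in> hom_A M M"
  shows "\<exists>c. f - scal M c \<in> rad_hom M M"
proof -
  note kM = indecomposable_kmod[OF M]
  note lin = kmodD(1)[OF kM]
  from indecomposable_endomorphism[OF assms]
  obtain c n where nil: "\<And>v. v \<in> vcarrier M \<Longrightarrow> ((f - scal M c) ^^ n) v = 0"
    by blast
  define \<nu> where "\<nu> = f - scal M c"
  have \<nu>: "\<nu> \<in> hom_A M M"
    unfolding \<nu>_def using kM f by (intro hom_A_minus hom_A_scal)
  have "\<not> bij_betw \<nu> (vcarrier M) (vcarrier M)"
  proof
    assume "bij_betw \<nu> (vcarrier M) (vcarrier M)"
    then have inj: "inj_on \<nu> (vcarrier M)"
      by (simp add: bij_betw_def)
    have "v = 0" if v: "v \<in> vcarrier M" and "(\<nu> ^^ i) v = 0" for v i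
      using that(2)
    proof (induction i)
      case (Suc i)
      then have "\<nu> ((\<nu> ^^ i) v) = \<nu> 0"
        by (simp add: hom_k_0[OF lin hom_AD(1)[OF \<nu>]])
      then have "(\<nu> ^^ i) v = 0"
        using inj_onD[OF inj] funpow_hom(1)[OF lin hom_AD(1)[OF \<nu>] v] lin_space_closed(1)[OF lin]
        by blast
      then show ?case
        by (rule Suc.IH)
    qed simp
    then show False
      using nil indecomposable_nonzero[OF M] lin_space_closed(1)[OF lin] by (auto simp: \<nu>_def)
  qed
  then show ?thesis
    using nonisomorphism_in_rad_hom[OF M M \<nu>] by (auto simp: \<nu>_def)
qed

text \<open>Dividing by a nonzero \<open>c\<close> would put the identity into the radical; the
  identity is idempotent, so it would be 0 and \<open>M\<close> with it.\<close>

lemma scal_in_rad_hom: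
  assumes M: "indecomposable_A sA M" and "scal M c \<in> rad_hom M M"
  shows "c = 0"
proof (rule ccontr)
  assume "c \<noteq> 0"
  note kM = indecomposable_kmod[OF M]
  have "id_on_carrier M \<in> rad_hom M M"
    using rad_hom_scale[OF kM kM assms(2), of "1 / c"] \<open>c \<noteq> 0\<close> by (simp add: scal_algebra[OF kM])
  then have "id_on_carrier M = 0"
    using hom_A_id_comp(1)[OF kM kM hom_A_id[OF kM]] by (rule rad_hom_idempotent[OF kM])
  then have "id_on_carrier M v = 0" for v
    by (simp only: zero_fun_apply)
  then have "v = 0" if "v \<in> vcarrier M" for v
    using that by (metis on_carrier_def)
  then show False
    using indecomposable_nonzero[OF M] lin_space_closed(1)[OF kmodD(1)[OF kM]] by auto
qed

text \<open>The class of an endomorphism in End(M) modulo its radical, identified with the field.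
  Existence is \<open>endomorphism_residue\<close>, and uniqueness follows from
  \<open>scal_in_rad_hom\<close>.\<close>

definition residue :: "('a, 'k::field, 'v::ab_group_add) amodule \<Rightarrow> ('v \<Rightarrow> 'v) \<Rightarrow> 'k" where
  "residue M f = (THE c. f - scal M c \<in> rad_hom M M)"

context
  fixes sA :: "'k::alg_closed_field \<Rightarrow> 'a::ring_1 \<Rightarrow> 'a" and M :: "('a, 'k, 'v::ab_group_add) amodule"
  assumes M: "indecomposable_A sA M"
begin

lemma residue_eqI:
  assumes "f - scal M c \<in> rad_hom M M"
  shows "residue M f = c"
  unfolding residue_def
proof (rule the_equality)
  show "f - scal M c \<in> rad_hom M M"
    by (rule assms)
next
  fix d assume "f - scal M d \<in> rad_hom M M"
  then have "(f - scal M c) - (f - scal M d) \<in> rad_hom M M"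
    by (rule rad_hom_minus[OF indecomposable_kmod[OF M] indecomposable_kmod[OF M] assms])
  moreover have "(f - scal M c) - (f - scal M d) = scal M (d - c)"
    by (simp flip: scal_algebra(2)[OF indecomposable_kmod[OF M]])
  ultimately show "d = c"
    using scal_in_rad_hom[OF M, of "d - c"] by (metis eq_iff_diff_eq_0)
qed

lemma residue_rad_hom: "f \<in> hom_A M M \<Longrightarrow> f - scal M (residue M f) \<in> rad_hom M M"
  using endomorphism_residue[OF M] residue_eqI by metis

lemma residue_add:
  assumes "f \<in> hom_A M M" "g \<in> hom_A M M"
  shows "residue M (f + g) = residue M f + residue M g"
proof (rule residue_eqI)
  note kM = indecomposable_kmod[OF M]
  have eq: "(f + g) - scal M (residue M f + residue M g)
      = (f - scal M (residue M f)) + (g - scal M (residue M g))"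
    by (simp flip: scal_algebra(1)[OF kM])
  show "(f + g) - scal M (residue M f + residue M g) \<in> rad_hom M M"
    unfolding eq using assms by (intro rad_hom_plus kM residue_rad_hom)
qed

lemma residue_scale:
  assumes "f \<in> hom_A M M"
  shows "residue M (scal M c \<circ> f) = c * residue M f"
proof (rule residue_eqI)
  note kM = indecomposable_kmod[OF M]
  note lin = kmodD(1)[OF kM]
  have "(scal M c \<circ> f) - scal M (c * residue M f) = scal M c \<circ> (f - scal M (residue M f))"
    using hom_k_mem[OF lin hom_AD(1)[OF assms]] lin_space_closed[OF lin]
      hom_kD(4)[OF hom_AD(1)[OF assms]]
    by (auto simp: scal_def on_carrier_def fun_eq_iff lin_space_scale[OF lin])
  then show "(scal M c \<circ> f) - scal M (c * residue M f) \<in> rad_hom M M"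
    using rad_hom_scale[OF kM kM residue_rad_hom[OF assms]] by simp
qed

lemma residue_zero: "residue M 0 = 0"
  by (rule residue_eqI)
    (simp add: scal_algebra rad_hom_zero indecomposable_kmod[OF M])

lemma residue_sum:
  assumes "\<And>i. i \<in> I \<Longrightarrow> f i \<in> hom_A M M"
  shows "residue M (\<Sum>i\<in>I. f i) = (\<Sum>i\<in>I. residue M (f i))"
  using assms
  by (induction I rule: infinite_finite_induct)
    (simp_all add: residue_zero residue_add hom_A_sum indecomposable_kmod[OF M])

end

section \<open>Block matrices of homomorphisms and their residues\<close>

text \<open>
  A block matrix describes a homomorphism from the direct sum of the tensor products of
  \<open>Z z\<close> and \<open>V z\<close> to that of \<open>Z z\<close> and \<open>V' z\<close>: the entry \<open>c z' \<xi> z v\<close> is its composition with the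
  inclusion of \<open>Z z\<close> given by the vector \<open>v\<close> and the contraction to \<open>Z z'\<close> given by the functional
  \<open>\<xi>\<close>. Its top part is the family of linear maps induced modulo the radical.
\<close>

definition block_matrix ::
  "('z \<Rightarrow> ('a, 'k::field, 'b::ab_group_add) amodule) \<Rightarrow> ('z \<Rightarrow> ('k, 'v::ab_group_add) vspace) \<Rightarrow>
   ('z \<Rightarrow> ('k, 'w::ab_group_add) vspace) \<Rightarrow> ('z \<Rightarrow> ('w \<Rightarrow> 'k) \<Rightarrow> 'z \<Rightarrow> 'v \<Rightarrow> 'b \<Rightarrow> 'b) \<Rightarrow> bool" where
  "block_matrix Z V V' c \<longleftrightarrow>
     (\<forall>z z'. \<forall>\<xi>\<in>dual (V' z'). \<forall>v\<in>vcarrier (V z). c z' \<xi> z v \<in> hom_A (Z z) (Z z')) \<and>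
     (\<forall>z z'. \<forall>\<xi>\<in>dual (V' z'). \<forall>u\<in>vcarrier (V z). \<forall>v\<in>vcarrier (V z).
        c z' \<xi> z (u + v) = c z' \<xi> z u + c z' \<xi> z v) \<and>
     (\<forall>z z'. \<forall>\<xi>\<in>dual (V' z'). \<forall>a. \<forall>v\<in>vcarrier (V z).
        c z' \<xi> z (vscale (V z) a v) = scal (Z z') a \<circ> c z' \<xi> z v) \<and>
     (\<forall>z z'. \<forall>\<xi>\<in>dual (V' z'). \<forall>v\<in>vcarrier (V z).
        c z' \<xi> z v = (\<Sum>b\<in>basis_of (V' z'). scal (Z z') (\<xi> b) \<circ> c z' (coord (V' z') b) z v))"

text \<open>Only the diagonal entries occur: the entries between different members of a family of
  pairwise non-isomorphic indecomposable modules are radical anyway.\<close>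

definition top_part ::
  "('z \<Rightarrow> ('a, 'k::field, 'b::ab_group_add) amodule) \<Rightarrow> ('z \<Rightarrow> ('k, 'v::ab_group_add) vspace) \<Rightarrow>
   ('z \<Rightarrow> ('k, 'w::ab_group_add) vspace) \<Rightarrow> ('z \<Rightarrow> ('w \<Rightarrow> 'k) \<Rightarrow> 'z \<Rightarrow> 'v \<Rightarrow> 'b \<Rightarrow> 'b) \<Rightarrow>
   ('z \<Rightarrow> 'v \<Rightarrow> 'w) \<Rightarrow> bool" where
  "top_part Z V V' c f \<longleftrightarrow> (\<forall>z. f z \<in> hom_k (V z) (V' z)) \<and>
     (\<forall>z. \<forall>\<xi>\<in>dual (V' z). \<forall>v\<in>vcarrier (V z). c z \<xi> z v - scal (Z z) (\<xi> (f z v)) \<in> rad_hom (Z z) (Z z))"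

lemma top_partD:
  assumes "top_part Z V V' c f"
  shows "f z \<in> hom_k (V z) (V' z)"
    and "\<xi> \<in> dual (V' z) \<Longrightarrow> v \<in> vcarrier (V z) \<Longrightarrow>
      c z \<xi> z v - scal (Z z) (\<xi> (f z v)) \<in> rad_hom (Z z) (Z z)"
  using assms by (auto simp: top_part_def)

lemma block_matrixD:
  assumes "block_matrix Z V V' c" "\<xi> \<in> dual (V' z')" "v \<in> vcarrier (V z)"
  shows "c z' \<xi> z v \<in> hom_A (Z z) (Z z')"
    and "u \<in> vcarrier (V z) \<Longrightarrow> c z' \<xi> z (u + v) = c z' \<xi> z u + c z' \<xi> z v"
    and "c z' \<xi> z (vscale (V z) a v) = scal (Z z') a \<circ> c z' \<xi> z v"
    and "(\<Sum>b\<in>basis_of (V' z'). scal (Z z') (\<xi> b) \<circ> c z' (coord (V' z') b) z v) = c z' \<xi> z v"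
  using assms(1)[unfolded block_matrix_def, THEN conjunct1, rule_format, OF assms(2,3)]
    assms(1)[unfolded block_matrix_def, THEN conjunct2, THEN conjunct1, rule_format, OF assms(2) _ assms(3)]
    assms(1)[unfolded block_matrix_def, THEN conjunct2, THEN conjunct2, THEN conjunct1, rule_format,
      OF assms(2,3)]
    assms(1)[unfolded block_matrix_def, THEN conjunct2, THEN conjunct2, THEN conjunct2, rule_format,
      OF assms(2,3), symmetric]
  by simp_all

locale indec_family =
  fixes sA :: "'k::alg_closed_field \<Rightarrow> 'a::ring_1 \<Rightarrow> 'a"
    and Z :: "'z::finite \<Rightarrow> ('a, 'k, 'b::ab_group_add) amodule"
  assumes indec: "\<And>z. indecomposable_A sA (Z z)"
    and non_iso: "\<And>z z'. z \<noteq> z' \<Longrightarrow> \<not> iso_A (Z z) (Z z')"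
begin

lemma kmod_Z: "kmod (Z z)"
  using indec by (rule indecomposable_kmod)

lemma off_diagonal_rad: "f \<in> hom_A (Z z) (Z z') \<Longrightarrow> z \<noteq> z' \<Longrightarrow> f \<in> rad_hom (Z z) (Z z')"
  using noniso_hom_A_in_rad_hom[OF indec indec non_iso] by blast

text \<open>The coordinates of \<open>f z v\<close> are the residues of the entries at the
  coordinate functionals. The expansion clause of \<open>block_matrix\<close> extends this from
  coordinate functionals to all \<open>\<xi>\<close>, because residues are linear.\<close>

lemma top_part_exists:
  assumes V: "\<And>z. fd_space (V z)" and V': "\<And>z. fd_space (V' z)" and c: "block_matrix Z V V' c"
  shows "\<exists>f. top_part Z V V' c f"
proof -
  define f where "f z = on_carrier (V z)
    (\<lambda>v. \<Sum>b\<in>basis_of (V' z). vscale (V' z) (residue (Z z) (c z (coord (V' z) b) z v)) b)" for z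
  note linV' = fd_space_lin_space[OF V'] and linV = fd_space_lin_space[OF V]
  note coord = dual_basis_props(3)[OF V'] and basis = dual_basis_props(2)[OF V']
  note hom = block_matrixD(1)[OF c]
  have f: "f z \<in> hom_k (V z) (V' z)" for z
  proof (rule hom_kI)
    show "f z v \<in> vcarrier (V' z)" if "v \<in> vcarrier (V z)" for v
      using that by (auto simp: f_def on_carrier_def intro!: lin_space_closed(5,6)[OF linV'] intro: basis)
    show "f z (u + v) = f z u + f z v" if "u \<in> vcarrier (V z)" "v \<in> vcarrier (V z)" for u v
      using that
      by (simp add: f_def on_carrier_def lin_space_closed(2)[OF linV] block_matrixD(2)[OF c coord]
          residue_add[OF indec] hom[OF coord] lin_space_scale[OF linV'] sum.distrib)
    show "f z (vscale (V z) a v) = vscale (V' z) a (f z v)" if "v \<in> vcarrier (V z)" for a v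
      using that
      by (simp add: f_def on_carrier_def lin_space_closed(5)[OF linV] block_matrixD(3)[OF c coord]
          residue_scale[OF indec] hom[OF coord] lin_space_scale[OF linV'])
  qed (simp add: f_def on_carrier_def)
  have "c z \<xi> z v - scal (Z z) (\<xi> (f z v)) \<in> rad_hom (Z z) (Z z)"
    if \<xi>: "\<xi> \<in> dual (V' z)" and v: "v \<in> vcarrier (V z)" for z \<xi> v
  proof -
    have "\<xi> (f z v) = (\<Sum>b\<in>basis_of (V' z). \<xi> b * residue (Z z) (c z (coord (V' z) b) z v))"
      using v
      by (simp add: f_def on_carrier_def dual_sum[OF linV' \<xi>] lin_space_closed(5)[OF linV'] basis
          dualD(2)[OF \<xi>] mult.commute)
    also have "\<dots> = (\<Sum>b\<in>basis_of (V' z). residue (Z z) (scal (Z z) (\<xi> b) \<circ> c z (coord (V' z) b) z v))"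
      by (simp add: residue_scale[OF indec] hom[OF coord v])
    also have "\<dots> = residue (Z z) (\<Sum>b\<in>basis_of (V' z). scal (Z z) (\<xi> b) \<circ> c z (coord (V' z) b) z v)"
      using hom[OF coord v] hom_A_scal[OF kmod_Z]
      by (intro residue_sum[OF indec, symmetric] hom_A_comp[OF kmod_Z kmod_Z kmod_Z])
    finally have "\<xi> (f z v) = residue (Z z) (c z \<xi> z v)"
      by (simp add: block_matrixD(4)[OF c \<xi> v])
    then show ?thesis
      using residue_rad_hom[OF indec hom[OF \<xi> v]] by simp
  qed
  then show ?thesis
    using f by (auto simp: top_part_def)
qed

text \<open>The scalars \<open>\<xi> (f z v)\<close> and \<open>\<xi> (g z v)\<close> are both the
  residue of the same entry, and functionals separate vectors.\<close>

lemma top_part_unique: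
  assumes V': "\<And>z. fd_space (V' z)" and "top_part Z V V' c f" "top_part Z V V' c g"
  shows "f z = g z"
proof (rule hom_k_eqI[OF top_partD(1)[OF assms(2)] top_partD(1)[OF assms(3)]])
  fix v assume v: "v \<in> vcarrier (V z)"
  note mem = hom_kD(1)[OF top_partD(1)[OF assms(2)] v] hom_kD(1)[OF top_partD(1)[OF assms(3)] v]
  note lin = fd_space_lin_space[OF V']
  have "\<xi> (f z v - g z v) = 0" if \<xi>: "\<xi> \<in> dual (V' z)" for \<xi>
  proof -
    have "\<xi> (f z v) = \<xi> (g z v)"
      using residue_eqI[OF indec top_partD(2)[OF assms(2) \<xi> v]]
        residue_eqI[OF indec top_partD(2)[OF assms(3) \<xi> v]] by simp
    moreover have "\<xi> (f z v - g z v) = \<xi> (f z v) - \<xi> (g z v)"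
      using hom_k_diff[OF lin \<xi>[unfolded dual_def] mem] .
    ultimately show ?thesis
      by simp
  qed
  then show "f z v = g z v"
    using dual_separates[OF V' lin_space_closed(3)[OF lin mem]] by simp
qed

text \<open>The hypothesis on \<open>e\<close> is matrix multiplication. Modulo the radical only the
  terms through \<open>z' = z\<close> survive, and there both factors may be replaced by their
  scalars, which multiply as the matrices of \<open>g\<close> and \<open>f\<close>.\<close>

lemma top_part_comp:
  assumes V': "\<And>z. fd_space (V' z)"
    and c: "block_matrix Z V' V'' c" "top_part Z V' V'' c g"
    and d: "block_matrix Z V V' d" "top_part Z V V' d f"
    and lin: "\<And>z. lin_space (V z)" "\<And>z. lin_space (V'' z)"
    and e: "\<And>z \<xi> v. \<xi> \<in> dual (V'' z) \<Longrightarrow> v \<in> vcarrier (V z) \<Longrightarrow>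
      e z \<xi> z v = (\<Sum>z'\<in>UNIV. \<Sum>b\<in>basis_of (V' z'). c z \<xi> z' b \<circ> d z' (coord (V' z') b) z v)"
  shows "top_part Z V V'' e (\<lambda>z. g z \<circ> f z)"
proof -
  note linV' = fd_space_lin_space[OF V']
  have hom: "g z \<circ> f z \<in> hom_k (V z) (V'' z)" for z
    by (rule hom_k_comp[OF linV' lin(2) top_partD(1)[OF d(2)] top_partD(1)[OF c(2)]])
  have "e z \<xi> z v - scal (Z z) (\<xi> ((g z \<circ> f z) v)) \<in> rad_hom (Z z) (Z z)"
    if \<xi>: "\<xi> \<in> dual (V'' z)" and v: "v \<in> vcarrier (V z)" for z \<xi> v
  proof -
    let ?t = "\<lambda>z' b. c z \<xi> z' b \<circ> d z' (coord (V' z') b) z v"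
    let ?x = "\<lambda>b. \<xi> (g z b) * coord (V' z) b (f z v)"
    have cb: "c z \<xi> z' b \<in> hom_A (Z z') (Z z)" if "b \<in> basis_of (V' z')" for z' b
      using block_matrixD(1)[OF c(1) \<xi>] dual_basis_props(2)[OF V'] that by blast
    have db: "d z' (coord (V' z') b) z v \<in> hom_A (Z z) (Z z')" for z' b
      by (rule block_matrixD(1)[OF d(1) dual_basis_props(3)[OF V'] v])
    \<comment> \<open>For \<open>z' \<noteq> z\<close> the left factor runs between non-isomorphic
      modules and is radical, and composing it with a homomorphism stays in the radical.\<close>
    have off: "(\<Sum>z'\<in>UNIV - {z}. \<Sum>b\<in>basis_of (V' z'). ?t z' b) \<in> rad_hom (Z z) (Z z)"
      using cb db
      by (intro rad_hom_sum kmod_Z rad_hom_comp_right[of _ "Z _"] off_diagonal_rad) auto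
    have diag: "?t z b - scal (Z z) (?x b) \<in> rad_hom (Z z) (Z z)" if b: "b \<in> basis_of (V' z)" for b
    proof -
      let ?r = "c z \<xi> z b - scal (Z z) (\<xi> (g z b))"
      let ?s = "d z (coord (V' z) b) z v - scal (Z z) (coord (V' z) b (f z v))"
      have r: "?r \<in> rad_hom (Z z) (Z z)"
        by (rule top_partD(2)[OF c(2) \<xi> dual_basis_props(2)[OF V' b]])
      have s: "?s \<in> rad_hom (Z z) (Z z)"
        by (rule top_partD(2)[OF d(2) dual_basis_props(3)[OF V'] v])
      \<comment> \<open>Pattern \<open>c d - x y = (c - x) d + x (d - y)\<close>: each summand has
        one radical factor.\<close>
      have eq: "?t z b - scal (Z z) (?x b)
          = (?r \<circ> d z (coord (V' z) b) z v) + (scal (Z z) (\<xi> (g z b)) \<circ> ?s)"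
      proof -
        note linZ = kmodD(1)[OF kmod_Z]
        have scal_add: "scal (Z z) a (u - w) = scal (Z z) a u - scal (Z z) a w"
          if "u \<in> vcarrier (Z z)" "w \<in> vcarrier (Z z)" for a u w
          using hom_k_diff[OF linZ hom_AD(1)[OF hom_A_scal[OF kmod_Z]] that] .
        have "scal (Z z) (?x b) w = scal (Z z) (\<xi> (g z b)) (scal (Z z) (coord (V' z) b (f z v)) w)" for w
          using scal_algebra(3)[OF kmod_Z] by (metis comp_apply)
        then show ?thesis
          using hom_k_mem[OF linZ hom_AD(1)[OF db]] hom_k_mem[OF linZ hom_AD(1)[OF hom_A_scal[OF kmod_Z]]]
          by (simp add: fun_eq_iff scal_add)
      qed
      show ?thesis
        unfolding eq using r s db
        by (intro rad_hom_plus rad_hom_comp_right[of "Z z" "Z z"] rad_hom_scale kmod_Z) auto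
    qed
    have "e z \<xi> z v = (\<Sum>b\<in>basis_of (V' z). ?t z b)
        + (\<Sum>z'\<in>UNIV - {z}. \<Sum>b\<in>basis_of (V' z'). ?t z' b)"
      by (simp add: e[OF \<xi> v] sum.remove[of UNIV z])
    \<comment> \<open>The functional \<open>\<xi> \<circ> g z\<close> is expanded in the coordinate
      functionals at \<open>f z v\<close>.\<close>
    moreover have "\<xi> (g z (f z v)) = (\<Sum>b\<in>basis_of (V' z). ?x b)"
      using dual_expand[OF V' dual_comp[OF linV' lin(2) \<xi> top_partD(1)[OF c(2)]]
          hom_kD(1)[OF top_partD(1)[OF d(2)] v]] by simp
    ultimately have "e z \<xi> z v - scal (Z z) (\<xi> ((g z \<circ> f z) v))
        = (\<Sum>b\<in>basis_of (V' z). ?t z b - scal (Z z) (?x b))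
          + (\<Sum>z'\<in>UNIV - {z}. \<Sum>b\<in>basis_of (V' z'). ?t z' b)"
      by (simp add: sum_subtractf scal_sum[OF kmod_Z])
    then show ?thesis
      using off diag by (auto intro!: rad_hom_plus rad_hom_sum kmod_Z)
  qed
  then show ?thesis
    using hom by (auto simp: top_part_def)
qed

end

section \<open>Direct sums and the radical of the cocycle bifunctor\<close>

definition ds_proj ::
  "('i \<Rightarrow> ('a, 'k, 'v::ab_group_add) amodule) \<Rightarrow> 'i \<Rightarrow> ('i \<Rightarrow> 'v) \<Rightarrow> 'v" where
  "ds_proj X i = on_carrier (direct_sum X) (\<lambda>x. x i)"

definition ds_incl ::
  "('i \<Rightarrow> ('a, 'k, 'v::ab_group_add) amodule) \<Rightarrow> 'i \<Rightarrow> 'v \<Rightarrow> 'i \<Rightarrow> 'v" where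
  "ds_incl X i = on_carrier (X i) (\<lambda>v i'. if i' = i then v else 0)"

context
  fixes X :: "'i \<Rightarrow> ('a, 'k::field, 'v::ab_group_add) amodule"
  assumes X: "\<And>i. kmod (X i)"
begin

lemma kmod_direct_sum: "kmod (direct_sum X)"
proof -
  note lin = kmodD(1)[OF X]
  interpret vector_space "\<lambda>c x i. vscale (X i) c (x i :: 'v)"
    by standard (auto simp: lin_space_scale[OF lin])
  have "subspace {x. \<forall>i. x i \<in> vcarrier (X i)}"
    by (rule subspaceI) (auto simp: lin_space_closed[OF lin])
  then have "lin_space (direct_sum X)"
    by (simp add: lin_space_def direct_sum_def vector_space_axioms)
  moreover have "act (direct_sum X) a \<in> hom_k (direct_sum X) (direct_sum X)" for a
    by (intro hom_kI)
      (auto simp: direct_sum_def hom_kD[OF kmodD(2)[OF X]] lin_space_closed[OF lin] fun_eq_iff)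
  ultimately show ?thesis
    by (simp add: kmod_def)
qed

lemma ds_proj_hom_A: "ds_proj X i \<in> hom_A (direct_sum X) (X i)"
  using lin_space_closed[OF kmodD(1)[OF kmod_direct_sum]] hom_kD(1)[OF kmodD(2)[OF kmod_direct_sum]]
  by (intro hom_AI hom_kI kmod_direct_sum X)
    (auto simp: ds_proj_def on_carrier_def direct_sum_def split: if_splits)

lemma ds_incl_hom_A: "ds_incl X i \<in> hom_A (X i) (direct_sum X)"
  using lin_space_closed[OF kmodD(1)[OF X]] hom_kD(1)[OF kmodD(2)[OF X]]
    hom_k_0[OF kmodD(1)[OF X] kmodD(2)[OF X]]
  by (intro hom_AI hom_kI kmod_direct_sum X)
    (auto simp: ds_incl_def on_carrier_def direct_sum_def fun_eq_iff lin_space_scale[OF kmodD(1)[OF X]])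

lemma ds_proj_incl: "ds_proj X i \<circ> ds_incl X i = id_on_carrier (X i)"
  using lin_space_closed(1)[OF kmodD(1)[OF X]]
  by (auto simp: ds_proj_def ds_incl_def on_carrier_def direct_sum_def fun_eq_iff)

end

section \<open>Bifunctoriality of cocycles and generators of their radical\<close>

lemma Z1D:
  assumes "\<delta> \<in> Z1 sA N M"
  shows "\<delta> a \<in> hom_k N M" "\<delta> (a + b) v = \<delta> a v + \<delta> b v" "\<delta> (sA c a) v = vscale M c (\<delta> a v)"
    "\<delta> (a * b) v = act M a (\<delta> b v) + \<delta> a (act N b v)"
  using assms by (auto simp: Z1_def)

lemma Z1_comp_left:
  assumes "kmod N" "kmod M" "kmod L" "r \<in> hom_A M L" "\<delta> \<in> Z1 sA N M"
  shows "(\<lambda>a. r \<circ> \<delta> a) \<in> Z1 sA N L"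
proof -
  note rk = hom_AD(1)[OF assms(4)]
  note mem = hom_k_mem[OF kmodD(1)[OF assms(2)] Z1D(1)[OF assms(5)]]
  have "r \<circ> \<delta> a \<in> hom_k N L" for a
    using assms(2,3) Z1D(1)[OF assms(5)] rk by (intro hom_k_comp[of M L]) (auto simp: kmodD)
  then show ?thesis
    using hom_kD(1)[OF kmodD(2)[OF assms(2)] mem] mem
    by (auto simp: Z1_def fun_eq_iff Z1D[OF assms(5)] hom_kD(2,3)[OF rk] hom_AD(2)[OF assms(4)])
qed

lemma Z1_comp_right:
  assumes "kmod L" "kmod N" "kmod M" "r \<in> hom_A L N" "\<delta> \<in> Z1 sA N M"
  shows "(\<lambda>a. \<delta> a \<circ> r) \<in> Z1 sA L M"
proof -
  have "\<delta> a \<circ> r \<in> hom_k L M" for a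
    using assms Z1D(1)[OF assms(5)] hom_AD(1)[OF assms(4)]
    by (intro hom_k_comp[of N M]) (auto simp: kmodD)
  then show ?thesis
    by (auto simp: Z1_def fun_eq_iff Z1D[OF assms(5)] hom_AD(2)[OF assms(4)])
qed

lemma vector_space_cocycle_scale:
  assumes "lin_space M"
  shows "vector_space (cocycle_scale M)"
  by standard (auto simp: cocycle_scale_def fun_eq_iff lin_space_scale[OF assms])

text \<open>\<open>RadZ\<close> is defined with radical maps out of the whole direct sum, whereas
  block entries give radical maps between single summands. Inserting the inclusion of
  \<open>X i'\<close> followed by its projection, which is the identity, passes from one to the
  other.\<close>

lemma rad_comp_cocycle_generator:
  fixes X :: "'i \<Rightarrow> ('a::ring_1, 'k::field, 'x::ab_group_add) amodule"
  assumes X: "\<And>i. kmod (X i)" and N: "kmod N" and "r \<in> rad_hom (X i') (X i)" "\<zeta> \<in> Z1 sA N (X i')"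
  shows "(\<lambda>a. r \<circ> \<zeta> a) \<in> {\<lambda>a. \<rho> \<circ> \<zeta> a | \<rho> \<zeta>. \<rho> \<in> rad_hom (direct_sum X) (X i) \<and>
    \<zeta> \<in> Z1 sA N (direct_sum X)}"
proof -
  note kD = kmod_direct_sum[of X, OF X]
  have 1: "r \<circ> ds_proj X i' \<in> rad_hom (direct_sum X) (X i)"
    by (rule rad_hom_comp_right[OF kD X X assms(3) ds_proj_hom_A[of X, OF X]])
  have 2: "(\<lambda>a. ds_incl X i' \<circ> \<zeta> a) \<in> Z1 sA N (direct_sum X)"
    by (rule Z1_comp_left[OF N X kD ds_incl_hom_A[of X, OF X] assms(4)])
  have "r \<circ> \<zeta> a = (r \<circ> ds_proj X i') \<circ> (ds_incl X i' \<circ> \<zeta> a)" for a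
  proof -
    have "(r \<circ> ds_proj X i') \<circ> (ds_incl X i' \<circ> \<zeta> a) = r \<circ> ((ds_proj X i' \<circ> ds_incl X i') \<circ> \<zeta> a)"
      by (simp only: o_assoc)
    then show ?thesis
      using hom_k_id_comp(1)[OF Z1D(1)[OF assms(4)] kmodD(1)[OF X]]
      by (simp only: ds_proj_incl[of X, OF X])
  qed
  then show ?thesis
    using 1 2 by (intro CollectI exI[of _ "r \<circ> ds_proj X i'"] exI[of _ "\<lambda>a. ds_incl X i' \<circ> \<zeta> a"]) auto
qed

text \<open>The same device on the other side: the radical map is prolonged by the inclusion of
  \<open>Y j'\<close>, and the cocycle is precomposed with the projection.\<close>

lemma cocycle_comp_rad_generator:
  fixes Y :: "'j \<Rightarrow> ('a::ring_1, 'k::field, 'y::ab_group_add) amodule"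
  assumes Y: "\<And>j. kmod (Y j)" and M: "kmod M" and "r \<in> rad_hom (Y j) (Y j')" "\<zeta> \<in> Z1 sA (Y j') M"
  shows "(\<lambda>a. \<zeta> a \<circ> r) \<in> {\<lambda>a. \<zeta> a \<circ> \<rho> | \<zeta> \<rho>. \<zeta> \<in> Z1 sA (direct_sum Y) M \<and>
    \<rho> \<in> rad_hom (Y j) (direct_sum Y)}"
proof -
  note kD = kmod_direct_sum[of Y, OF Y]
  have 1: "ds_incl Y j' \<circ> r \<in> rad_hom (Y j) (direct_sum Y)"
    by (rule rad_hom_comp_left[OF Y Y kD assms(3) ds_incl_hom_A[of Y, OF Y]])
  have 2: "(\<lambda>a. \<zeta> a \<circ> ds_proj Y j') \<in> Z1 sA (direct_sum Y) M"
    by (rule Z1_comp_right[OF kD Y M ds_proj_hom_A[of Y, OF Y] assms(4)])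
  have "\<zeta> a \<circ> r = (\<zeta> a \<circ> ds_proj Y j') \<circ> (ds_incl Y j' \<circ> r)" for a
  proof -
    have "(\<zeta> a \<circ> ds_proj Y j') \<circ> (ds_incl Y j' \<circ> r) = \<zeta> a \<circ> ((ds_proj Y j' \<circ> ds_incl Y j') \<circ> r)"
      by (simp only: o_assoc)
    then show ?thesis
      using hom_k_id_comp(1)[OF hom_AD(1)[OF rad_hom_hom_A[OF assms(3)]] kmodD(1)[OF Y]]
      by (simp only: ds_proj_incl[of Y, OF Y])
  qed
  then show ?thesis
    using 1 2 by (intro CollectI exI[of _ "ds_incl Y j' \<circ> r"] exI[of _ "\<lambda>a. \<zeta> a \<circ> ds_proj Y j'"]) auto
qed

section \<open>Coordinates on the image of the functor\<close>

lemma contr_sum: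
  assumes "lin_space V"
  shows "contr V \<xi> (sum t I) = (\<Sum>i\<in>I. contr V \<xi> (t i))"
  by (simp add: contr_def sum_fun_apply lin_space_scale(13)[OF assms]) (rule sum.swap)

text \<open>Contracting the basis expansion of \<open>t\<close> term by term. This is the source of
  the expansion clause in \<open>block_matrix\<close>.\<close>

lemma contr_expand:
  fixes V :: "('k::field, 'v::ab_group_add, 'm) vspace_scheme"
    and W :: "('k, 'w::ab_group_add, 'n) vspace_scheme"
  assumes V: "fd_space V" and W: "fd_space W" and t: "t \<in> vcarrier (tensor V W)" and \<xi>: "\<xi> \<in> dual W"
  shows "(\<Sum>b\<in>basis_of W. vscale V (\<xi> b) (contr V (coord W b) t)) = contr V \<xi> t"
proof -
  have "contr V \<xi> t = contr V \<xi> (\<Sum>b\<in>basis_of W. pure_tensor V W (contr V (coord W b) t) b)"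
    by (simp add: tensor_expand[OF V W t])
  also have "\<dots> = (\<Sum>b\<in>basis_of W. vscale V (\<xi> b) (contr V (coord W b) t))"
    using V by (simp add: contr_sum fd_space_lin_space contr_pure contr_mem dual_basis_props(2)[OF W] \<xi>)
  finally show ?thesis ..
qed

text \<open>The assumptions are those under which \<open>F M\<close> is a module; what concerns
  indecomposability and independence is added in a later extension.\<close>

locale cocycle_family =
  fixes sA :: "'k::alg_closed_field \<Rightarrow> 'a::ring_1 \<Rightarrow> 'a"
    and X :: "'i::finite \<Rightarrow> ('a, 'k, 'x::ab_group_add) amodule"
    and Y :: "'j::finite \<Rightarrow> ('a, 'k, 'y::ab_group_add) amodule"
    and \<B> :: "'i \<Rightarrow> 'j \<Rightarrow> ('a \<Rightarrow> 'y \<Rightarrow> 'x) set"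
  assumes X_fd: "\<And>i. fd_module sA (X i)"
    and Y_fd: "\<And>j. fd_module sA (Y j)"
    and cocycles: "\<And>i j. \<B> i j \<subseteq> Z1 sA (Y j) (X i)"
begin

lemma fd_X: "fd_space (X i)" and fd_Y: "fd_space (Y j)"
  and kmod_X: "kmod (X i)" and kmod_Y: "kmod (Y j)"
  using X_fd Y_fd by (auto intro: fd_module_kmod) (auto simp: fd_module_def)

lemmas lin_X = fd_space_lin_space[OF fd_X]
lemmas lin_Y = fd_space_lin_space[OF fd_Y]

lemma cocycle: "\<alpha> \<in> \<B> i j \<Longrightarrow> \<alpha> \<in> Z1 sA (Y j) (X i)"
  using cocycles by blast

lemma cocycle_hom_k: "\<alpha> \<in> \<B> i j \<Longrightarrow> \<alpha> a \<in> hom_k (Y j) (X i)"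
  using Z1D(1)[OF cocycle] .

section \<open>Coordinate inclusions and contractions of the image of a representation\<close>

abbreviation (input) "P M \<equiv> F_obj X Y \<B> M"
abbreviation (input) "spX M i \<equiv> rspace M (VX i)"
abbreviation (input) "spY M j \<equiv> rspace M (VY j)"

text \<open>For fixed \<open>v\<close> the map tensoring with \<open>v\<close>, placed in component
  \<open>i\<close>. As \<open>v\<close> varies, these maps play the role of the inclusions of copies
  of \<open>X i\<close> without a choice of basis.\<close>

definition inX ::
  "('k, 'v::ab_group_add, ('i, 'j) vertex, ('i, 'j, 'a, 'x, 'y) arrow) quiver_rep \<Rightarrow> 'i \<Rightarrow> 'v \<Rightarrow> 'x \<Rightarrow> _" where
  "inX M i v = on_carrier (X i)
     (\<lambda>x. (\<lambda>i'. if i' = i then pure_tensor (X i) (spX M i) x v else 0,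
           \<lambda>_::'j. 0 :: ('y \<Rightarrow> 'v \<Rightarrow> 'k) \<Rightarrow> 'k))"

definition inY ::
  "('k, 'v::ab_group_add, ('i, 'j) vertex, ('i, 'j, 'a, 'x, 'y) arrow) quiver_rep \<Rightarrow> 'j \<Rightarrow> 'v \<Rightarrow> 'y \<Rightarrow> _" where
  "inY M j v = on_carrier (Y j)
     (\<lambda>y. (\<lambda>_::'i. 0 :: ('x \<Rightarrow> 'v \<Rightarrow> 'k) \<Rightarrow> 'k,
           \<lambda>j'. if j' = j then pure_tensor (Y j) (spY M j) y v else 0))"

text \<open>The counterpart of \<open>inX\<close>: a functional instead of a vector selects a copy
  of \<open>X i\<close>. Cutting off at the carrier of \<open>F M\<close> makes it an element of
  \<open>hom_k\<close>.\<close>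

definition prX ::
  "('k, 'v::ab_group_add, ('i, 'j) vertex, ('i, 'j, 'a, 'x, 'y) arrow) quiver_rep \<Rightarrow> 'i \<Rightarrow> ('v \<Rightarrow> 'k) \<Rightarrow> _ \<Rightarrow> 'x"
  where "prX M i \<xi> = on_carrier (P M) (\<lambda>t. contr (X i) \<xi> (fst t i))"

definition prY ::
  "('k, 'v::ab_group_add, ('i, 'j) vertex, ('i, 'j, 'a, 'x, 'y) arrow) quiver_rep \<Rightarrow> 'j \<Rightarrow> ('v \<Rightarrow> 'k) \<Rightarrow> _ \<Rightarrow> 'y"
  where "prY M j \<xi> = on_carrier (P M) (\<lambda>t. contr (Y j) \<xi> (snd t j))"

context
  fixes M :: "('k, 'v::ab_group_add, ('i, 'j) vertex, ('i, 'j, 'a, 'x, 'y) arrow) quiver_rep"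
  assumes M: "fd_rep (quiver_K \<B>) M"
begin

lemma fd_rspace: "fd_space (rspace M p)"
  using M by (auto simp: fd_rep_def quiver_K_def)

lemmas lin_rspace = fd_space_lin_space[OF fd_rspace]

lemma rmap_hom_k:
  assumes "\<alpha> \<in> \<B> i j"
  shows "rmap M (i, j, \<alpha>) \<in> hom_k (spY M j) (spX M i)"
proof -
  have "(i, j, \<alpha>) \<in> arcs (quiver_K \<B>)"
    using assms by (auto simp: quiver_K_def)
  then show ?thesis
    using M by (fastforce simp: fd_rep_def quiver_K_def)
qed

lemma dual_rmap: "\<alpha> \<in> \<B> i j \<Longrightarrow> \<xi> \<in> dual (spX M i) \<Longrightarrow> \<xi> \<circ> rmap M (i, j, \<alpha>) \<in> dual (spY M j)"
  using dual_comp[OF lin_rspace lin_rspace _ rmap_hom_k] .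

lemma mem_P: "t \<in> vcarrier (P M) \<longleftrightarrow>
    (\<forall>i. fst t i \<in> vcarrier (tensor (X i) (spX M i))) \<and>
    (\<forall>j. snd t j \<in> vcarrier (tensor (Y j) (spY M j)))"
  by (auto simp: F_obj_def F_space_def split_beta mem_Times_iff)

lemma vscale_P: "vscale (P M) c t = (\<lambda>i. dual_scale c (fst t i), \<lambda>j. dual_scale c (snd t j))"
  by (simp add: F_obj_def F_space_def split_beta)

lemma lin_P: "lin_space (P M)"
proof -
  interpret vector_space "vscale (P M)"
    by standard (auto simp: vscale_P dual_scale_def fun_eq_iff algebra_simps prod_eq_iff)
  have "subspace (vcarrier (P M))"
    by (rule subspaceI) (auto simp: mem_P vscale_P intro: tensor_closed)
  then show ?thesis
    by (simp add: lin_space_def vector_space_axioms)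
qed

lemma inX_hom_k:
  assumes v: "v \<in> vcarrier (spX M i)"
  shows "inX M i v \<in> hom_k (X i) (P M)"
  using v
  by (intro hom_kI)
    (auto simp: inX_def on_carrier_def mem_P vscale_P pure_tensor_mem pure_tensor_linear prod_eq_iff
      fun_eq_iff dual_scale_def lin_space_closed[OF lin_X] tensor_closed(1))

lemma inY_hom_k:
  assumes v: "v \<in> vcarrier (spY M j)"
  shows "inY M j v \<in> hom_k (Y j) (P M)"
  using v
  by (intro hom_kI)
    (auto simp: inY_def on_carrier_def mem_P vscale_P pure_tensor_mem pure_tensor_linear prod_eq_iff
      fun_eq_iff dual_scale_def lin_space_closed[OF lin_Y] tensor_closed(1))

lemma inX_linear:
  assumes "u \<in> vcarrier (spX M i)"
  shows "v \<in> vcarrier (spX M i) \<Longrightarrow> inX M i (u + v) x = inX M i u x + inX M i v x"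
    and "inX M i (vscale (spX M i) c u) x = vscale (P M) c (inX M i u x)"
  using assms
  by (auto simp: inX_def on_carrier_def vscale_P pure_tensor_linear prod_eq_iff fun_eq_iff
      dual_scale_def)

lemma inY_linear:
  assumes "u \<in> vcarrier (spY M j)"
  shows "v \<in> vcarrier (spY M j) \<Longrightarrow> inY M j (u + v) y = inY M j u y + inY M j v y"
    and "inY M j (vscale (spY M j) c u) y = vscale (P M) c (inY M j u y)"
  using assms
  by (auto simp: inY_def on_carrier_def vscale_P pure_tensor_linear prod_eq_iff fun_eq_iff
      dual_scale_def)

lemma prX_hom_k: "prX M i \<xi> \<in> hom_k (P M) (X i)"
  using lin_space_closed[OF lin_P]
  by (intro hom_kI)
    (auto simp: prX_def on_carrier_def vscale_P contr_mem[OF fd_X] contr_linear[OF lin_X])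

lemma prY_hom_k: "prY M j \<xi> \<in> hom_k (P M) (Y j)"
  using lin_space_closed[OF lin_P]
  by (intro hom_kI)
    (auto simp: prY_def on_carrier_def vscale_P contr_mem[OF fd_Y] contr_linear[OF lin_Y])

lemma prX_expand:
  assumes "\<xi> \<in> dual (spX M i)"
  shows "(\<Sum>b\<in>basis_of (spX M i). vscale (X i) (\<xi> b) (prX M i (coord (spX M i) b) t)) = prX M i \<xi> t"
proof (cases "t \<in> vcarrier (P M)")
  case True
  then show ?thesis
    using contr_expand[OF fd_X fd_rspace _ assms] by (simp add: prX_def on_carrier_def) (simp add: mem_P)
next
  case False
  then show ?thesis
    using lin_space_scale(8)[OF lin_X] by (simp add: prX_def on_carrier_def)
qed

lemma prY_expand:
  assumes "\<xi> \<in> dual (spY M j)"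
  shows "(\<Sum>b\<in>basis_of (spY M j). vscale (Y j) (\<xi> b) (prY M j (coord (spY M j) b) t)) = prY M j \<xi> t"
proof (cases "t \<in> vcarrier (P M)")
  case True
  then show ?thesis
    using contr_expand[OF fd_Y fd_rspace _ assms] by (simp add: prY_def on_carrier_def) (simp add: mem_P)
next
  case False
  then show ?thesis
    using lin_space_scale(8)[OF lin_Y] by (simp add: prY_def on_carrier_def)
qed

lemma prX_inX:
  assumes "v \<in> vcarrier (spX M i')" "\<xi> \<in> dual (spX M i)" "x \<in> vcarrier (X i')"
  shows "prX M i \<xi> (inX M i' v x) = (if i = i' then vscale (X i') (\<xi> v) x else 0)"
  using assms hom_kD(1)[OF inX_hom_k assms(3)]
  by (auto simp: prX_def on_carrier_def)
    (auto simp: inX_def on_carrier_def contr_pure[OF fd_X] contr_linear[OF lin_X])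

lemma prY_inY:
  assumes "v \<in> vcarrier (spY M j')" "\<xi> \<in> dual (spY M j)" "y \<in> vcarrier (Y j')"
  shows "prY M j \<xi> (inY M j' v y) = (if j = j' then vscale (Y j') (\<xi> v) y else 0)"
  using assms hom_kD(1)[OF inY_hom_k assms(3)]
  by (auto simp: prY_def on_carrier_def)
    (auto simp: inY_def on_carrier_def contr_pure[OF fd_Y] contr_linear[OF lin_Y])

lemma prX_inY: "prX M i \<xi> (inY M j v y) = 0"
  by (simp add: prX_def inY_def on_carrier_def contr_linear[OF lin_X])

lemma prY_inX: "prY M j \<xi> (inX M i v x) = 0"
  by (simp add: prY_def inX_def on_carrier_def contr_linear[OF lin_Y])

text \<open>The identity of \<open>F M\<close> as a sum of contractions followed by inclusions.
  Every later factorisation of an endomorphism through the modules \<open>X i\<close> and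
  \<open>Y j\<close> comes from composing with this sum.\<close>

lemma expand_P:
  assumes t: "t \<in> vcarrier (P M)"
  shows "(\<Sum>i\<in>UNIV. \<Sum>b\<in>basis_of (spX M i). inX M i b (prX M i (coord (spX M i) b) t))
    + (\<Sum>j\<in>UNIV. \<Sum>b\<in>basis_of (spY M j). inY M j b (prY M j (coord (spY M j) b) t)) = t"
    (is "(\<Sum>i\<in>UNIV. ?x i) + (\<Sum>j\<in>UNIV. ?y j) = t")
proof -
  define gx gy where "gx i = ?x i" and "gy j = ?y j" for i j
  have x: "fst (gx i) i' = (if i' = i then fst t i else 0)" "snd (gx i) j = 0" for i i' j
    using tensor_expand[OF fd_X fd_rspace, of "fst t i" i "VX i"] t
    by (auto simp: gx_def inX_def prX_def on_carrier_def fst_sum snd_sum sum_fun_apply mem_P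
        contr_mem[OF fd_X])
  have y: "snd (gy j) j' = (if j' = j then snd t j else 0)" "fst (gy j) i = 0" for i j j'
    using tensor_expand[OF fd_Y fd_rspace, of "snd t j" j "VY j"] t
    by (auto simp: gy_def inY_def prY_def on_carrier_def fst_sum snd_sum sum_fun_apply mem_P
        contr_mem[OF fd_Y])
  have "fst (sum gx UNIV + sum gy UNIV) i = fst t i" "snd (sum gx UNIV + sum gy UNIV) j = snd t j" for i j
    by (simp_all add: fst_sum snd_sum sum_fun_apply x y)
  then have "fst (sum gx UNIV + sum gy UNIV) = fst t" "snd (sum gx UNIV + sum gy UNIV) = snd t"
    by blast+
  then have "sum gx UNIV + sum gy UNIV = t"
    by (rule prod_eqI)
  then show ?thesis
    by (simp only: gx_def[abs_def] gy_def[abs_def])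
qed

text \<open>By \<open>expand_P\<close> an element is determined by its contractions. Identities in
  \<open>F M\<close> thereby become identities in \<open>X i\<close> and \<open>Y j\<close>, without
  looking into tensors.\<close>

lemma eqI_P:
  assumes t: "t \<in> vcarrier (P M)" and s: "s \<in> vcarrier (P M)"
    and X: "\<And>i \<xi>. \<xi> \<in> dual (spX M i) \<Longrightarrow> prX M i \<xi> t = prX M i \<xi> s"
    and Y: "\<And>j \<xi>. \<xi> \<in> dual (spY M j) \<Longrightarrow> prY M j \<xi> t = prY M j \<xi> s"
  shows "t = s"
proof -
  note coord = dual_basis_props(3)[OF fd_rspace]
  show ?thesis
    using expand_P[OF t] unfolding X[OF coord] Y[OF coord] expand_P[OF s] by (rule sym)
qed

section \<open>The module structure on the image of a representation\<close>

lemma act_P: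
  assumes "t \<in> vcarrier (P M)"
  shows "act (P M) a t =
    (\<lambda>i. tensor_map (X i) (spX M i) (act (X i) a) (id_on_carrier (spX M i)) (fst t i) +
         (\<Sum>j\<in>UNIV. \<Sum>\<alpha>\<in>\<B> i j. tensor_map (X i) (spX M i) (\<alpha> a) (rmap M (i, j, \<alpha>)) (snd t j)),
     \<lambda>j. tensor_map (Y j) (spY M j) (act (Y j) a) (id_on_carrier (spY M j)) (snd t j))"
proof -
  have "t \<in> vcarrier (F_space X Y M)"
    using assms by (simp add: F_obj_def)
  then show ?thesis
    by (simp add: F_obj_def on_carrier_def split_beta)
qed

lemma act_P_mem:
  assumes "t \<in> vcarrier (P M)"
  shows "act (P M) a t \<in> vcarrier (P M)"
  using assms
  by (auto simp: act_P mem_P intro!: tensor_closed(2,6) tensor_map_mem cocycle_hom_k rmap_hom_k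
      kmodD(2)[OF kmod_X] kmodD(2)[OF kmod_Y] hom_k_id lin_rspace)

text \<open>The upper row of the block matrix seen through \<open>\<xi>\<close>: the block of an
  arrow \<open>\<alpha>\<close> applies \<open>\<alpha> a\<close> after contracting the
  \<open>Y\<close>-part with \<open>\<xi>\<close> pulled back along \<open>M \<alpha>\<close>. The
  sum measures how far \<open>prX\<close> is from a module homomorphism.\<close>

lemma prX_act:
  assumes t: "t \<in> vcarrier (P M)" and \<xi>: "\<xi> \<in> dual (spX M i)"
  shows "prX M i \<xi> (act (P M) a t) = act (X i) a (prX M i \<xi> t) +
    (\<Sum>j\<in>UNIV. \<Sum>\<alpha>\<in>\<B> i j. \<alpha> a (prY M j (\<xi> \<circ> rmap M (i, j, \<alpha>)) t))"
proof -
  \<comment> \<open>\<open>\<xi>\<close> is 0 outside its space, so composing it with the identity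
    cut off at the carrier gives \<open>\<xi>\<close> itself.\<close>
  note \<xi>_id = hom_k_id_comp(2)[OF \<xi>[unfolded dual_def] lin_space_field lin_rspace]
  have "contr (X i) \<xi> (tensor_map (X i) (spX M i) (act (X i) a)
      (id_on_carrier (spX M i)) (fst t i)) = act (X i) a (contr (X i) \<xi> (fst t i))"
    using contr_tensor_map[OF fd_X fd_X lin_rspace lin_rspace kmodD(2)[OF kmod_X]
        hom_k_id[OF lin_rspace] \<xi>] t
    by (simp only: \<xi>_id mem_P)
  moreover have "contr (X i) \<xi> (tensor_map (X i) (spX M i) (\<alpha> a) (rmap M (i, j, \<alpha>)) (snd t j))
      = \<alpha> a (contr (Y j) (\<xi> \<circ> rmap M (i, j, \<alpha>)) (snd t j))" if "\<alpha> \<in> \<B> i j" for j \<alpha>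
    using contr_tensor_map[OF fd_Y fd_X lin_rspace lin_rspace cocycle_hom_k[OF that]
        rmap_hom_k[OF that] \<xi>] t
    by (simp only: mem_P)
  moreover have "prX M i \<xi> (act (P M) a t) = contr (X i) \<xi> (fst (act (P M) a t) i)"
    "prX M i \<xi> t = contr (X i) \<xi> (fst t i)" "prY M j \<eta> t = contr (Y j) \<eta> (snd t j)" for j \<eta>
    using t act_P_mem[OF t] by (simp_all add: prX_def prY_def on_carrier_def)
  ultimately show ?thesis
    by (simp add: act_P[OF t] contr_linear(1)[OF lin_X] contr_sum[OF lin_X])
qed

lemma prY_act:
  assumes t: "t \<in> vcarrier (P M)" and \<xi>: "\<xi> \<in> dual (spY M j)"
  shows "prY M j \<xi> (act (P M) a t) = act (Y j) a (prY M j \<xi> t)"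
proof -
  note \<xi>_id = hom_k_id_comp(2)[OF \<xi>[unfolded dual_def] lin_space_field lin_rspace]
  have "contr (Y j) \<xi> (tensor_map (Y j) (spY M j) (act (Y j) a)
      (id_on_carrier (spY M j)) (snd t j)) = act (Y j) a (contr (Y j) \<xi> (snd t j))"
    using contr_tensor_map[OF fd_Y fd_Y lin_rspace lin_rspace kmodD(2)[OF kmod_Y]
        hom_k_id[OF lin_rspace] \<xi>] t
    by (simp only: \<xi>_id mem_P)
  moreover have "prY M j \<xi> (act (P M) a t) = contr (Y j) \<xi> (snd (act (P M) a t) j)"
    "prY M j \<xi> t = contr (Y j) \<xi> (snd t j)"
    using t act_P_mem[OF t] by (simp_all add: prY_def on_carrier_def)
  ultimately show ?thesis
    by (simp add: act_P[OF t])
qed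

lemma act_P_outside: "t \<notin> vcarrier (P M) \<Longrightarrow> act (P M) a t = 0"
  by (auto simp: F_obj_def on_carrier_def)

lemma act_P_hom_k: "act (P M) a \<in> hom_k (P M) (P M)"
proof (rule hom_kI)
  note closed = lin_space_closed[OF lin_P] act_P_mem
  note kX = hom_kD(2,3)[OF kmodD(2)[OF kmod_X]] and kY = hom_kD(2,3)[OF kmodD(2)[OF kmod_Y]]
  show "act (P M) a (s + t) = act (P M) a s + act (P M) a t"
    if "s \<in> vcarrier (P M)" "t \<in> vcarrier (P M)" for s t
    using that
    by (intro eqI_P)
      (simp_all add: closed prX_act prY_act hom_kD(1,2)[OF prX_hom_k] hom_kD(1,2)[OF prY_hom_k] kX kY
        hom_kD(2)[OF cocycle_hom_k] sum.distrib)
  show "act (P M) a (vscale (P M) c t) = vscale (P M) c (act (P M) a t)" if "t \<in> vcarrier (P M)" for c t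
    using that
    by (intro eqI_P)
      (simp_all add: closed prX_act prY_act hom_kD(1,3)[OF prX_hom_k] hom_kD(1,3)[OF prY_hom_k] kX kY
        hom_kD(3)[OF cocycle_hom_k] lin_space_scale[OF lin_X])
qed (auto simp: act_P_mem act_P_outside)

lemma kmod_P: "kmod (P M)"
  by (simp add: kmod_def lin_P act_P_hom_k)

lemma fd_space_P: "fd_space (P M)"
proof -
  interpret vector_space "vscale (P M)"
    by (rule lin_space_vector_space[OF lin_P])
  let ?S = "(\<Union>i. \<Union>b\<in>basis_of (spX M i). inX M i b ` basis_of (X i)) \<union>
    (\<Union>j. \<Union>b\<in>basis_of (spY M j). inY M j b ` basis_of (Y j))"
  have X: "inX M i b x \<in> span ?S" if b: "b \<in> basis_of (spX M i)" and x: "x \<in> vcarrier (X i)" for i b x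
  proof -
    note hom = inX_hom_k[OF dual_basis_props(2)[OF fd_rspace b]]
    have "inX M i b x = inX M i b (\<Sum>m\<in>basis_of (X i). vscale (X i) (coord (X i) m x) m)"
      by (simp add: dual_basis_props(4)[OF fd_X x])
    also have "\<dots> = (\<Sum>m\<in>basis_of (X i). vscale (P M) (coord (X i) m x) (inX M i b m))"
      using dual_basis_props(2)[OF fd_X] lin_space_closed(5)[OF lin_X]
      by (simp add: hom_k_sum[OF lin_X hom] hom_kD(3)[OF hom])
    also have "\<dots> \<in> span ?S"
      using b by (intro span_sum span_scale span_base UnI1) auto
    finally show ?thesis .
  qed
  have Y: "inY M j b y \<in> span ?S" if b: "b \<in> basis_of (spY M j)" and y: "y \<in> vcarrier (Y j)" for j b y
  proof -
    note hom = inY_hom_k[OF dual_basis_props(2)[OF fd_rspace b]]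
    have "inY M j b y = inY M j b (\<Sum>m\<in>basis_of (Y j). vscale (Y j) (coord (Y j) m y) m)"
      by (simp add: dual_basis_props(4)[OF fd_Y y])
    also have "\<dots> = (\<Sum>m\<in>basis_of (Y j). vscale (P M) (coord (Y j) m y) (inY M j b m))"
      using dual_basis_props(2)[OF fd_Y] lin_space_closed(5)[OF lin_Y]
      by (simp add: hom_k_sum[OF lin_Y hom] hom_kD(3)[OF hom])
    also have "\<dots> \<in> span ?S"
      using b by (intro span_sum span_scale span_base UnI2) auto
    finally show ?thesis .
  qed
  have "t \<in> span ?S" if t: "t \<in> vcarrier (P M)" for t
  proof -
    have "(\<Sum>i\<in>UNIV. \<Sum>b\<in>basis_of (spX M i). inX M i b (prX M i (coord (spX M i) b) t))
      + (\<Sum>j\<in>UNIV. \<Sum>b\<in>basis_of (spY M j). inY M j b (prY M j (coord (spY M j) b) t)) \<in> span ?S"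
      by (intro span_add span_sum X Y hom_kD(1)[OF prX_hom_k t] hom_kD(1)[OF prY_hom_k t])
    then show ?thesis
      by (simp only: expand_P[OF t])
  qed
  moreover have "span ?S \<subseteq> vcarrier (P M)"
    using hom_kD(1)[OF inX_hom_k] hom_kD(1)[OF inY_hom_k] dual_basis_props(2)[OF fd_rspace]
      dual_basis_props(2)[OF fd_X] dual_basis_props(2)[OF fd_Y] lin_space_subspace[OF lin_P]
    by (intro span_minimal) auto
  moreover have "finite ?S"
    using dual_basis_props(1)[OF fd_rspace] dual_basis_props(1)[OF fd_X] dual_basis_props(1)[OF fd_Y]
    by auto
  ultimately show ?thesis
    using lin_P by (auto simp: fd_space_def lin_space_def intro!: exI[of _ ?S])
qed

text \<open>Both units act as the identity, so the product rule at \<open>1 * 1\<close> reads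
  \<open>\<alpha> 1 y = \<alpha> 1 y + \<alpha> 1 y\<close>.\<close>

lemma cocycle_one:
  assumes \<alpha>: "\<alpha> \<in> \<B> i j" and y: "y \<in> vcarrier (Y j)"
  shows "\<alpha> 1 y = 0"
proof -
  have "act (Y j) 1 y = y"
    using Y_fd[of j] y by (simp add: fd_module_def on_carrier_def)
  moreover have "act (X i) 1 (\<alpha> 1 y) = \<alpha> 1 y"
    using X_fd[of i] hom_kD(1)[OF cocycle_hom_k[OF \<alpha>] y] by (simp add: fd_module_def on_carrier_def)
  ultimately show ?thesis
    using Z1D(4)[OF cocycle[OF \<alpha>], of 1 1 y] by simp
qed

text \<open>Each axiom is checked under contractions. On the diagonal it is the axiom for
  \<open>X i\<close> or \<open>Y j\<close>; off the diagonal it is the corresponding property of the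
  cocycles, the product rule giving multiplicativity and \<open>cocycle_one\<close> the unit
  law.\<close>

lemma fd_module_P: "fd_module sA (P M)"
proof -
  note closed = lin_space_closed[OF lin_P] act_P_mem
  note memX = hom_kD(1)[OF prX_hom_k] and memY = hom_kD(1)[OF prY_hom_k]
  note linX = hom_kD(2,3)[OF prX_hom_k] and linY = hom_kD(2,3)[OF prY_hom_k]
  have X: "act (X i) (a + b) x = act (X i) a x + act (X i) b x"
    "act (X i) (sA c a) x = vscale (X i) c (act (X i) a x)"
    "act (X i) (a * b) x = act (X i) a (act (X i) b x)"
    "x \<in> vcarrier (X i) \<Longrightarrow> act (X i) 1 x = x" for i a b c x
    using X_fd[of i] by (auto simp: fd_module_def on_carrier_def)
  have Y: "act (Y i) (a + b) x = act (Y i) a x + act (Y i) b x"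
    "act (Y i) (sA c a) x = vscale (Y i) c (act (Y i) a x)"
    "act (Y i) (a * b) x = act (Y i) a (act (Y i) b x)"
    "x \<in> vcarrier (Y i) \<Longrightarrow> act (Y i) 1 x = x" for i a b c x
    using Y_fd[of i] by (auto simp: fd_module_def on_carrier_def)
  have outside: "act (P M) a t = 0" if "t \<notin> vcarrier (P M)" for a t
    using act_P_outside[OF that] .
  have "act (P M) (a + b) t = act (P M) a t + act (P M) b t" for a b t
  proof (cases "t \<in> vcarrier (P M)")
    case True
    then show ?thesis
      by (intro eqI_P)
        (simp_all add: closed prX_act prY_act linX linY X Y Z1D(2)[OF cocycle] sum.distrib)
  qed (simp add: outside)
  moreover have "act (P M) (sA c a) t = vscale (P M) c (act (P M) a t)" for a c t
  proof (cases "t \<in> vcarrier (P M)")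
    case True
    then show ?thesis
      by (intro eqI_P)
        (simp_all add: closed prX_act prY_act linX linY X Y Z1D(3)[OF cocycle]
          lin_space_scale[OF lin_X])
  qed (simp add: outside lin_space_scale[OF lin_P])
  moreover have "act (P M) 1 t = id_on_carrier (P M) t" for t
  proof (cases "t \<in> vcarrier (P M)")
    case True
    then have "act (P M) 1 t = t"
      by (intro eqI_P) (simp_all add: closed prX_act prY_act X(4) Y(4) memX memY cocycle_one)
    then show ?thesis
      using True by (simp add: on_carrier_def)
  qed (simp add: outside on_carrier_def)
  moreover have "act (P M) (a * b) t = act (P M) a (act (P M) b t)" for a b t
  proof (cases "t \<in> vcarrier (P M)")
    case True
    have "act (X i) a (u + (\<Sum>j\<in>UNIV. \<Sum>\<alpha>\<in>\<B> i j. \<alpha> b (prY M j (\<xi> \<circ> rmap M (i, j, \<alpha>)) t)))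
      = act (X i) a u + (\<Sum>j\<in>UNIV. \<Sum>\<alpha>\<in>\<B> i j. act (X i) a (\<alpha> b (prY M j (\<xi> \<circ> rmap M (i, j, \<alpha>)) t)))"
      if "u \<in> vcarrier (X i)" for i u \<xi>
    proof -
      note hom = kmodD(2)[OF kmod_X]
      have m: "\<alpha> b (prY M j \<eta> t) \<in> vcarrier (X i)" if "\<alpha> \<in> \<B> i j" for j \<alpha> \<eta>
        using hom_kD(1)[OF cocycle_hom_k[OF that] memY[OF True]] .
      show ?thesis
        using that m
        by (subst hom_kD(2)[OF hom])
          (auto simp: hom_k_sum[OF lin_X hom] lin_space_closed(6)[OF lin_X])
    qed
    then show ?thesis
      using True
      by (intro eqI_P)
        (simp_all add: closed prX_act prY_act dual_rmap X Y Z1D(4)[OF cocycle] memX hom_kD(1)[OF kmodD(2)[OF kmod_X]] sum.distrib add.assoc)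
  qed (simp add: outside hom_k_0[OF lin_P act_P_hom_k])
  ultimately show ?thesis
    by (auto simp: fd_module_def fd_space_P act_P_hom_k fun_eq_iff)
qed

text \<open>No arrow leaves a vertex of \<open>X\<close>, so the \<open>X\<close>-part is a
  submodule and \<open>inX\<close> is a module homomorphism.\<close>

lemma act_inX:
  assumes v: "v \<in> vcarrier (spX M i)" and x: "x \<in> vcarrier (X i)"
  shows "act (P M) a (inX M i v x) = inX M i v (act (X i) a x)"
proof (rule eqI_P)
  note mem = hom_kD(1)[OF inX_hom_k[OF v]]
  have ax: "act (X i) a x \<in> vcarrier (X i)"
    using hom_kD(1)[OF kmodD(2)[OF kmod_X] x] .
  show "act (P M) a (inX M i v x) \<in> vcarrier (P M)" "inX M i v (act (X i) a x) \<in> vcarrier (P M)"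
    using mem x ax by (auto intro: act_P_mem)
  show "prX M i' \<xi> (act (P M) a (inX M i v x)) = prX M i' \<xi> (inX M i v (act (X i) a x))"
    if "\<xi> \<in> dual (spX M i')" for i' \<xi>
    using that v x ax
    by (simp add: prX_act mem prX_inX prY_inX hom_k_0[OF lin_Y cocycle_hom_k]
        hom_kD(3)[OF kmodD(2)[OF kmod_X]] hom_k_0[OF lin_X kmodD(2)[OF kmod_X]])
  show "prY M j \<xi> (act (P M) a (inX M i v x)) = prY M j \<xi> (inX M i v (act (X i) a x))"
    if "\<xi> \<in> dual (spY M j)" for j \<xi>
    using that x by (simp add: prY_act mem prY_inX hom_k_0[OF lin_Y kmodD(2)[OF kmod_Y]])
qed

text \<open>The failure of \<open>inY\<close> to be a module homomorphism: each arrow leaving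
  \<open>VY j\<close> contributes a term, and all these terms lie in the
  \<open>X\<close>-part.\<close>

lemma act_inY:
  assumes v: "v \<in> vcarrier (spY M j)" and y: "y \<in> vcarrier (Y j)"
  shows "act (P M) a (inY M j v y) = inY M j v (act (Y j) a y) +
    (\<Sum>i\<in>UNIV. \<Sum>\<alpha>\<in>\<B> i j. inX M i (rmap M (i, j, \<alpha>) v) (\<alpha> a y))" (is "_ = _ + ?s")
proof (rule eqI_P)
  note mem = hom_kD(1)[OF inY_hom_k[OF v]]
  have ay: "act (Y j) a y \<in> vcarrier (Y j)"
    using hom_kD(1)[OF kmodD(2)[OF kmod_Y] y] .
  have \<alpha>: "\<alpha> a y \<in> vcarrier (X i)" "rmap M (i, j, \<alpha>) v \<in> vcarrier (spX M i)"
    if "\<alpha> \<in> \<B> i j" for i \<alpha>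
    using hom_kD(1)[OF cocycle_hom_k[OF that] y] hom_kD(1)[OF rmap_hom_k[OF that] v] by auto
  have sm: "inX M i (rmap M (i, j, \<alpha>) v) (\<alpha> a y) \<in> vcarrier (P M)" if "\<alpha> \<in> \<B> i j" for i \<alpha>
    using hom_kD(1)[OF inX_hom_k] \<alpha>[OF that] by auto
  have ssm: "(\<Sum>\<alpha>\<in>\<B> i j. inX M i (rmap M (i, j, \<alpha>) v) (\<alpha> a y)) \<in> vcarrier (P M)" for i
    using sm by (rule lin_space_closed(6)[OF lin_P])
  have s: "?s \<in> vcarrier (P M)"
    using ssm by (rule lin_space_closed(6)[OF lin_P])
  show "act (P M) a (inY M j v y) \<in> vcarrier (P M)" "inY M j v (act (Y j) a y) + ?s \<in> vcarrier (P M)"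
    using mem y ay s by (auto intro: act_P_mem lin_space_closed(2)[OF lin_P])
  show "prX M i \<xi> (act (P M) a (inY M j v y)) = prX M i \<xi> (inY M j v (act (Y j) a y) + ?s)"
    if \<xi>: "\<xi> \<in> dual (spX M i)" for i \<xi>
  proof -
    have "(\<Sum>\<alpha>\<in>\<B> i j'. \<alpha> a (prY M j' (\<xi> \<circ> rmap M (i, j', \<alpha>)) (inY M j v y)))
        = (if j' = j then \<Sum>\<alpha>\<in>\<B> i j. vscale (X i) (\<xi> (rmap M (i, j, \<alpha>) v)) (\<alpha> a y) else 0)" for j'
      using v y \<xi>
      by (auto simp: prY_inY dual_rmap hom_k_0[OF lin_Y cocycle_hom_k] hom_kD(3)[OF cocycle_hom_k]
          intro!: sum.cong sum.neutral)
    then have "prX M i \<xi> (act (P M) a (inY M j v y))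
        = (\<Sum>\<alpha>\<in>\<B> i j. vscale (X i) (\<xi> (rmap M (i, j, \<alpha>) v)) (\<alpha> a y))"
      using y \<xi> by (simp add: prX_act mem prX_inY hom_k_0[OF lin_X kmodD(2)[OF kmod_X]])
    moreover have "prX M i \<xi> ?s = (\<Sum>i'\<in>UNIV. \<Sum>\<alpha>\<in>\<B> i' j. prX M i \<xi> (inX M i' (rmap M (i', j, \<alpha>) v) (\<alpha> a y)))"
      using sm ssm by (simp add: hom_k_sum[OF lin_P prX_hom_k])
    moreover have "(\<Sum>\<alpha>\<in>\<B> i' j. prX M i \<xi> (inX M i' (rmap M (i', j, \<alpha>) v) (\<alpha> a y)))
        = (if i' = i then \<Sum>\<alpha>\<in>\<B> i j. vscale (X i) (\<xi> (rmap M (i, j, \<alpha>) v)) (\<alpha> a y) else 0)" for i'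
      using \<alpha> \<xi> by (auto simp: prX_inX)
    ultimately show ?thesis
      using y ay s by (simp add: hom_kD(2)[OF prX_hom_k] mem prX_inY)
  qed
  show "prY M j' \<xi> (act (P M) a (inY M j v y)) = prY M j' \<xi> (inY M j v (act (Y j) a y) + ?s)"
    if \<xi>: "\<xi> \<in> dual (spY M j')" for j' \<xi>
  proof -
    have "prY M j' \<xi> ?s = 0"
      using sm ssm by (simp add: hom_k_sum[OF lin_P prY_hom_k] prY_inX)
    then show ?thesis
      using v y ay s \<xi>
      by (simp add: hom_kD(2)[OF prY_hom_k] mem prY_inY prY_act hom_kD(3)[OF kmodD(2)[OF kmod_Y]]
          hom_k_0[OF lin_Y kmodD(2)[OF kmod_Y]])
  qed
qed

end

end

section \<open>The top part of a homomorphism between images of the functor\<close>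

lemma hom_A_inv:
  assumes N: "kmod N" and M: "kmod M" and f: "f \<in> hom_A N M"
    and bij: "bij_betw f (vcarrier N) (vcarrier M)"
  obtains g where "g \<in> hom_A M N" "g \<circ> f = id_on_carrier N" "f \<circ> g = id_on_carrier M"
proof -
  obtain g where g: "g \<in> hom_k M N" "g \<circ> f = id_on_carrier N" "f \<circ> g = id_on_carrier M"
    using hom_k_inv[OF kmodD(1)[OF N] kmodD(1)[OF M] hom_AD(1)[OF f] bij] .
  have "g (act M a w) = act N a (g w)" if w: "w \<in> vcarrier M" for a w
  proof -
    have fg: "f (g w) = w" and gf: "g (f (act N a (g w))) = act N a (g w)"
      using fun_cong[OF g(3), of w] fun_cong[OF g(2), of "act N a (g w)"] w hom_kD(1)[OF g(1) w]
        hom_kD(1)[OF kmodD(2)[OF N]] by (simp_all add: on_carrier_def)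
    then show ?thesis
      by (simp add: hom_AD(2)[OF f])
  qed
  then have "g \<in> hom_A M N"
    by (intro hom_AI M N g(1))
  then show ?thesis
    using g(2,3) by (rule that)
qed

text \<open>The projection to \<open>U\<close> along \<open>W\<close>; it turns a decomposition into
  an idempotent, which has a top part.\<close>

lemma direct_sum_projection:
  assumes M: "kmod M" and U: "submodule M U" and W: "submodule M W"
    and sum: "internal_direct_sum (vcarrier M) U W"
  obtains e where "e \<in> hom_A M M" "e \<circ> e = e" "\<And>u. u \<in> U \<Longrightarrow> e u = u" "\<And>w. w \<in> W \<Longrightarrow> e w = 0"
proof -
  note mod = lin_space_module[OF kmodD(1)[OF M]]
  note lin = kmodD(1)[OF M]
  have subU: "module.subspace (vscale M) U" "U \<subseteq> vcarrier M" "\<And>a u. u \<in> U \<Longrightarrow> act M a u \<in> U"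
    and subW: "module.subspace (vscale M) W" "W \<subseteq> vcarrier M" "\<And>a u. u \<in> W \<Longrightarrow> act M a u \<in> W"
    using U W by (auto simp: submodule_def)
  note clU = module.subspace_0[OF mod subU(1)] module.subspace_add[OF mod subU(1)]
    module.subspace_scale[OF mod subU(1)] module.subspace_diff[OF mod subU(1)]
  note clW = module.subspace_0[OF mod subW(1)] module.subspace_add[OF mod subW(1)]
    module.subspace_scale[OF mod subW(1)] module.subspace_diff[OF mod subW(1)]
  have uniq: "u = u'" if "u \<in> U" "u' \<in> U" "w \<in> W" "w' \<in> W" "u + w = u' + w'" for u u' w w'
  proof -
    have "u - u' = w' - w"
      using that(5) by (simp add: algebra_simps)
    then have "u - u' \<in> U \<inter> W"
      using clU(4)[OF that(1,2)] clW(4)[OF that(4,3)] by simp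
    then have "u - u' \<in> {0}"
      using sum by (simp only: internal_direct_sum_def)
    then show ?thesis
      by simp
  qed
  define e where "e = on_carrier M (\<lambda>v. THE u. u \<in> U \<and> (\<exists>w\<in>W. v = u + w))"
  have eI: "e (u + w) = u" if "u \<in> U" "w \<in> W" for u w
  proof -
    have "u + w \<in> vcarrier M"
      using that subU(2) subW(2) lin_space_closed(2)[OF lin] by blast
    moreover have "(THE u'. u' \<in> U \<and> (\<exists>w'\<in>W. u + w = u' + w')) = u"
      using that uniq by (intro the_equality) (blast, metis)
    ultimately show ?thesis
      by (simp add: e_def on_carrier_def)
  qed
  have split: "\<exists>u\<in>U. \<exists>w\<in>W. v = u + w" if "v \<in> vcarrier M" for v
    using that sum unfolding internal_direct_sum_def by blast
  have e: "e \<in> hom_A M M"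
  proof (intro hom_AI hom_kI M)
    fix u v assume "u \<in> vcarrier M" "v \<in> vcarrier M"
    then obtain u1 u2 v1 v2 where uv: "u1 \<in> U" "u2 \<in> W" "v1 \<in> U" "v2 \<in> W" "u = u1 + u2" "v = v1 + v2"
      using split by meson
    have "u + v = (u1 + v1) + (u2 + v2)"
      by (simp add: uv algebra_simps)
    then have "e (u + v) = u1 + v1"
      by (simp only: eI[OF clU(2)[OF uv(1,3)] clW(2)[OF uv(2,4)]])
    then show "e (u + v) = e u + e v"
      using eI uv by simp
  next
    fix c v assume "v \<in> vcarrier M"
    then obtain v1 v2 where v: "v1 \<in> U" "v2 \<in> W" "v = v1 + v2"
      using split by meson
    then show "e (vscale M c v) = vscale M c (e v)"
      using eI[OF clU(3)[OF v(1)] clW(3)[OF v(2)], of c c] eI by (simp add: lin_space_scale[OF lin])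
  next
    fix a v assume "v \<in> vcarrier M"
    then obtain v1 v2 where v: "v1 \<in> U" "v2 \<in> W" "v = v1 + v2"
      using split by meson
    have "act M a v = act M a v1 + act M a v2"
      using hom_kD(2)[OF kmodD(2)[OF M]] v subU(2) subW(2) by blast
    then show "e (act M a v) = act M a (e v)"
      using eI[OF subU(3)[OF v(1)] subW(3)[OF v(2)], of a a] eI v by simp
  next
    fix v assume "v \<in> vcarrier M"
    then obtain v1 v2 where v: "v1 \<in> U" "v2 \<in> W" "v = v1 + v2"
      using split by meson
    then show "e v \<in> vcarrier M"
      using eI subU(2) by auto
  qed (simp add: e_def on_carrier_def)
  have eU: "e u = u" if "u \<in> U" for u
    using eI[OF that clW(1)] by simp
  have eW: "e w = 0" if "w \<in> W" for w
    using eI[OF clU(1) that] by simp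
  have "e \<circ> e = e"
  proof (rule hom_A_eqI[OF hom_A_comp[OF M M M e e] e])
    fix v assume "v \<in> vcarrier M"
    then obtain v1 v2 where v: "v1 \<in> U" "v2 \<in> W" "v = v1 + v2"
      using split by meson
    then show "(e \<circ> e) v = e v"
      using eI eU by simp
  qed
  then show ?thesis
    using that e eU eW by blast
qed

lemma rep_hom_quiver_K:
  "rep_hom (quiver_K \<B>) M M' f \<longleftrightarrow> (\<forall>p. f p \<in> hom_k (rspace M p) (rspace M' p)) \<and>
    (\<forall>i j. \<forall>\<alpha>\<in>\<B> i j. f (VX i) \<circ> rmap M (i, j, \<alpha>) = rmap M' (i, j, \<alpha>) \<circ> f (VY j))"
  by (fastforce simp: rep_hom_def quiver_K_def)

lemma subrep_quiver_K:
  "subrep (quiver_K \<B>) M U \<longleftrightarrow>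
    (\<forall>p. module.subspace (vscale (rspace M p)) (U p) \<and> U p \<subseteq> vcarrier (rspace M p)) \<and>
    (\<forall>i j. \<forall>\<alpha>\<in>\<B> i j. \<forall>u\<in>U (VY j). rmap M (i, j, \<alpha>) u \<in> U (VX i))"
  by (fastforce simp: subrep_def quiver_K_def)

text \<open>Vanishing of homomorphisms from \<open>X\<close> to \<open>Y\<close> is stated for
  summands, since it is applied to block entries; \<open>hom_A_summands_zero\<close> derives this
  form from the direct sums.\<close>

locale independent_cocycle_family =
  cocycle_family sA X Y \<B> + X: indec_family sA X + Y: indec_family sA Y
  for sA :: "'k::alg_closed_field \<Rightarrow> 'a::ring_1 \<Rightarrow> 'a"
    and X :: "'i::finite \<Rightarrow> ('a, 'k, 'x::ab_group_add) amodule"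
    and Y :: "'j::finite \<Rightarrow> ('a, 'k, 'y::ab_group_add) amodule"
    and \<B> :: "'i \<Rightarrow> 'j \<Rightarrow> ('a \<Rightarrow> 'y \<Rightarrow> 'x) set" +
  assumes hom_X_Y: "\<And>i j f. f \<in> hom_A (X i) (Y j) \<Longrightarrow> f = 0"
    and independent: "\<And>i j c \<alpha>. (\<Sum>\<alpha>\<in>\<B> i j. cocycle_scale (X i) (c \<alpha>) \<alpha>)
        \<in> RadZ_plus_B sA (direct_sum X) (direct_sum Y) (Y j) (X i) \<Longrightarrow> \<alpha> \<in> \<B> i j \<Longrightarrow> c \<alpha> = 0"
begin

section \<open>Diagonal blocks of a homomorphism between images of the functor\<close>

definition compX where
  "compX M M' \<rho> i' \<xi> i v = prX M' i' \<xi> \<circ> \<rho> \<circ> inX M i v"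

definition compY where
  "compY M M' \<rho> j' \<xi> j v = prY M' j' \<xi> \<circ> \<rho> \<circ> inY M j v"

text \<open>The top parts at the two kinds of vertices together. The block from \<open>Y\<close> to
  \<open>X\<close> is not recorded here; it reappears as the cochain \<open>h\<close> in the proof
  of \<open>rep_top_rep_hom\<close>.\<close>

definition rep_top where
  "rep_top M M' \<rho> f \<longleftrightarrow>
     top_part X (\<lambda>i. spX M i) (\<lambda>i. spX M' i) (compX M M' \<rho>) (\<lambda>i. f (VX i)) \<and>
     top_part Y (\<lambda>j. spY M j) (\<lambda>j. spY M' j) (compY M M' \<rho>) (\<lambda>j. f (VY j))"

context
  fixes M :: "('k, 'v::ab_group_add, ('i, 'j) vertex, ('i, 'j, 'a, 'x, 'y) arrow) quiver_rep"
    and M' :: "('k, 'w::ab_group_add, ('i, 'j) vertex, ('i, 'j, 'a, 'x, 'y) arrow) quiver_rep"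
    and \<rho>
  assumes M: "fd_rep (quiver_K \<B>) M" and M': "fd_rep (quiver_K \<B>) M'"
    and \<rho>: "\<rho> \<in> hom_A (P M) (P M')"
begin

lemma \<rho>_mem: "\<rho> t \<in> vcarrier (P M')"
  using hom_k_mem[OF lin_P[OF M'] hom_AD(1)[OF \<rho>]] .

text \<open>Inclusions of \<open>X\<close> and contractions to \<open>Y\<close> are module
  homomorphisms, so this composite is one from \<open>X i\<close> to \<open>Y j\<close> and hence 0.
  This is the triangularity of \<open>\<rho>\<close>.\<close>

lemma prY_\<rho>_inX:
  assumes v: "v \<in> vcarrier (spX M i)" and \<xi>: "\<xi> \<in> dual (spY M' j)"
  shows "prY M' j \<xi> (\<rho> (inX M i v x)) = 0"
proof -
  have "prY M' j \<xi> \<circ> (\<rho> \<circ> inX M i v) \<in> hom_A (X i) (Y j)"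
  proof (intro hom_AI kmod_X kmod_Y)
    show "prY M' j \<xi> \<circ> (\<rho> \<circ> inX M i v) \<in> hom_k (X i) (Y j)"
      by (intro hom_k_comp[OF lin_P[OF M'] lin_Y] hom_k_comp[OF lin_P[OF M] lin_P[OF M']] inX_hom_k M v hom_AD(1)[OF \<rho>]
          prY_hom_k M')
    show "(prY M' j \<xi> \<circ> (\<rho> \<circ> inX M i v)) (act (X i) a x)
        = act (Y j) a ((prY M' j \<xi> \<circ> (\<rho> \<circ> inX M i v)) x)" if "x \<in> vcarrier (X i)" for a x
      by (simp add: act_inX[OF M v that, symmetric] hom_AD(2)[OF \<rho>] prY_act[OF M' \<rho>_mem \<xi>])
  qed
  then have "prY M' j \<xi> \<circ> (\<rho> \<circ> inX M i v) = 0"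
    by (rule hom_X_Y)
  then have "(prY M' j \<xi> \<circ> (\<rho> \<circ> inX M i v)) x = 0 x"
    by (rule fun_cong)
  then show ?thesis
    by simp
qed

lemma \<rho>_inX_expand:
  assumes v: "v \<in> vcarrier (spX M i)"
  shows "(\<Sum>i'\<in>UNIV. \<Sum>b\<in>basis_of (spX M' i').
    inX M' i' b (compX M M' \<rho> i' (coord (spX M' i') b) i v x)) = \<rho> (inX M i v x)"
proof -
  note coord = dual_basis_props(3)[OF fd_rspace[OF M']]
  note basis = dual_basis_props(2)[OF fd_rspace[OF M']]
  have "(\<Sum>j\<in>UNIV. \<Sum>b\<in>basis_of (spY M' j).
      inY M' j b (prY M' j (coord (spY M' j) b) (\<rho> (inX M i v x)))) = 0"
    by (simp add: prY_\<rho>_inX[OF v coord] hom_k_0[OF lin_Y inY_hom_k[OF M' basis]])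
  then show ?thesis
    using expand_P[OF M' \<rho>_mem, of "inX M i v x"] by (simp add: compX_def)
qed

text \<open>The error terms of \<open>prX\<close> are values of cocycles on
  \<open>Y\<close>-contractions, and these vanish on \<open>\<rho> (inX M i v x)\<close> by
  triangularity.\<close>

lemma compX_hom_A:
  assumes v: "v \<in> vcarrier (spX M i)" and \<xi>: "\<xi> \<in> dual (spX M' i')"
  shows "compX M M' \<rho> i' \<xi> i v \<in> hom_A (X i) (X i')"
  unfolding compX_def
proof (intro hom_AI kmod_X)
  show "prX M' i' \<xi> \<circ> \<rho> \<circ> inX M i v \<in> hom_k (X i) (X i')"
    by (intro hom_k_comp[OF lin_P[OF M] lin_X] hom_k_comp[OF lin_P[OF M'] lin_X] inX_hom_k M v hom_AD(1)[OF \<rho>]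
        prX_hom_k M')
  show "(prX M' i' \<xi> \<circ> \<rho> \<circ> inX M i v) (act (X i) a x) = act (X i') a ((prX M' i' \<xi> \<circ> \<rho> \<circ> inX M i v) x)"
    if "x \<in> vcarrier (X i)" for a x
    by (simp add: act_inX[OF M v that, symmetric] hom_AD(2)[OF \<rho>] prX_act[OF M' \<rho>_mem \<xi>]
        prY_\<rho>_inX[OF v dual_rmap[OF M' _ \<xi>]] hom_k_0[OF lin_Y cocycle_hom_k])
qed

text \<open>Dually, the error terms of \<open>inY\<close> lie in the \<open>X\<close>-part, which
  \<open>prY\<close> after \<open>\<rho>\<close> annihilates.\<close>

lemma compY_hom_A:
  assumes v: "v \<in> vcarrier (spY M j)" and \<xi>: "\<xi> \<in> dual (spY M' j')"
  shows "compY M M' \<rho> j' \<xi> j v \<in> hom_A (Y j) (Y j')"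
  unfolding compY_def
proof (intro hom_AI kmod_Y)
  have hom: "prY M' j' \<xi> \<circ> \<rho> \<in> hom_k (P M) (Y j')"
    by (intro hom_k_comp[OF lin_P[OF M'] lin_Y] hom_AD(1)[OF \<rho>] prY_hom_k M')
  show "prY M' j' \<xi> \<circ> \<rho> \<circ> inY M j v \<in> hom_k (Y j) (Y j')"
    by (intro hom_k_comp[OF lin_P[OF M] lin_Y] hom inY_hom_k M v)
  show "(prY M' j' \<xi> \<circ> \<rho> \<circ> inY M j v) (act (Y j) a y) = act (Y j') a ((prY M' j' \<xi> \<circ> \<rho> \<circ> inY M j v) y)"
    if y: "y \<in> vcarrier (Y j)" for a y
  proof -
    let ?s = "\<lambda>i. \<Sum>\<alpha>\<in>\<B> i j. inX M i (rmap M (i, j, \<alpha>) v) (\<alpha> a y)"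
    have rv: "rmap M (i, j, \<alpha>) v \<in> vcarrier (spX M i)" if "\<alpha> \<in> \<B> i j" for i \<alpha>
      using hom_kD(1)[OF rmap_hom_k[OF M that] v] .
    have m: "inX M i (rmap M (i, j, \<alpha>) v) (\<alpha> a y) \<in> vcarrier (P M)" if "\<alpha> \<in> \<B> i j" for i \<alpha>
      using hom_k_mem[OF lin_P[OF M] inX_hom_k[OF M rv[OF that]]] .
    have sm: "?s i \<in> vcarrier (P M)" for i
      using m by (rule lin_space_closed(6)[OF lin_P[OF M]])
    have 0: "(prY M' j' \<xi> \<circ> \<rho>) (?s i) = 0" for i
    proof -
      have "(prY M' j' \<xi> \<circ> \<rho>) (?s i)
          = (\<Sum>\<alpha>\<in>\<B> i j. (prY M' j' \<xi> \<circ> \<rho>) (inX M i (rmap M (i, j, \<alpha>) v) (\<alpha> a y)))"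
        by (rule hom_k_sum[OF lin_P[OF M] hom m])
      then show ?thesis
        by (simp add: prY_\<rho>_inX[OF rv \<xi>])
    qed
    have "(prY M' j' \<xi> \<circ> \<rho>) (sum ?s UNIV) = 0"
      unfolding hom_k_sum[OF lin_P[OF M] hom sm] by (simp only: 0 sum.neutral_const)
    moreover have "(prY M' j' \<xi> \<circ> \<rho>) (inY M j v (act (Y j) a y) + sum ?s UNIV)
        = (prY M' j' \<xi> \<circ> \<rho>) (inY M j v (act (Y j) a y)) + (prY M' j' \<xi> \<circ> \<rho>) (sum ?s UNIV)"
      by (intro hom_kD(2)[OF hom] hom_k_mem[OF lin_P[OF M] inY_hom_k[OF M v]] lin_space_closed(6)[OF lin_P[OF M]] sm)
    ultimately have "prY M' j' \<xi> (\<rho> (inY M j v (act (Y j) a y))) = prY M' j' \<xi> (\<rho> (act (P M) a (inY M j v y)))"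
      by (simp add: act_inY[OF M v y])
    then show ?thesis
      by (simp add: hom_AD(2)[OF \<rho>] prY_act[OF M' \<rho>_mem \<xi>])
  qed
qed

lemma block_matrix_compX:
  "block_matrix X (\<lambda>i. spX M i) (\<lambda>i. spX M' i) (compX M M' \<rho>)"
proof -
  have hom: "prX M' i' \<xi> \<circ> \<rho> \<in> hom_k (P M) (X i')" for i' \<xi>
    by (intro hom_k_comp[OF lin_P[OF M'] lin_X] hom_AD(1)[OF \<rho>] prX_hom_k M')
  have "compX M M' \<rho> i' \<xi> i (u + v) = compX M M' \<rho> i' \<xi> i u + compX M M' \<rho> i' \<xi> i v"
    if "u \<in> vcarrier (spX M i)" "v \<in> vcarrier (spX M i)" for i i' \<xi> u v
    using that hom_kD(2)[OF hom hom_k_mem[OF lin_P[OF M] inX_hom_k[OF M that(1)]]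
        hom_k_mem[OF lin_P[OF M] inX_hom_k[OF M that(2)]]]
    by (auto simp: compX_def fun_eq_iff inX_linear[OF M])
  moreover have "compX M M' \<rho> i' \<xi> i (vscale (spX M i) c v) = scal (X i') c \<circ> compX M M' \<rho> i' \<xi> i v"
    if v: "v \<in> vcarrier (spX M i)" for i i' \<xi> c v
  proof -
    have "prX M' i' \<xi> (\<rho> (vscale (P M) c (inX M i v x))) = vscale (X i') c (prX M' i' \<xi> (\<rho> (inX M i v x)))" for x
      using hom_kD(3)[OF hom hom_k_mem[OF lin_P[OF M] inX_hom_k[OF M v]]] by simp
    then show ?thesis
      using hom_k_mem[OF lin_X prX_hom_k[OF M']]
      by (auto simp: compX_def fun_eq_iff inX_linear[OF M v] scal_def on_carrier_def)
  qed
  moreover have "compX M M' \<rho> i' \<xi> i v = (\<Sum>b\<in>basis_of (spX M' i').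
      scal (X i') (\<xi> b) \<circ> compX M M' \<rho> i' (coord (spX M' i') b) i v)"
    if "\<xi> \<in> dual (spX M' i')" for i i' \<xi> v
    using hom_k_mem[OF lin_X prX_hom_k[OF M']]
    by (auto simp: compX_def fun_eq_iff sum_fun_apply scal_def on_carrier_def prX_expand[OF M' that])
  ultimately show ?thesis
    unfolding block_matrix_def using compX_hom_A by blast
qed

lemma block_matrix_compY:
  "block_matrix Y (\<lambda>j. spY M j) (\<lambda>j. spY M' j) (compY M M' \<rho>)"
proof -
  have hom: "prY M' i' \<xi> \<circ> \<rho> \<in> hom_k (P M) (Y i')" for i' \<xi>
    by (intro hom_k_comp[OF lin_P[OF M'] lin_Y] hom_AD(1)[OF \<rho>] prY_hom_k M')
  have "compY M M' \<rho> i' \<xi> i (u + v) = compY M M' \<rho> i' \<xi> i u + compY M M' \<rho> i' \<xi> i v"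
    if "u \<in> vcarrier (spY M i)" "v \<in> vcarrier (spY M i)" for i i' \<xi> u v
    using that hom_kD(2)[OF hom hom_k_mem[OF lin_P[OF M] inY_hom_k[OF M that(1)]]
        hom_k_mem[OF lin_P[OF M] inY_hom_k[OF M that(2)]]]
    by (auto simp: compY_def fun_eq_iff inY_linear[OF M])
  moreover have "compY M M' \<rho> i' \<xi> i (vscale (spY M i) c v) = scal (Y i') c \<circ> compY M M' \<rho> i' \<xi> i v"
    if v: "v \<in> vcarrier (spY M i)" for i i' \<xi> c v
  proof -
    have "prY M' i' \<xi> (\<rho> (vscale (P M) c (inY M i v x))) = vscale (Y i') c (prY M' i' \<xi> (\<rho> (inY M i v x)))" for x
      using hom_kD(3)[OF hom hom_k_mem[OF lin_P[OF M] inY_hom_k[OF M v]]] by simp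
    then show ?thesis
      using hom_k_mem[OF lin_Y prY_hom_k[OF M']]
      by (auto simp: compY_def fun_eq_iff inY_linear[OF M v] scal_def on_carrier_def)
  qed
  moreover have "compY M M' \<rho> i' \<xi> i v = (\<Sum>b\<in>basis_of (spY M' i').
      scal (Y i') (\<xi> b) \<circ> compY M M' \<rho> i' (coord (spY M' i') b) i v)"
    if "\<xi> \<in> dual (spY M' i')" for i i' \<xi> v
    using hom_k_mem[OF lin_Y prY_hom_k[OF M']]
    by (auto simp: compY_def fun_eq_iff sum_fun_apply scal_def on_carrier_def prY_expand[OF M' that])
  ultimately show ?thesis
    unfolding block_matrix_def using compY_hom_A by blast
qed

lemma rep_top_exists: "\<exists>f. rep_top M M' \<rho> f"
proof -
  obtain fX where fX: "top_part X (\<lambda>i. spX M i) (\<lambda>i. spX M' i) (compX M M' \<rho>) fX"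
    using X.top_part_exists[OF fd_rspace[OF M] fd_rspace[OF M'] block_matrix_compX] by blast
  obtain fY where fY: "top_part Y (\<lambda>j. spY M j) (\<lambda>j. spY M' j) (compY M M' \<rho>) fY"
    using Y.top_part_exists[OF fd_rspace[OF M] fd_rspace[OF M'] block_matrix_compY] by blast
  show ?thesis
    using fX fY
    by (intro exI[of _ "\<lambda>p. case p of VX i \<Rightarrow> fX i | VY j \<Rightarrow> fY j"]) (simp add: rep_top_def)
qed

lemma rep_top_unique:
  assumes "rep_top M M' \<rho> f" "rep_top M M' \<rho> g"
  shows "f p = g p"
proof (cases p)
  case (VX i)
  then show ?thesis
    using X.top_part_unique[of "\<lambda>i. spX M' i", OF fd_rspace[OF M']] assms unfolding rep_top_def by metis
next
  case (VY j)
  then show ?thesis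
    using Y.top_part_unique[of "\<lambda>j. spY M' j", OF fd_rspace[OF M']] assms unfolding rep_top_def by metis
qed

text \<open>
  Applying \<open>\<rho>\<close> to the action on \<open>y \<otimes> v\<close> and contracting with \<open>\<xi>\<close> expresses the combination of the
  cocycles with the coefficients \<open>\<xi> (f (M \<alpha> v)) - \<xi> (M' \<alpha> (f v))\<close> as a sum of products of cocycles
  with radical maps and of the coboundary of \<open>y \<mapsto> \<xi> (\<rho> (y \<otimes> v))\<close>.
\<close>

lemma rep_top_rep_hom:
  assumes f: "rep_top M M' \<rho> f"
  shows "rep_hom (quiver_K \<B>) M M' f"
proof -
  note tX = top_partD[OF f[unfolded rep_top_def, THEN conjunct1]]
  note tY = top_partD[OF f[unfolded rep_top_def, THEN conjunct2]]
  have hom: "f p \<in> hom_k (rspace M p) (rspace M' p)" for p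
    by (cases p) (auto intro: tX(1) tY(1))
  have comm: "f (VX i) (rmap M (i, j, \<beta>) v) = rmap M' (i, j, \<beta>) (f (VY j) v)"
    if \<beta>: "\<beta> \<in> \<B> i j" and v: "v \<in> vcarrier (spY M j)" for i j \<beta> v
  proof -
    note rm = hom_kD(1)[OF rmap_hom_k[OF M] v]
    note fv = hom_kD(1)[OF hom v]
    have "\<xi> (f (VX i) (rmap M (i, j, \<beta>) v) - rmap M' (i, j, \<beta>) (f (VY j) v)) = 0"
      if \<xi>: "\<xi> \<in> dual (spX M' i)" for \<xi>
    proof -
      define c where "c \<alpha> = \<xi> (f (VX i) (rmap M (i, j, \<alpha>) v)) - \<xi> (rmap M' (i, j, \<alpha>) (f (VY j) v))" for \<alpha>
      \<comment> \<open>In \<open>r\<close> and \<open>s\<close> the scalar given by the top part is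
        removed from the diagonal entries, and the other entries are left unchanged. All of them are
        then radical, while the removed scalars make up \<open>c\<close>.\<close>
      define r where "r i' \<alpha> = compX M M' \<rho> i \<xi> i' (rmap M (i', j, \<alpha>) v)
        - (if i' = i then scal (X i) (\<xi> (f (VX i) (rmap M (i, j, \<alpha>) v))) else 0)" for i' \<alpha>
      define s where "s j' \<alpha> = compY M M' \<rho> j' (\<xi> \<circ> rmap M' (i, j', \<alpha>)) j v
        - (if j' = j then scal (Y j) (\<xi> (rmap M' (i, j, \<alpha>) (f (VY j) v))) else 0)" for j' \<alpha>
      \<comment> \<open>The block from \<open>Y j\<close> to \<open>X i\<close> at
        \<open>\<xi>\<close> and \<open>v\<close>, in general only linear.\<close>
      define h where "h = prX M' i \<xi> \<circ> \<rho> \<circ> inY M j v"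
      have r: "r i' \<alpha> \<in> rad_hom (X i') (X i)" if "\<alpha> \<in> \<B> i' j" for i' \<alpha>
        using tX(2)[OF \<xi> rm] X.off_diagonal_rad[OF compX_hom_A[OF rm \<xi>]] that
        by (auto simp: r_def)
      have s: "s j' \<alpha> \<in> rad_hom (Y j) (Y j')" if "\<alpha> \<in> \<B> i j'" for j' \<alpha>
        using tY(2)[OF dual_rmap[OF M' _ \<xi>] v] Y.off_diagonal_rad[OF compY_hom_A[OF v dual_rmap[OF M' _ \<xi>]]] that
        by (auto simp: s_def)
      have h: "h \<in> hom_k (Y j) (X i)"
        unfolding h_def
        by (intro hom_k_comp[OF lin_P[OF M] lin_X] hom_k_comp[OF lin_P[OF M'] lin_X] inY_hom_k M v hom_AD(1)[OF \<rho>]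
            prX_hom_k M')
      let ?G1 = "{\<lambda>a. \<rho> \<circ> \<zeta> a | \<rho> \<zeta>. \<rho> \<in> rad_hom (direct_sum X) (X i) \<and> \<zeta> \<in> Z1 sA (Y j) (direct_sum X)}"
      let ?G2 = "{\<lambda>a. \<zeta> a \<circ> \<rho> | \<zeta> \<rho>. \<zeta> \<in> Z1 sA (direct_sum Y) (X i) \<and> \<rho> \<in> rad_hom (Y j) (direct_sum Y)}"
      interpret C: vector_space "cocycle_scale (X i)"
        by (rule vector_space_cocycle_scale[OF lin_X])
      define S1 where "S1 = (\<Sum>i'\<in>UNIV. \<Sum>\<alpha>\<in>\<B> i' j. (\<lambda>a. r i' \<alpha> \<circ> \<alpha> a))"
      define S2 where "S2 = (\<Sum>j'\<in>UNIV. \<Sum>\<alpha>\<in>\<B> i j'. (\<lambda>a. \<alpha> a \<circ> s j' \<alpha>))"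
      have "(\<lambda>a. r i' \<alpha> \<circ> \<alpha> a) \<in> ?G1" if "\<alpha> \<in> \<B> i' j" for i' \<alpha>
        by (rule rad_comp_cocycle_generator[of X, OF kmod_X kmod_Y r[OF that] cocycle[OF that]])
      then have "S1 \<in> C.span ?G1"
        unfolding S1_def by (intro C.span_sum C.span_base)
      then have S1: "- S1 \<in> C.span ?G1"
        by (rule C.span_neg)
      have "(\<lambda>a. \<alpha> a \<circ> s j' \<alpha>) \<in> ?G2" if "\<alpha> \<in> \<B> i j'" for j' \<alpha>
        by (rule cocycle_comp_rad_generator[of Y, OF kmod_Y kmod_X s[OF that] cocycle[OF that]])
      then have S2: "S2 \<in> C.span ?G2"
        unfolding S2_def by (intro C.span_sum C.span_base)
      let ?b = "\<lambda>a. (act (X i) a \<circ> h) - (h \<circ> act (Y j) a)"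
      have eq: "(\<Sum>\<alpha>\<in>\<B> i j. cocycle_scale (X i) (c \<alpha>) \<alpha>) a y = ((- S1 + S2) + ?b) a y" for a y
      \<comment> \<open>Cocycles are compared as functions on the whole ambient type; outside the
        carrier every term is 0.\<close>
      proof (cases "y \<in> vcarrier (Y j)")
        case False
        have zero: "\<alpha> a y = 0" if "\<alpha> \<in> \<B> i' j" for i' \<alpha>
          using hom_kD(4)[OF cocycle_hom_k[OF that] False] .
        have "s j' \<alpha> y = 0" if "\<alpha> \<in> \<B> i j'" for j' \<alpha>
          using hom_kD(4)[OF hom_AD(1)[OF rad_hom_hom_A[OF s[OF that]]] False] .
        moreover have "(\<Sum>\<alpha>\<in>\<B> i' j. r i' \<alpha> (\<alpha> a y)) = 0" for i'
        proof (intro sum.neutral ballI)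
          fix \<alpha> assume \<alpha>: "\<alpha> \<in> \<B> i' j"
          show "r i' \<alpha> (\<alpha> a y) = 0"
            unfolding zero[OF \<alpha>] using hom_k_0[OF lin_X hom_AD(1)[OF rad_hom_hom_A[OF r[OF \<alpha>]]]] .
        qed
        moreover have "(\<Sum>\<alpha>\<in>\<B> i j. vscale (X i) (c \<alpha>) (\<alpha> a y)) = 0"
        proof (intro sum.neutral ballI)
          fix \<alpha> assume \<alpha>: "\<alpha> \<in> \<B> i j"
          show "vscale (X i) (c \<alpha>) (\<alpha> a y) = 0"
            unfolding zero[OF \<alpha>] by (rule lin_space_scale(8)[OF lin_X])
        qed
        ultimately show ?thesis
          using hom_kD(4)[OF h False] hom_kD(4)[OF kmodD(2)[OF kmod_Y] False] hom_k_0[OF lin_Y h]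
          by (simp add: S1_def S2_def sum_fun_apply cocycle_scale_def lin_space_scale[OF lin_X]
              hom_k_0[OF lin_X kmodD(2)[OF kmod_X]] hom_k_0[OF lin_Y cocycle_hom_k])
      next
        case y: True
        note ay = hom_kD(1)[OF cocycle_hom_k y]
        note Yy = inY_hom_k[OF M v]
        have pr: "prX M' i \<xi> \<circ> \<rho> \<in> hom_k (P M) (X i)"
          by (intro hom_k_comp[OF lin_P[OF M'] lin_X] hom_AD(1)[OF \<rho>] prX_hom_k M')
        have inm: "inX M i' (rmap M (i', j, \<alpha>) v) (\<alpha> a y) \<in> vcarrier (P M)" if "\<alpha> \<in> \<B> i' j" for i' \<alpha>
          using hom_k_mem[OF lin_P[OF M] inX_hom_k[OF M rm[OF that]]] .
        have insm: "(\<Sum>\<alpha>\<in>\<B> i' j. inX M i' (rmap M (i', j, \<alpha>) v) (\<alpha> a y)) \<in> vcarrier (P M)" for i'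
          using inm by (rule lin_space_closed(6)[OF lin_P[OF M]])
        \<comment> \<open>Two computations of the same element: the action is expanded before
          \<open>\<rho>\<close> by \<open>act_inY\<close>, and after \<open>\<rho>\<close> by
          \<open>prX_act\<close>.\<close>
        have "h (act (Y j) a y) + (\<Sum>i'\<in>UNIV. \<Sum>\<alpha>\<in>\<B> i' j. compX M M' \<rho> i \<xi> i' (rmap M (i', j, \<alpha>) v) (\<alpha> a y))
            = (prX M' i \<xi> \<circ> \<rho>) (act (P M) a (inY M j v y))"
          using inm insm
          by (simp add: act_inY[OF M v y] hom_kD(2)[OF pr] hom_k_sum[OF lin_P[OF M] pr]
              hom_k_mem[OF lin_P[OF M] Yy] lin_space_closed(6)[OF lin_P[OF M]] h_def compX_def
              del: comp_apply) simp
        also have "\<dots> = act (X i) a (h y) + (\<Sum>j'\<in>UNIV. \<Sum>\<alpha>\<in>\<B> i j'.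
            \<alpha> a (compY M M' \<rho> j' (\<xi> \<circ> rmap M' (i, j', \<alpha>)) j v y))"
          by (simp add: hom_AD(2)[OF \<rho>] prX_act[OF M' \<rho>_mem \<xi>] h_def compY_def)
        finally have main: "h (act (Y j) a y) + (\<Sum>i'\<in>UNIV. \<Sum>\<alpha>\<in>\<B> i' j. compX M M' \<rho> i \<xi> i' (rmap M (i', j, \<alpha>) v) (\<alpha> a y))
            = act (X i) a (h y) + (\<Sum>j'\<in>UNIV. \<Sum>\<alpha>\<in>\<B> i j'. \<alpha> a (compY M M' \<rho> j' (\<xi> \<circ> rmap M' (i, j', \<alpha>)) j v y))" .
        have "(\<Sum>\<alpha>\<in>\<B> i' j. compX M M' \<rho> i \<xi> i' (rmap M (i', j, \<alpha>) v) (\<alpha> a y))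
            = (\<Sum>\<alpha>\<in>\<B> i' j. r i' \<alpha> (\<alpha> a y))
              + (if i' = i then \<Sum>\<alpha>\<in>\<B> i j. vscale (X i) (\<xi> (f (VX i) (rmap M (i, j, \<alpha>) v))) (\<alpha> a y) else 0)" for i'
          using ay by (auto simp: r_def scal_def on_carrier_def sum.distrib[symmetric] intro!: sum.cong)
        then have X: "(\<Sum>i'\<in>UNIV. \<Sum>\<alpha>\<in>\<B> i' j. compX M M' \<rho> i \<xi> i' (rmap M (i', j, \<alpha>) v) (\<alpha> a y))
            = S1 a y + (\<Sum>\<alpha>\<in>\<B> i j. vscale (X i) (\<xi> (f (VX i) (rmap M (i, j, \<alpha>) v))) (\<alpha> a y))"
          by (simp add: S1_def sum_fun_apply sum.distrib)
        have cY: "compY M M' \<rho> j' (\<xi> \<circ> rmap M' (i, j', \<alpha>)) j v y = s j' \<alpha> y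
            + (if j' = j then vscale (Y j) (\<xi> (rmap M' (i, j, \<alpha>) (f (VY j) v))) y else 0)" for j' \<alpha>
          using y by (simp add: s_def scal_def on_carrier_def)
        have "(\<Sum>\<alpha>\<in>\<B> i j'. \<alpha> a (compY M M' \<rho> j' (\<xi> \<circ> rmap M' (i, j', \<alpha>)) j v y))
            = (\<Sum>\<alpha>\<in>\<B> i j'. \<alpha> a (s j' \<alpha> y))
              + (if j' = j then \<Sum>\<alpha>\<in>\<B> i j. vscale (X i) (\<xi> (rmap M' (i, j, \<alpha>) (f (VY j) v))) (\<alpha> a y) else 0)" for j'
        proof -
          have step: "\<alpha> a (s j' \<alpha> y + (if j' = j then vscale (Y j) d y else 0))
              = \<alpha> a (s j' \<alpha> y) + (if j' = j then vscale (X i) d (\<alpha> a y) else 0)" if "\<alpha> \<in> \<B> i j'" for \<alpha> d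
            using hom_kD(2)[OF cocycle_hom_k[OF that] hom_k_mem[OF lin_Y hom_AD(1)[OF rad_hom_hom_A[OF s[OF that]]]]]
              hom_kD(3)[OF cocycle_hom_k[OF that]] lin_space_closed(5)[OF lin_Y y] y
            by auto
          have "(\<Sum>\<alpha>\<in>\<B> i j'. \<alpha> a (compY M M' \<rho> j' (\<xi> \<circ> rmap M' (i, j', \<alpha>)) j v y))
              = (\<Sum>\<alpha>\<in>\<B> i j'. \<alpha> a (s j' \<alpha> y)
                + (if j' = j then vscale (X i) (\<xi> (rmap M' (i, j, \<alpha>) (f (VY j) v))) (\<alpha> a y) else 0))"
            unfolding cY by (intro sum.cong refl step)
          then show ?thesis
            by (auto simp: sum.distrib)
        qed
        then have Y: "(\<Sum>j'\<in>UNIV. \<Sum>\<alpha>\<in>\<B> i j'. \<alpha> a (compY M M' \<rho> j' (\<xi> \<circ> rmap M' (i, j', \<alpha>)) j v y))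
            = S2 a y + (\<Sum>\<alpha>\<in>\<B> i j. vscale (X i) (\<xi> (rmap M' (i, j, \<alpha>) (f (VY j) v))) (\<alpha> a y))"
          by (simp add: S2_def sum_fun_apply sum.distrib)
        have "(\<Sum>\<alpha>\<in>\<B> i j. cocycle_scale (X i) (c \<alpha>) \<alpha>) a y
            = (\<Sum>\<alpha>\<in>\<B> i j. vscale (X i) (\<xi> (f (VX i) (rmap M (i, j, \<alpha>) v))) (\<alpha> a y))
              - (\<Sum>\<alpha>\<in>\<B> i j. vscale (X i) (\<xi> (rmap M' (i, j, \<alpha>) (f (VY j) v))) (\<alpha> a y))"
          by (simp add: sum_fun_apply cocycle_scale_def c_def lin_space_scale[OF lin_X] sum_subtractf)
        moreover have "u - w = (- s1 + s2) + (k - l)" if "l + (s1 + u) = k + (s2 + w)" for k l s1 s2 u w :: 'x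
        proof -
          have "u = (l + (s1 + u)) - (l + s1)"
            by (simp add: algebra_simps)
          then have "u = (k + (s2 + w)) - (l + s1)"
            by (simp only: that)
          then show ?thesis
            by (simp add: algebra_simps)
        qed
        ultimately show ?thesis
          using main[unfolded X Y] by simp
      qed
      have "(\<Sum>\<alpha>\<in>\<B> i j. cocycle_scale (X i) (c \<alpha>) \<alpha>) = (- S1 + S2) + ?b"
        by (intro ext) (rule eq)
      moreover have "- S1 + S2 \<in> RadZ sA (direct_sum X) (direct_sum Y) (Y j) (X i)"
        unfolding RadZ_def using S1 S2 by blast
      moreover have "?b \<in> B1 (Y j) (X i)"
        unfolding B1_def using h by blast
      ultimately have "(\<Sum>\<alpha>\<in>\<B> i j. cocycle_scale (X i) (c \<alpha>) \<alpha>)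
          \<in> RadZ_plus_B sA (direct_sum X) (direct_sum Y) (Y j) (X i)"
        unfolding RadZ_plus_B_def by blast
      then have "c \<beta> = 0"
        using \<beta> by (rule independent)
      then show ?thesis
        using hom_k_diff[OF lin_rspace[OF M'] \<xi>[unfolded dual_def] hom_kD(1)[OF hom rm[OF \<beta>]]
            hom_kD(1)[OF rmap_hom_k[OF M' \<beta>] fv]]
        by (simp add: c_def)
    qed
    then have "f (VX i) (rmap M (i, j, \<beta>) v) - rmap M' (i, j, \<beta>) (f (VY j) v) = 0"
      using dual_separates[OF fd_rspace[OF M'] lin_space_closed(3)[OF lin_rspace[OF M']
          hom_kD(1)[OF hom rm[OF \<beta>]] hom_kD(1)[OF rmap_hom_k[OF M' \<beta>] fv]]] by blast
    then show ?thesis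
      by simp
  qed
  have "f (VX i) (rmap M (i, j, \<beta>) v) = rmap M' (i, j, \<beta>) (f (VY j) v)" if \<beta>: "\<beta> \<in> \<B> i j" for i j \<beta> v
  proof (cases "v \<in> vcarrier (spY M j)")
    case True
    then show ?thesis
      using comm[OF \<beta>] by simp
  next
    case False
    then show ?thesis
      using hom_kD(4)[OF hom False] hom_kD(4)[OF rmap_hom_k[OF M \<beta>] False]
        hom_k_0[OF lin_rspace[OF M] hom] hom_k_0[OF lin_rspace[OF M'] rmap_hom_k[OF M' \<beta>]] by simp
  qed
  then have "f (VX i) \<circ> rmap M (i, j, \<beta>) = rmap M' (i, j, \<beta>) \<circ> f (VY j)" if "\<beta> \<in> \<B> i j" for i j \<beta>
    using that by (intro ext) simp
  then show ?thesis
    using hom by (simp add: rep_hom_quiver_K)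
qed

end

end

section \<open>Functoriality of the top part\<close>

context independent_cocycle_family
begin

lemma rep_top_hom_k: "rep_top M M' \<rho> f \<Longrightarrow> f p \<in> hom_k (rspace M p) (rspace M' p)"
  by (cases p) (auto simp: rep_top_def intro: top_partD(1))

text \<open>Diagonal blocks of block triangular matrices multiply without mixed terms. On
  \<open>X\<close> this holds because \<open>\<rho>\<close> maps the \<open>X\<close>-part to the
  \<open>X\<close>-part; on \<open>Y\<close> because \<open>\<sigma>\<close> followed by
  \<open>prY\<close> annihilates the \<open>X\<close>-part.\<close>

lemma rep_top_comp:
  assumes M: "fd_rep (quiver_K \<B>) M" and M': "fd_rep (quiver_K \<B>) M'" and M'': "fd_rep (quiver_K \<B>) M''"
    and \<rho>: "\<rho> \<in> hom_A (P M) (P M')" and \<sigma>: "\<sigma> \<in> hom_A (P M') (P M'')"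
    and f: "rep_top M M' \<rho> f" and g: "rep_top M' M'' \<sigma> g"
  shows "rep_top M M'' (\<sigma> \<circ> \<rho>) (\<lambda>p. g p \<circ> f p)"
proof -
  note basis = dual_basis_props(2)[OF fd_rspace[OF M']]
  note coord = dual_basis_props(3)[OF fd_rspace[OF M']]
  note lin = lin_P[OF M']
  have homX: "prX M'' i \<xi> \<circ> \<sigma> \<in> hom_k (P M') (X i)" for i \<xi>
    by (intro hom_k_comp[OF lin_P[OF M''] lin_X] hom_AD(1)[OF \<sigma>] prX_hom_k M'')
  have homY: "prY M'' j \<xi> \<circ> \<sigma> \<in> hom_k (P M') (Y j)" for j \<xi>
    by (intro hom_k_comp[OF lin_P[OF M''] lin_Y] hom_AD(1)[OF \<sigma>] prY_hom_k M'')
  have inX_mem: "inX M' i b x \<in> vcarrier (P M')" if "b \<in> basis_of (spX M' i)" for i b x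
    using hom_k_mem[OF lin inX_hom_k[OF M' basis[OF that]]] .
  have inY_mem: "inY M' j b y \<in> vcarrier (P M')" if "b \<in> basis_of (spY M' j)" for j b y
    using hom_k_mem[OF lin inY_hom_k[OF M' basis[OF that]]] .
  have sumX: "h (\<Sum>i\<in>UNIV. \<Sum>b\<in>basis_of (spX M' i). inX M' i b (x i b))
      = (\<Sum>i\<in>UNIV. \<Sum>b\<in>basis_of (spX M' i). h (inX M' i b (x i b)))"
    if h: "h \<in> hom_k (P M') N" for h N and x :: "'i \<Rightarrow> _ \<Rightarrow> 'x"
    by (rule hom_k_double_sum[OF lin h inX_mem])
  have sumY: "h (\<Sum>i\<in>UNIV. \<Sum>b\<in>basis_of (spY M' i). inY M' i b (x i b))
      = (\<Sum>i\<in>UNIV. \<Sum>b\<in>basis_of (spY M' i). h (inY M' i b (x i b)))"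
    if h: "h \<in> hom_k (P M') N" for h N and x :: "'j \<Rightarrow> _ \<Rightarrow> 'y"
    by (rule hom_k_double_sum[OF lin h inY_mem])
  have "top_part X (\<lambda>i. spX M i) (\<lambda>i. spX M'' i) (compX M M'' (\<sigma> \<circ> \<rho>))
      (\<lambda>i. g (VX i) \<circ> f (VX i))"
  proof (rule X.top_part_comp[OF fd_rspace[OF M'] block_matrix_compX[OF M' M'' \<sigma>] _
        block_matrix_compX[OF M M' \<rho>] _ lin_rspace[OF M] lin_rspace[OF M'']])
    fix i \<xi> v assume \<xi>: "\<xi> \<in> dual (spX M'' i)" and v: "v \<in> vcarrier (spX M i)"
    have "prX M'' i \<xi> (\<sigma> (\<rho> (inX M i v x))) = (\<Sum>i'\<in>UNIV. \<Sum>b\<in>basis_of (spX M' i').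
        compX M' M'' \<sigma> i \<xi> i' b (compX M M' \<rho> i' (coord (spX M' i') b) i v x))" for x
      using sumX[OF homX, of i \<xi> "\<lambda>i' b. compX M M' \<rho> i' (coord (spX M' i') b) i v x"]
      by (simp add: \<rho>_inX_expand[OF M M' \<rho> v]) (simp add: compX_def[of M' M''])
    then show "compX M M'' (\<sigma> \<circ> \<rho>) i \<xi> i v = (\<Sum>i'\<in>UNIV. \<Sum>b\<in>basis_of (spX M' i').
        compX M' M'' \<sigma> i \<xi> i' b \<circ> compX M M' \<rho> i' (coord (spX M' i') b) i v)"
      by (simp add: fun_eq_iff sum_fun_apply) (simp add: compX_def[of M M''])
  qed (use f g in \<open>simp_all add: rep_top_def\<close>)
  moreover have "top_part Y (\<lambda>j. spY M j) (\<lambda>j. spY M'' j) (compY M M'' (\<sigma> \<circ> \<rho>))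
      (\<lambda>j. g (VY j) \<circ> f (VY j))"
  proof (rule Y.top_part_comp[OF fd_rspace[OF M'] block_matrix_compY[OF M' M'' \<sigma>] _
        block_matrix_compY[OF M M' \<rho>] _ lin_rspace[OF M] lin_rspace[OF M'']])
    fix j \<xi> v assume \<xi>: "\<xi> \<in> dual (spY M'' j)" and v: "v \<in> vcarrier (spY M j)"
    have "prY M'' j \<xi> (\<sigma> (\<rho> (inY M j v y))) = (\<Sum>j'\<in>UNIV. \<Sum>b\<in>basis_of (spY M' j').
        compY M' M'' \<sigma> j \<xi> j' b (compY M M' \<rho> j' (coord (spY M' j') b) j v y))" for y
    proof -
      let ?sX = "\<Sum>i\<in>UNIV. \<Sum>b\<in>basis_of (spX M' i).
        inX M' i b (prX M' i (coord (spX M' i) b) (\<rho> (inY M j v y)))"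
      let ?sY = "\<Sum>j'\<in>UNIV. \<Sum>b\<in>basis_of (spY M' j').
        inY M' j' b (prY M' j' (coord (spY M' j') b) (\<rho> (inY M j v y)))"
      have "(prY M'' j \<xi> \<circ> \<sigma>) (?sX + ?sY) = (prY M'' j \<xi> \<circ> \<sigma>) ?sX + (prY M'' j \<xi> \<circ> \<sigma>) ?sY"
        by (intro hom_kD(2)[OF homY] lin_space_closed(6)[OF lin] inX_mem inY_mem)
      \<comment> \<open>Of the expansion of \<open>\<rho> (inY M j v y)\<close> only the
        \<open>Y\<close>-terms remain.\<close>
      also have "(prY M'' j \<xi> \<circ> \<sigma>) ?sX = 0"
        unfolding sumX[OF homY] by (simp add: prY_\<rho>_inX[OF M' M'' \<sigma> basis \<xi>])
      also have "?sX + ?sY = \<rho> (inY M j v y)"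
        by (rule expand_P[OF M' \<rho>_mem[OF M M' \<rho>]])
      finally show ?thesis
        unfolding sumY[OF homY] by (simp add: compY_def)
    qed
    then show "compY M M'' (\<sigma> \<circ> \<rho>) j \<xi> j v = (\<Sum>j'\<in>UNIV. \<Sum>b\<in>basis_of (spY M' j').
        compY M' M'' \<sigma> j \<xi> j' b \<circ> compY M M' \<rho> j' (coord (spY M' j') b) j v)"
      by (simp add: fun_eq_iff sum_fun_apply) (simp add: compY_def[of M M''])
  qed (use f g in \<open>simp_all add: rep_top_def\<close>)
  ultimately show ?thesis
    by (simp add: rep_top_def)
qed

lemma rep_top_id:
  assumes M: "fd_rep (quiver_K \<B>) M"
  shows "rep_top M M (id_on_carrier (P M)) (\<lambda>p. id_on_carrier (rspace M p))"
proof -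
  have "compX M M (id_on_carrier (P M)) i \<xi> i v = scal (X i) (\<xi> v)"
    if "\<xi> \<in> dual (spX M i)" "v \<in> vcarrier (spX M i)" for i \<xi> v
  proof
    fix x
    show "compX M M (id_on_carrier (P M)) i \<xi> i v x = scal (X i) (\<xi> v) x"
      using that hom_k_mem[OF lin_P[OF M] inX_hom_k[OF M that(2)]] hom_kD(4)[OF inX_hom_k[OF M that(2)]]
        hom_k_0[OF lin_P[OF M] prX_hom_k[OF M]]
      by (cases "x \<in> vcarrier (X i)")
        (simp_all add: compX_def scal_def on_carrier_def prX_inX[OF M])
  qed
  moreover have "compY M M (id_on_carrier (P M)) j \<xi> j v = scal (Y j) (\<xi> v)"
    if "\<xi> \<in> dual (spY M j)" "v \<in> vcarrier (spY M j)" for j \<xi> v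
  proof
    fix y
    show "compY M M (id_on_carrier (P M)) j \<xi> j v y = scal (Y j) (\<xi> v) y"
      using that hom_k_mem[OF lin_P[OF M] inY_hom_k[OF M that(2)]] hom_kD(4)[OF inY_hom_k[OF M that(2)]]
        hom_k_0[OF lin_P[OF M] prY_hom_k[OF M]]
      by (cases "y \<in> vcarrier (Y j)")
        (simp_all add: compY_def scal_def on_carrier_def prY_inY[OF M])
  qed
  moreover have "id_on_carrier (rspace M p) v = v" if "v \<in> vcarrier (rspace M p)" for p v
    using that by (simp add: on_carrier_def)
  ultimately show ?thesis
    by (simp add: rep_top_def top_part_def hom_k_id lin_rspace[OF M] rad_hom_zero kmod_X kmod_Y)
qed

text \<open>Needed to pass from an idempotent \<open>e\<close> to the complementary idempotent
  \<open>1 - e\<close>.\<close>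

lemma rep_top_minus:
  assumes M: "fd_rep (quiver_K \<B>) M" and M': "fd_rep (quiver_K \<B>) M'"
    and \<rho>: "\<rho> \<in> hom_A (P M) (P M')" and \<sigma>: "\<sigma> \<in> hom_A (P M) (P M')"
    and f: "rep_top M M' \<rho> f" and g: "rep_top M M' \<sigma> g"
  shows "rep_top M M' (\<rho> - \<sigma>) (\<lambda>p. f p - g p)"
proof -
  have hom: "f p - g p \<in> hom_k (rspace M p) (rspace M' p)" for p
    by (intro hom_k_minus lin_rspace[OF M'] rep_top_hom_k[OF f] rep_top_hom_k[OF g])
  have \<xi>: "\<xi> ((f p - g p) v) = \<xi> (f p v) - \<xi> (g p v)"
    if "\<xi> \<in> dual (rspace M' p)" "v \<in> vcarrier (rspace M p)" for p \<xi> v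
    using hom_k_diff[OF lin_rspace[OF M'] that(1)[unfolded dual_def]
        hom_kD(1)[OF rep_top_hom_k[OF f] that(2)] hom_kD(1)[OF rep_top_hom_k[OF g] that(2)]] by simp
  note mem = \<rho>_mem[OF M M' \<rho>] \<rho>_mem[OF M M' \<sigma>]
  have "compX M M' (\<rho> - \<sigma>) i \<xi> i v - scal (X i) (\<xi> ((f (VX i) - g (VX i)) v)) \<in> rad_hom (X i) (X i)"
    if "\<xi> \<in> dual (spX M' i)" "v \<in> vcarrier (spX M i)" for i \<xi> v
  proof -
    have "compX M M' (\<rho> - \<sigma>) i \<xi> i v = compX M M' \<rho> i \<xi> i v - compX M M' \<sigma> i \<xi> i v"
      by (simp add: compX_def fun_eq_iff hom_k_diff[OF lin_P[OF M'] prX_hom_k[OF M'] mem])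
    then have eq: "compX M M' (\<rho> - \<sigma>) i \<xi> i v - scal (X i) (\<xi> ((f (VX i) - g (VX i)) v))
        = (compX M M' \<rho> i \<xi> i v - scal (X i) (\<xi> (f (VX i) v)))
          - (compX M M' \<sigma> i \<xi> i v - scal (X i) (\<xi> (g (VX i) v)))"
      unfolding \<xi>[OF that] scal_algebra(2)[OF kmod_X, symmetric] by simp
    show ?thesis
      unfolding eq
      by (rule rad_hom_minus[OF kmod_X kmod_X top_partD(2)[OF f[unfolded rep_top_def, THEN conjunct1] that]
          top_partD(2)[OF g[unfolded rep_top_def, THEN conjunct1] that]])
  qed
  moreover have "compY M M' (\<rho> - \<sigma>) j \<xi> j v - scal (Y j) (\<xi> ((f (VY j) - g (VY j)) v)) \<in> rad_hom (Y j) (Y j)"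
    if "\<xi> \<in> dual (spY M' j)" "v \<in> vcarrier (spY M j)" for j \<xi> v
  proof -
    have "compY M M' (\<rho> - \<sigma>) j \<xi> j v = compY M M' \<rho> j \<xi> j v - compY M M' \<sigma> j \<xi> j v"
      by (simp add: compY_def fun_eq_iff hom_k_diff[OF lin_P[OF M'] prY_hom_k[OF M'] mem])
    then have eq: "compY M M' (\<rho> - \<sigma>) j \<xi> j v - scal (Y j) (\<xi> ((f (VY j) - g (VY j)) v))
        = (compY M M' \<rho> j \<xi> j v - scal (Y j) (\<xi> (f (VY j) v)))
          - (compY M M' \<sigma> j \<xi> j v - scal (Y j) (\<xi> (g (VY j) v)))"
      unfolding \<xi>[OF that] scal_algebra(2)[OF kmod_Y, symmetric] by simp
    show ?thesis
      unfolding eq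
      by (rule rad_hom_minus[OF kmod_Y kmod_Y top_partD(2)[OF f[unfolded rep_top_def, THEN conjunct2] that]
          top_partD(2)[OF g[unfolded rep_top_def, THEN conjunct2] that]])
  qed
  ultimately show ?thesis
    using hom by (auto simp: rep_top_def top_part_def)
qed

text \<open>
  The contractions \<open>prX\<close> are linear over the algebra only on the submodule of vectors without
  \<open>Y\<close>-part. So an idempotent with zero top part is first shown to vanish on this submodule; then
  its compositions with the inclusions \<open>inY\<close> become homomorphisms of modules.
\<close>

lemma idempotent_zero_top:
  assumes M: "fd_rep (quiver_K \<B>) M" and e: "e \<in> hom_A (P M) (P M)" and ee: "e \<circ> e = e"
    and top: "rep_top M M e f" and f: "\<And>p v. v \<in> vcarrier (rspace M p) \<Longrightarrow> f p v = 0"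
  shows "e = 0"
proof -
  note kP = kmod_P[OF M] and lin = lin_P[OF M]
  note ek = hom_AD(1)[OF e]
  note e_mem = \<rho>_mem[OF M M e]
  note basis = dual_basis_props(2)[OF fd_rspace[OF M]]
  note coord = dual_basis_props(3)[OF fd_rspace[OF M]]
  have dual0: "\<xi> (f p v) = 0" if "\<xi> \<in> dual (rspace M p)" "v \<in> vcarrier (rspace M p)" for p \<xi> v
    using f[OF that(2)] hom_k_0[OF lin_rspace[OF M] that(1)[unfolded dual_def]] by simp
  \<comment> \<open>Diagonal entries have residue 0 by the vanishing of \<open>f\<close>; the
    remaining ones are radical as maps between non-isomorphic modules.\<close>
  have radX: "compX M M e i' \<xi> i v \<in> rad_hom (X i) (X i')"
    if "v \<in> vcarrier (spX M i)" "\<xi> \<in> dual (spX M i')" for i i' \<xi> v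
  proof (cases "i = i'")
    case True
    then have "\<xi> (f (VX i) v) = 0"
      using dual0 that by blast
    then show ?thesis
      using top_partD(2)[OF top[unfolded rep_top_def, THEN conjunct1], of \<xi> i v] that True
      by (simp add: scal_algebra(5)[OF kmod_X])
  next
    case False
    then show ?thesis
      using X.off_diagonal_rad compX_hom_A[OF M M e that] by blast
  qed
  have radY: "compY M M e j' \<xi> j v \<in> rad_hom (Y j) (Y j')"
    if "v \<in> vcarrier (spY M j)" "\<xi> \<in> dual (spY M j')" for j j' \<xi> v
  proof (cases "j = j'")
    case True
    then have "\<xi> (f (VY j) v) = 0"
      using dual0 that by blast
    then show ?thesis
      using top_partD(2)[OF top[unfolded rep_top_def, THEN conjunct2], of \<xi> j v] that True
      by (simp add: scal_algebra(5)[OF kmod_Y])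
  next
    case False
    then show ?thesis
      using Y.off_diagonal_rad compY_hom_A[OF M M e that] by blast
  qed
  \<comment> \<open>The \<open>X\<close>-part of \<open>F M\<close>, described as the common kernel
    of all contractions to \<open>Y\<close>, so that the error terms of \<open>prX\<close> visibly
    vanish on it.\<close>
  define C where "C = {t \<in> vcarrier (P M). \<forall>j. \<forall>\<xi>\<in>dual (spY M j). prY M j \<xi> t = 0}"
  \<comment> \<open>\<open>C\<close> as an object of the radical calculus; the action is cut off to
    respect the convention of value 0 outside the carrier.\<close>
  define Q where "Q = \<lparr>vcarrier = C, vscale = vscale (P M), act = \<lambda>a t. if t \<in> C then act (P M) a t else 0\<rparr>"
  have Q: "vcarrier Q = C" "vscale Q = vscale (P M)" "\<And>a t. t \<in> C \<Longrightarrow> act Q a t = act (P M) a t"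
    "\<And>a t. t \<notin> C \<Longrightarrow> act Q a t = 0"
    by (simp_all add: Q_def)
  have CP: "t \<in> vcarrier (P M)" and CY: "\<xi> \<in> dual (spY M j) \<Longrightarrow> prY M j \<xi> t = 0" if "t \<in> C" for t j \<xi>
    using that by (auto simp: C_def)
  have expand_C: "(\<Sum>i\<in>UNIV. \<Sum>b\<in>basis_of (spX M i). inX M i b (prX M i (coord (spX M i) b) t)) = t"
    if t: "t \<in> C" for t
    using expand_P[OF M CP[OF t]] CY[OF t coord] by (simp add: hom_k_0[OF lin_Y inY_hom_k[OF M basis]])
  have act_C: "act (P M) a t \<in> C" if "t \<in> C" for a t
    using that CY[OF that]
    by (auto simp: C_def act_P_mem[OF M] prY_act[OF M] hom_k_0[OF lin_Y kmodD(2)[OF kmod_Y]])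
  have kQ: "kmod Q"
    unfolding kmod_def
  proof (intro conjI allI)
    have "module.subspace (vscale (P M)) C"
      by (rule module.subspaceI[OF lin_space_module[OF lin]])
        (auto simp: C_def lin_space_closed[OF lin] hom_k_0[OF lin prY_hom_k[OF M]]
          hom_kD(2,3)[OF prY_hom_k[OF M]] lin_space_scale[OF lin_Y])
    then show linQ: "lin_space Q"
      using lin by (simp add: lin_space_def Q)
    show "act Q a \<in> hom_k Q Q" for a
      using lin_space_closed[OF linQ] CP hom_kD(2,3)[OF kmodD(2)[OF kP]] act_C
      by (intro hom_kI) (simp_all add: Q)
  qed
  note linQ = kmodD(1)[OF kQ]
  have inX_C: "inX M i v x \<in> C" if "v \<in> vcarrier (spX M i)" for i v x
    using hom_k_mem[OF lin inX_hom_k[OF M that]] by (simp add: C_def prY_inX[OF M])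
  have inX_Q: "inX M i v \<in> hom_A (X i) Q" if v: "v \<in> vcarrier (spX M i)" for i v
    using inX_hom_k[OF M v] inX_C[OF v]
    by (intro hom_AI kmod_X kQ) (auto simp: hom_k_def Q act_inX[OF M v])
  have prX_Q: "on_carrier Q (prX M i \<xi>) \<in> hom_A Q (X i)" if \<xi>: "\<xi> \<in> dual (spX M i)" for i \<xi>
  proof (intro hom_AI hom_kI kmod_X kQ)
    show "on_carrier Q (prX M i \<xi>) (act Q a t) = act (X i) a (on_carrier Q (prX M i \<xi>) t)"
      if "t \<in> vcarrier Q" for a t
      using that
      by (simp add: Q on_carrier_def act_C prX_act[OF M CP \<xi>] CY dual_rmap[OF M _ \<xi>]
          hom_k_0[OF lin_Y cocycle_hom_k])
  qed (use lin_space_closed[OF linQ] hom_kD[OF prX_hom_k[OF M]] CP in \<open>simp_all add: Q on_carrier_def\<close>)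
  define eQ where "eQ = on_carrier Q e"
  have e_inX: "e (inX M i v x) \<in> C" if v: "v \<in> vcarrier (spX M i)" for i v x
    using e_mem prY_\<rho>_inX[OF M M e v] by (simp add: C_def)
  have e_sum: "e t = (\<Sum>i\<in>UNIV. \<Sum>b\<in>basis_of (spX M i).
      e (inX M i b (prX M i (coord (spX M i) b) t)))" if t: "t \<in> C" for t
  proof -
    have "e (\<Sum>i\<in>UNIV. \<Sum>b\<in>basis_of (spX M i). inX M i b (prX M i (coord (spX M i) b) t))
      = (\<Sum>i\<in>UNIV. \<Sum>b\<in>basis_of (spX M i). e (inX M i b (prX M i (coord (spX M i) b) t)))"
      by (rule hom_k_double_sum[OF lin ek CP[OF inX_C[OF basis]]])
    then show ?thesis
      by (simp only: expand_C[OF t])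
  qed
  have e_C: "e t \<in> C" if t: "t \<in> C" for t
    unfolding e_sum[OF t] by (intro lin_space_closed(6)[OF linQ, unfolded Q] e_inX basis)
  have eQ: "eQ \<in> hom_A Q Q"
    unfolding eQ_def
    using lin_space_closed[OF linQ] e_C act_C CP hom_kD(2,3)[OF ek] hom_AD(2)[OF e]
    by (intro hom_AI hom_kI kQ) (simp_all add: Q on_carrier_def)
  \<comment> \<open>\<open>eQ\<close> after an inclusion is a sum of radical entries followed by
    inclusions, which are homomorphisms into \<open>Q\<close>.\<close>
  have eQ_inX: "eQ \<circ> inX M i v \<in> rad_hom (X i) Q" if v: "v \<in> vcarrier (spX M i)" for i v
  proof -
    have "eQ \<circ> inX M i v = (\<Sum>i'\<in>UNIV. \<Sum>b\<in>basis_of (spX M i').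
        inX M i' b \<circ> compX M M e i' (coord (spX M i') b) i v)"
      using \<rho>_inX_expand[OF M M e v] inX_C[OF v]
      by (simp add: fun_eq_iff sum_fun_apply eQ_def on_carrier_def Q)
    also have "\<dots> \<in> rad_hom (X i) Q"
      by (intro rad_hom_sum kmod_X kQ rad_hom_comp_left[OF kmod_X kmod_X kQ radX[OF v coord] inX_Q] basis)
    finally show ?thesis .
  qed
  \<comment> \<open>The expansion of the identity of \<open>Q\<close> composed with
    \<open>eQ\<close>: each summand contains the radical factor
    \<open>eQ \<circ> inX M i b\<close>.\<close>
  have "eQ = (\<Sum>i\<in>UNIV. \<Sum>b\<in>basis_of (spX M i).
      (eQ \<circ> inX M i b) \<circ> on_carrier Q (prX M i (coord (spX M i) b)))" (is "_ = ?s")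
  proof
    fix t
    show "eQ t = ?s t"
    proof (cases "t \<in> C")
      case True
      have "eQ t = (\<Sum>i\<in>UNIV. \<Sum>b\<in>basis_of (spX M i).
          e (inX M i b (prX M i (coord (spX M i) b) t)))"
        using True e_sum[OF True] by (simp add: eQ_def on_carrier_def Q)
      also have "\<dots> = ?s t"
        using True inX_C basis by (simp add: sum_fun_apply eQ_def on_carrier_def Q)
      finally show ?thesis .
    next
      case False
      then have "?s t = (\<Sum>i\<in>UNIV. \<Sum>b\<in>basis_of (spX M i). eQ (inX M i b 0))"
        by (simp add: sum_fun_apply on_carrier_def Q)
      also have "\<dots> = 0"
        using hom_k_0[OF lin_X inX_hom_k[OF M basis]] hom_k_0[OF linQ hom_AD(1)[OF eQ]] by simp
      finally show ?thesis
        using False by (simp add: eQ_def on_carrier_def Q)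
    qed
  qed
  also have "?s \<in> rad_hom Q Q"
    by (intro rad_hom_sum kQ rad_hom_comp_right[OF kQ kmod_X kQ eQ_inX prX_Q[OF coord]] basis)
  finally have "eQ \<in> rad_hom Q Q" .
  moreover have "eQ \<circ> eQ = eQ"
    using fun_cong[OF ee] e_C hom_k_0[OF lin ek] by (auto simp: fun_eq_iff eQ_def on_carrier_def Q)
  ultimately have eQ0: "eQ = 0"
    by (rule rad_hom_idempotent[OF kQ])
  have e0: "e t = 0" if "t \<in> C" for t
    using fun_cong[OF eQ0, of t] that by (simp add: eQ_def on_carrier_def Q)
  \<comment> \<open>The error terms of \<open>inY\<close> lie in \<open>C\<close>, where
    \<open>e\<close> has just been shown to vanish.\<close>
  have e_inY: "e \<circ> inY M j v \<in> hom_A (Y j) (P M)" if v: "v \<in> vcarrier (spY M j)" for j v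
  proof (intro hom_AI hom_k_comp[OF lin lin inY_hom_k[OF M v] ek] kmod_Y kP)
    fix a y assume y: "y \<in> vcarrier (Y j)"
    let ?s = "\<Sum>i\<in>UNIV. \<Sum>\<alpha>\<in>\<B> i j. inX M i (rmap M (i, j, \<alpha>) v) (\<alpha> a y)"
    have "?s \<in> C"
      by (intro lin_space_closed(6)[OF linQ, unfolded Q] inX_C[OF hom_kD(1)[OF rmap_hom_k[OF M] v]])
    then have "e (inY M j v (act (Y j) a y) + ?s) = e (inY M j v (act (Y j) a y))"
      using hom_kD(2)[OF ek hom_k_mem[OF lin inY_hom_k[OF M v]] CP] e0 by simp
    then show "(e \<circ> inY M j v) (act (Y j) a y) = act (P M) a ((e \<circ> inY M j v) y)"
      by (simp add: act_inY[OF M v y, symmetric] hom_AD(2)[OF e])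
  qed
  have inY_mem: "inY M j v y \<in> vcarrier (P M)" if "v \<in> vcarrier (spY M j)" for j v y
    using hom_k_mem[OF lin inY_hom_k[OF M that]] .
  have e_expand: "e t = (\<Sum>j\<in>UNIV. \<Sum>b\<in>basis_of (spY M j).
      e (inY M j b (prY M j (coord (spY M j) b) t)))" if t: "t \<in> vcarrier (P M)" for t
  proof -
    let ?x = "\<Sum>i\<in>UNIV. \<Sum>b\<in>basis_of (spX M i). inX M i b (prX M i (coord (spX M i) b) t)"
    let ?y = "\<lambda>j. \<Sum>b\<in>basis_of (spY M j). inY M j b (prY M j (coord (spY M j) b) t)"
    have x: "?x \<in> C"
      by (intro lin_space_closed(6)[OF linQ, unfolded Q] inX_C basis)
    have y: "?y j \<in> vcarrier (P M)" for j
      by (intro lin_space_closed(6)[OF lin] inY_mem basis)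
    have "e (?x + sum ?y UNIV) = e ?x + e (sum ?y UNIV)"
      by (rule hom_kD(2)[OF ek CP[OF x] lin_space_closed(6)[OF lin y]])
    also have "e (sum ?y UNIV) = (\<Sum>j\<in>UNIV. \<Sum>b\<in>basis_of (spY M j).
        e (inY M j b (prY M j (coord (spY M j) b) t)))"
      by (rule hom_k_double_sum[OF lin ek inY_mem[OF basis]])
    finally show ?thesis
      by (simp add: expand_P[OF M t] e0[OF x])
  qed
  have e_inY_rad: "e \<circ> inY M j v \<in> rad_hom (Y j) (P M)" if v: "v \<in> vcarrier (spY M j)" for j v
  proof -
    \<comment> \<open>By idempotence \<open>e\<close> may be applied twice. The
      \<open>X\<close>-part of the first value is killed by the second \<open>e\<close>, leaving the
      radical entries \<open>compY\<close> followed by homomorphisms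
      \<open>e \<circ> inY M j' b\<close>.\<close>
    have "e \<circ> inY M j v = (\<Sum>j'\<in>UNIV. \<Sum>b\<in>basis_of (spY M j').
        (e \<circ> inY M j' b) \<circ> compY M M e j' (coord (spY M j') b) j v)"
    proof
      fix y
      have "e (inY M j v y) = e (e (inY M j v y))"
        using fun_cong[OF ee, of "inY M j v y"] by simp
      then show "(e \<circ> inY M j v) y = (\<Sum>j'\<in>UNIV. \<Sum>b\<in>basis_of (spY M j').
          (e \<circ> inY M j' b) \<circ> compY M M e j' (coord (spY M j') b) j v) y"
        using e_expand[OF e_mem, of "inY M j v y"] by (simp add: sum_fun_apply compY_def)
    qed
    also have "\<dots> \<in> rad_hom (Y j) (P M)"
      by (intro rad_hom_sum kmod_Y kP rad_hom_comp_left[OF kmod_Y kmod_Y kP radY[OF v coord] e_inY] basis)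
    finally show ?thesis .
  qed
  have prY_A: "prY M j \<xi> \<in> hom_A (P M) (Y j)" if "\<xi> \<in> dual (spY M j)" for j \<xi>
    using prY_act[OF M _ that] by (intro hom_AI kP kmod_Y prY_hom_k[OF M])
  have "e = (\<Sum>j\<in>UNIV. \<Sum>b\<in>basis_of (spY M j).
      (e \<circ> inY M j b) \<circ> prY M j (coord (spY M j) b))" (is "_ = ?r")
  proof
    fix t
    show "e t = ?r t"
    proof (cases "t \<in> vcarrier (P M)")
      case True
      then show ?thesis
        using e_expand by (simp add: sum_fun_apply)
    next
      case False
      then show ?thesis
        using hom_kD(4)[OF ek] hom_kD(4)[OF prY_hom_k[OF M]] hom_k_0[OF lin_Y inY_hom_k[OF M basis]]
          hom_k_0[OF lin ek]
        by (simp add: sum_fun_apply)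
    qed
  qed
  also have "?r \<in> rad_hom (P M) (P M)"
    by (intro rad_hom_sum kP rad_hom_comp_right[OF kP kmod_Y kP e_inY_rad prY_A[OF coord]] basis)
  finally show ?thesis
    using ee by (rule rad_hom_idempotent[OF kP])
qed

section \<open>Transfer of indecomposability and isomorphism between representations and
  modules\<close>

lemma P_nonzero:
  assumes M: "fd_rep (quiver_K \<B>) M" and p: "vcarrier (rspace M p) \<noteq> {0}"
  shows "vcarrier (P M) \<noteq> {0}"
proof -
  obtain v where v: "v \<in> vcarrier (rspace M p)" "v \<noteq> 0"
    using p lin_space_closed(1)[OF lin_rspace[OF M], of p] by blast
  then obtain \<xi> where \<xi>: "\<xi> \<in> dual (rspace M p)" "\<xi> v \<noteq> 0"
    using dual_separates[OF fd_rspace[OF M]] by blast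
  show ?thesis
  proof (cases p)
    case (VX i)
    obtain x where x: "x \<in> vcarrier (X i)" "x \<noteq> 0"
      using indecomposable_nonzero[OF X.indec, of i] lin_space_closed(1)[OF lin_X, of i] by blast
    have "prX M i \<xi> (inX M i v x) \<noteq> 0"
      using v \<xi> x VX by (simp add: prX_inX[OF M] lin_space_scale[OF lin_X])
    then have "inX M i v x \<noteq> 0"
      using hom_k_0[OF lin_P[OF M] prX_hom_k[OF M]] by metis
    moreover have "inX M i v x \<in> vcarrier (P M)"
      using hom_kD(1)[OF inX_hom_k[OF M] x(1)] v VX by simp
    ultimately show ?thesis
      by blast
  next
    case (VY j)
    obtain y where y: "y \<in> vcarrier (Y j)" "y \<noteq> 0"
      using indecomposable_nonzero[OF Y.indec, of j] lin_space_closed(1)[OF lin_Y, of j] by blast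
    have "prY M j \<xi> (inY M j v y) \<noteq> 0"
      using v \<xi> y VY by (simp add: prY_inY[OF M] lin_space_scale[OF lin_Y])
    then have "inY M j v y \<noteq> 0"
      using hom_k_0[OF lin_P[OF M] prY_hom_k[OF M]] by metis
    moreover have "inY M j v y \<in> vcarrier (P M)"
      using hom_kD(1)[OF inY_hom_k[OF M] y(1)] v VY by simp
    ultimately show ?thesis
      by blast
  qed
qed

text \<open>A decomposition of \<open>F M\<close> gives an idempotent \<open>e\<close>, whose top
  part \<open>f\<close> is an idempotent endomorphism of \<open>M\<close>. Image and kernel of
  \<open>f\<close> split \<open>M\<close>, so one of them is 0; accordingly \<open>e\<close> or
  \<open>1 - e\<close> has zero top part and vanishes.\<close>

theorem F_obj_indecomposable:
  assumes "indecomposable_rep (quiver_K \<B>) M"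
  shows "indecomposable_A sA (P M)"
proof -
  have M: "fd_rep (quiver_K \<B>) M" and ne: "\<exists>p. vcarrier (rspace M p) \<noteq> {0}"
    and indec: "\<And>U W. subrep (quiver_K \<B>) M U \<Longrightarrow> subrep (quiver_K \<B>) M W \<Longrightarrow>
      (\<And>p. internal_direct_sum (vcarrier (rspace M p)) (U p) (W p)) \<Longrightarrow>
      (\<forall>p. U p = {0}) \<or> (\<forall>p. W p = {0})"
    using assms by (auto simp: indecomposable_rep_def quiver_K_def)
  note kP = kmod_P[OF M]
  have "U = {0} \<or> W = {0}"
    if U: "submodule (P M) U" and W: "submodule (P M) W"
      and UW: "internal_direct_sum (vcarrier (P M)) U W" for U W
  proof -
    obtain e where e: "e \<in> hom_A (P M) (P M)" "e \<circ> e = e"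
      and eU: "\<And>u. u \<in> U \<Longrightarrow> e u = u" and eW: "\<And>w. w \<in> W \<Longrightarrow> e w = 0"
      using direct_sum_projection[OF kP U W UW] by metis
    obtain f where f: "rep_top M M e f"
      using rep_top_exists[OF M M e(1)] by blast
    note hom = rep_top_hom_k[OF f]
    \<comment> \<open>Both \<open>f \<circ> f\<close> and \<open>f\<close> are top parts of
      \<open>e = e \<circ> e\<close>, and top parts are unique.\<close>
    have ff: "f p (f p v) = f p v" for p v
      using rep_top_unique[OF M M e(1) rep_top_comp[OF M M M e(1) e(1) f f, unfolded e(2)] f, of p]
      by (metis comp_apply)
    have rh: "f (VX i) (rmap M (i, j, \<alpha>) v) = rmap M (i, j, \<alpha>) (f (VY j) v)" if "\<alpha> \<in> \<B> i j" for i j \<alpha> v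
      using rep_top_rep_hom[OF M M e(1) f] that unfolding rep_hom_quiver_K by (metis comp_apply)
    define I where "I p = f p ` vcarrier (rspace M p)" for p
    define K where "K p = {v \<in> vcarrier (rspace M p). f p v = 0}" for p
    note linM = lin_rspace[OF M]
    note closed = lin_space_closed[OF linM]
    have subI: "module.subspace (vscale (rspace M p)) (I p)" for p
      unfolding I_def by (rule hom_k_image_subspace[OF linM linM hom])
    have subK: "module.subspace (vscale (rspace M p)) (K p)" for p
      by (rule module.subspaceI[OF lin_space_module[OF linM]])
        (auto simp: K_def closed hom_k_0[OF linM hom] hom_kD(2,3)[OF hom] lin_space_scale[OF linM])
    have "subrep (quiver_K \<B>) M I"
      unfolding subrep_quiver_K
    proof (intro conjI allI ballI)
      show "rmap M (i, j, \<alpha>) u \<in> I (VX i)" if \<alpha>: "\<alpha> \<in> \<B> i j" and u: "u \<in> I (VY j)" for i j \<alpha> u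
      proof -
        obtain v where v: "v \<in> vcarrier (spY M j)" "u = f (VY j) v"
          using u by (auto simp: I_def)
        show ?thesis
          unfolding v(2) rh[OF \<alpha>, symmetric] I_def
          by (intro imageI hom_kD(1)[OF rmap_hom_k[OF M \<alpha>] v(1)])
      qed
    qed (use subI hom_kD(1)[OF hom] in \<open>auto simp: I_def\<close>)
    moreover have "subrep (quiver_K \<B>) M K"
      unfolding subrep_quiver_K
    proof (intro conjI allI ballI)
      show "rmap M (i, j, \<alpha>) u \<in> K (VX i)" if \<alpha>: "\<alpha> \<in> \<B> i j" and u: "u \<in> K (VY j)" for i j \<alpha> u
        using u hom_kD(1)[OF rmap_hom_k[OF M \<alpha>]] hom_k_0[OF linM rmap_hom_k[OF M \<alpha>]]
        by (simp add: K_def rh[OF \<alpha>])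
    qed (use subK in \<open>auto simp: K_def\<close>)
    moreover have "internal_direct_sum (vcarrier (rspace M p)) (I p) (K p)" for p
      unfolding internal_direct_sum_def
    proof
      show "I p \<inter> K p = {0}"
        using module.subspace_0[OF lin_space_module[OF linM] subI]
          module.subspace_0[OF lin_space_module[OF linM] subK] ff
        by (auto simp: I_def K_def)
      have "v \<in> {u + w | u w. u \<in> I p \<and> w \<in> K p}" if v: "v \<in> vcarrier (rspace M p)" for v
      proof -
        have "v - f p v \<in> K p"
          using v hom_k_diff[OF linM hom v hom_kD(1)[OF hom v]] hom_kD(1)[OF hom v] ff closed(3)
          by (simp add: K_def)
        moreover have "v = f p v + (v - f p v)"
          by simp
        ultimately show ?thesis
          using v unfolding I_def by blast
      qed
      then show "vcarrier (rspace M p) = {u + w | u w. u \<in> I p \<and> w \<in> K p}"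
        using closed(2) hom_kD(1)[OF hom] by (auto simp: I_def K_def)
    qed
    ultimately have "(\<forall>p. I p = {0}) \<or> (\<forall>p. K p = {0})"
      by (rule indec)
    then show ?thesis
    proof
      assume "\<forall>p. I p = {0}"
      then have "f p v = 0" if "v \<in> vcarrier (rspace M p)" for p v
        using that unfolding I_def by blast
      then have "e = 0"
        by (rule idempotent_zero_top[OF M e f])
      then have "u = 0" if "u \<in> U" for u
        using eU[OF that] by simp
      then show ?thesis
        using UW by (auto simp: internal_direct_sum_def)
    next
      assume K: "\<forall>p. K p = {0}"
      let ?id = "id_on_carrier (P M)"
      \<comment> \<open>Since \<open>v - f p v\<close> lies in the zero kernel of
        \<open>f p\<close>, the idempotent \<open>f p\<close> is the identity.\<close>
      have "(id_on_carrier (rspace M p) - f p) v = 0" if v: "v \<in> vcarrier (rspace M p)" for p v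
      proof -
        have "v - f p v \<in> K p"
          using v hom_k_diff[OF linM hom v hom_kD(1)[OF hom v]] hom_kD(1)[OF hom v] ff closed(3)
          by (simp add: K_def)
        then show ?thesis
          using K v by (simp add: on_carrier_def)
      qed
      moreover have "rep_top M M (?id - e) (\<lambda>p. id_on_carrier (rspace M p) - f p)"
        by (rule rep_top_minus[OF M M hom_A_id[OF kP] e(1) rep_top_id[OF M] f])
      moreover have ide: "?id - e \<in> hom_A (P M) (P M)"
        by (rule hom_A_minus[OF kP kP hom_A_id[OF kP] e(1)])
      moreover have "(?id - e) \<circ> (?id - e) = ?id - e"
      proof (rule hom_A_eqI[OF hom_A_comp[OF kP kP kP ide ide] ide])
        fix t assume t: "t \<in> vcarrier (P M)"
        note et = hom_kD(1)[OF hom_AD(1)[OF e(1)] t]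
        have "e (t - e t) = 0"
          using hom_k_diff[OF lin_P[OF M] hom_AD(1)[OF e(1)] t et] fun_cong[OF e(2), of t] by simp
        then show "((?id - e) \<circ> (?id - e)) t = (?id - e) t"
          using t et lin_space_closed(3)[OF lin_P[OF M] t et] by (simp add: on_carrier_def)
      qed
      ultimately have "?id - e = 0"
        using idempotent_zero_top[OF M] by blast
      then have "(?id - e) w = 0" for w
        by (simp only: zero_fun_apply)
      then have "w = 0" if "w \<in> W" for w
        using eW[OF that] that W by (metis (no_types, lifting) fun_diff_def on_carrier_def submodule_def subsetD diff_zero)
      then show ?thesis
        using UW by (auto simp: internal_direct_sum_def)
    qed
  qed
  then show ?thesis
    using fd_module_P[OF M] P_nonzero[OF M] ne by (auto simp: indecomposable_A_def)
qed

text \<open>The top parts of an isomorphism and of its inverse compose to top parts of identities;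
  uniqueness forces them to be mutually inverse.\<close>

theorem F_obj_reflects_iso:
  assumes M: "fd_rep (quiver_K \<B>) M" and M': "fd_rep (quiver_K \<B>) M'" and iso: "iso_A (P M) (P M')"
  shows "rep_iso (quiver_K \<B>) M M'"
proof -
  note kP = kmod_P[OF M] and kP' = kmod_P[OF M']
  obtain \<rho> where \<rho>: "\<rho> \<in> hom_A (P M) (P M')" "bij_betw \<rho> (vcarrier (P M)) (vcarrier (P M'))"
    using iso by (auto simp: iso_A_def)
  obtain \<sigma> where \<sigma>: "\<sigma> \<in> hom_A (P M') (P M)" "\<sigma> \<circ> \<rho> = id_on_carrier (P M)" "\<rho> \<circ> \<sigma> = id_on_carrier (P M')"
    using hom_A_inv[OF kP kP' \<rho>] by metis
  obtain f where f: "rep_top M M' \<rho> f"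
    using rep_top_exists[OF M M' \<rho>(1)] by blast
  obtain g where g: "rep_top M' M \<sigma> g"
    using rep_top_exists[OF M' M \<sigma>(1)] by blast
  have gf: "g p \<circ> f p = id_on_carrier (rspace M p)" for p
    by (rule rep_top_unique[OF M M hom_A_id[OF kP] rep_top_comp[OF M M' M \<rho>(1) \<sigma>(1) f g, unfolded \<sigma>(2)]
          rep_top_id[OF M]])
  have fg: "f p \<circ> g p = id_on_carrier (rspace M' p)" for p
    by (rule rep_top_unique[OF M' M' hom_A_id[OF kP'] rep_top_comp[OF M' M M' \<sigma>(1) \<rho>(1) g f, unfolded \<sigma>(3)]
          rep_top_id[OF M']])
  have "bij_betw (f p) (vcarrier (rspace M p)) (vcarrier (rspace M' p))" for p
  proof (rule bij_betw_byWitness[where f' = "g p"])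
    show "\<forall>v\<in>vcarrier (rspace M p). g p (f p v) = v"
      using fun_cong[OF gf] by (simp add: on_carrier_def)
    show "\<forall>v\<in>vcarrier (rspace M' p). f p (g p v) = v"
      using fun_cong[OF fg] by (simp add: on_carrier_def)
  qed (use hom_kD(1)[OF rep_top_hom_k[OF f]] hom_kD(1)[OF rep_top_hom_k[OF g]] in auto)
  then show ?thesis
    using rep_top_rep_hom[OF M M' \<rho>(1) f] by (auto simp: rep_iso_def)
qed

end

text \<open>\<open>f\<close> is recovered from its extension to the direct sums by composing with an
  inclusion and a projection, and that extension is 0.\<close>

lemma hom_A_summands_zero:
  fixes X :: "'i \<Rightarrow> ('a, 'k::field, 'x::ab_group_add) amodule"
    and Y :: "'j \<Rightarrow> ('a, 'k, 'y::ab_group_add) amodule"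
  assumes X: "\<And>i. kmod (X i)" and Y: "\<And>j. kmod (Y j)"
    and zero: "hom_A (direct_sum X) (direct_sum Y) = {0}" and f: "f \<in> hom_A (X i) (Y j)"
  shows "f = 0"
proof -
  note kX = kmod_direct_sum[of X, OF X] and kY = kmod_direct_sum[of Y, OF Y]
  have "ds_incl Y j \<circ> (f \<circ> ds_proj X i) \<in> hom_A (direct_sum X) (direct_sum Y)"
    by (rule hom_A_comp[OF kX Y kY hom_A_comp[OF kX X Y ds_proj_hom_A[of X, OF X] f]
          ds_incl_hom_A[of Y, OF Y]])
  then have 0: "ds_incl Y j \<circ> (f \<circ> ds_proj X i) = 0"
    using zero by blast
  have "f = (ds_proj Y j \<circ> ds_incl Y j) \<circ> (f \<circ> (ds_proj X i \<circ> ds_incl X i))"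
    by (simp only: ds_proj_incl[of X, OF X] ds_proj_incl[of Y, OF Y] hom_A_id_comp[OF X Y f])
  also have "\<dots> = ds_proj Y j \<circ> (ds_incl Y j \<circ> (f \<circ> ds_proj X i)) \<circ> ds_incl X i"
    by (simp only: o_assoc)
  also have "\<dots> = 0"
    unfolding 0 using hom_k_0[OF kmodD(1)[OF kY] hom_AD(1)[OF ds_proj_hom_A[of Y, OF Y]]]
    by (simp add: fun_eq_iff)
  finally show ?thesis .
qed

theorem proposition4p3p2:
  fixes sA :: "'k::alg_closed_field \<Rightarrow> 'a::ring_1 \<Rightarrow> 'a"
    and X :: "'i::finite \<Rightarrow> ('a, 'k, 'x::ab_group_add) amodule"
    and Y :: "'j::finite \<Rightarrow> ('a, 'k, 'y::ab_group_add) amodule"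
    and \<B> :: "'i \<Rightarrow> 'j \<Rightarrow> ('a \<Rightarrow> 'y \<Rightarrow> 'x) set"
  assumes algebra: "k_algebra sA"
    and X_indecomposable: "\<And>i. indecomposable_A sA (X i)"
    and X_non_iso: "\<And>i i'. i \<noteq> i' \<Longrightarrow> \<not> iso_A (X i) (X i')"
    and Y_indecomposable: "\<And>j. indecomposable_A sA (Y j)"
    and Y_non_iso: "\<And>j j'. j \<noteq> j' \<Longrightarrow> \<not> iso_A (Y j) (Y j')"
    and hom_X_Y: "hom_A (direct_sum X) (direct_sum Y) = {0}"
    and basis: "\<And>i j. basis_modulo (cocycle_scale (X i)) (Z1 sA (Y j) (X i))
                  (RadZ_plus_B sA (direct_sum X) (direct_sum Y) (Y j) (X i)) (\<B> i j)"
  shows "(\<forall>M :: ('k, 'v::ab_group_add, ('i, 'j) vertex, ('i, 'j, 'a, 'x, 'y) arrow) quiver_rep.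
           indecomposable_rep (quiver_K \<B>) M \<longrightarrow> indecomposable_A sA (F_obj X Y \<B> M)) \<and>
         (\<forall>(M :: ('k, 'v::ab_group_add, ('i, 'j) vertex, ('i, 'j, 'a, 'x, 'y) arrow) quiver_rep)
          (M' :: ('k, 'w::ab_group_add, ('i, 'j) vertex, ('i, 'j, 'a, 'x, 'y) arrow) quiver_rep).
           fd_rep (quiver_K \<B>) M \<and> fd_rep (quiver_K \<B>) M' \<and>
           iso_A (F_obj X Y \<B> M) (F_obj X Y \<B> M') \<longrightarrow> rep_iso (quiver_K \<B>) M M')"
proof -
  note kX = indecomposable_kmod[OF X_indecomposable] and kY = indecomposable_kmod[OF Y_indecomposable]
  interpret independent_cocycle_family sA X Y \<B>
  proof
    show "fd_module sA (X i)" "fd_module sA (Y j)" for i j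
      by (rule indecomposable_fd_module[OF X_indecomposable] indecomposable_fd_module[OF Y_indecomposable])+
    show "\<B> i j \<subseteq> Z1 sA (Y j) (X i)" for i j
      using basis[of i j] by (simp add: basis_modulo_def)
    show "f = 0" if "f \<in> hom_A (X i) (Y j)" for i j f
      using hom_A_summands_zero[of X Y, OF kX kY hom_X_Y that] .
    show "c \<alpha> = 0" if "(\<Sum>\<alpha>\<in>\<B> i j. cocycle_scale (X i) (c \<alpha>) \<alpha>)
        \<in> RadZ_plus_B sA (direct_sum X) (direct_sum Y) (Y j) (X i)" "\<alpha> \<in> \<B> i j" for i j c \<alpha>
      using basis[of i j] that unfolding basis_modulo_def by blast
  qed (use X_indecomposable X_non_iso Y_indecomposable Y_non_iso in auto)
  show ?thesis
    using F_obj_indecomposable F_obj_reflects_iso by blast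
qed

end
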